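(* Let $n\ge 2$ and let $\phi: M^n \rightarrow \mathbb R^{n+1}$ be a (positive definite) hyperbolic affine hypersphere with mean curvature $\lambda$, $\lambda<0$, with affine metric $h$ and difference tensor $K$. Assume that there exist two (smooth) distributions $\mathcal D_1$ and $\mathcal D_2$ on $M$ such that (i) $T_pM = \mathcal D_1(p) \oplus \mathcal D_2(p)$ for every $p\in M$; (ii) $\mathcal D_1$ and $\mathcal D_2$ are orthogonal with respect to $h$; (iii) $\mathcal D_1$ is a one-dimensional distribution spanned by a vector field $T$ of unit length with respect to $h$; (iv) there exist real numbers $\lambda_1$ and $\lambda_2$ satisfying $-\lambda+\lambda_1 \lambda_2 -\lambda_2^2= 0$ such that $K(T,T)=\lambda_1 T$ and $K(T,U) = \lambda_2 U$ for every $U \in \mathcal D_2$. Then $\phi$ can be decomposed (locally, in the sense defined in the context) as the Calabi product of a hyperbolic affine hypersphere $\psi:M_1^{n-1} \rightarrow \mathbb R^{n}$ and a point.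
   Context: Affine hypersurfaces. $\mathbb R^{n+1}$ carries its standard flat connection $D$ and the volume form $\det$. Let $\phi:M^n\to\mathbb R^{n+1}$ be a (smooth) nondegenerate hypersurface immersion. Its affine normal $\xi$ is the canonical (Blaschke) transversal vector field: writing $D_XY=\nabla_XY+h(X,Y)\xi$ (with $\nabla_XY$ tangent and $\phi$ suppressed from the notation), $\xi$ is determined (up to sign) by requiring that $D_X\xi$ is tangent for all $X$ and that $|\det(X_1,\dots,X_n,\xi)|=|\det (h(X_i,X_j))|^{1/2}$ for all tangent $X_1,\dots,X_n$. Then $h$ is called the affine metric, $\nabla$ the induced affine connection, and the affine shape operator $S$ is defined by $D_X\xi=-SX$. The sign of $\xi$ is chosen so that $h$ is positive definite (this is possible by assumption: all affine hyperspheres considered are positive definite). $\widehat\nabla$ denotes the Levi-Civita connection of $h$, and the difference tensor is $K(X,Y)=K_XY=\nabla_XY-\widehat\nabla_XY$. $M$ is an affine hypersphere with mean curvature $\lambda$ if $S=\lambda I$ with $\lambda$ constant; it is hyperbolic if $\lambda<0$ (all affine normals then pass through a fixed point, the center). If $\lambda=-1$ and the center is the origin, then $\xi=\phi$. All hyperbolic affine hyperspheres of mean curvature $-1$ occurring as factors of a Calabi product are taken with center at the origin. Calabi product with a point. Let $\psi_1:M_1^{n-1}\to\mathbb R^{n}$ be a hyperbolic affine hypersphere with mean curvature $-1$. The Calabi product of $M_1$ with a point is the immersion $$\tilde\psi(t,p)=\bigl(c_1e^{t/\sqrt n}\,\psi_1(p),\;c_2e^{-\sqrt n\,t}\bigr)\in\mathbb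 R^{n}\times\mathbb R,\qquad p\in M_1,\ t\in\mathbb R,$$ with nonzero constants $c_1,c_2$. "$\phi$ can be decomposed as the Calabi product of a hyperbolic affine hypersphere $\psi$ and a point" means: every point of $M$ has a neighbourhood which can be identified (by a diffeomorphism) with $I\times M_1$, $I\subset\mathbb R$ an open interval and $M_1$ an $(n-1)$-dimensional manifold, such that on this neighbourhood $\phi$ coincides, up to an affine transformation of $\mathbb R^{n+1}$, with the Calabi product $\tilde\psi(t,p)=\bigl(c_1e^{t/\sqrt n}\,\psi_1(p),\;c_2e^{-\sqrt n\,t}\bigr)$ of $M_1$ with a point, for some nonzero constants $c_1,c_2$ (restricted to $t\in I$), for some hyperbolic affine hypersphere $\psi=\psi_1:M_1\to\mathbb R^n$ with mean curvature $-1$. *)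

theory Defs
  imports "HOL-Analysis.Analysis"
begin

section \<open>Smooth functions on open subsets of Euclidean space\<close>

text \<open>Meant for open \<open>S\<close>. All iterated directional derivatives exist and are continuous.\<close>

primrec Ck_on :: "nat \<Rightarrow> 'v::real_normed_vector set \<Rightarrow> ('v \<Rightarrow> 'w::real_normed_vector) \<Rightarrow> bool" where
  "Ck_on 0 S f \<longleftrightarrow> continuous_on S f"
| "Ck_on (Suc k) S f \<longleftrightarrow> (\<forall>x\<in>S. f differentiable (at x)) \<and>
     (\<forall>v. Ck_on k S (\<lambda>x. frechet_derivative f (at x) v))"

definition smooth_on :: "'v::real_normed_vector set \<Rightarrow> ('v \<Rightarrow> 'w::real_normed_vector) \<Rightarrow> bool" where
  "smooth_on S f \<longleftrightarrow> (\<forall>k. Ck_on k S f)"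

section \<open>Smooth manifolds\<close>

text \<open>The dimension of a manifold of type \<open>('a, 'n) manifold\<close> is \<open>CARD('n)\<close>. A chart is a pair of
  its domain and the coordinate map, whose values outside the domain are irrelevant.\<close>

type_synonym ('a, 'n) chart = "'a set \<times> ('a \<Rightarrow> real ^ 'n)"

record ('a, 'n) manifold =
  mtop :: "'a topology"
  atlas :: "('a, 'n) chart set"

abbreviation pts :: "('a, 'n) manifold \<Rightarrow> 'a set" where
  "pts M \<equiv> topspace (mtop M)"

definition smooth_manifold :: "('a, 'n::finite) manifold \<Rightarrow> bool" where
  "smooth_manifold M \<longleftrightarrow>
     Hausdorff_space (mtop M) \<and> second_countable (mtop M) \<and>
     pts M = (\<Union>(U, c)\<in>atlas M. U) \<and>
     (\<forall>(U, c)\<in>atlas M. openin (mtop M) U \<and> open (c ` U) \<and>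
        homeomorphic_map (subtopology (mtop M) U) (top_of_set (c ` U)) c) \<and>
     (\<forall>(U, c)\<in>atlas M. \<forall>(V, d)\<in>atlas M. smooth_on (c ` (U \<inter> V)) (d \<circ> inv_into U c))"

definition smooth_fun ::
  "('a, 'n::finite) manifold \<Rightarrow> 'a set \<Rightarrow> ('a \<Rightarrow> 'v::real_normed_vector) \<Rightarrow> bool" where
  "smooth_fun M W F \<longleftrightarrow> (\<forall>(U, c)\<in>atlas M. smooth_on (c ` (U \<inter> W)) (F \<circ> inv_into U c))"

definition smooth_map ::
  "('a, 'm::finite) manifold \<Rightarrow> ('b, 'n::finite) manifold \<Rightarrow> ('a \<Rightarrow> 'b) \<Rightarrow> bool" where
  "smooth_map M N f \<longleftrightarrow> continuous_map (mtop M) (mtop N) f \<and>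
     (\<forall>(U, c)\<in>atlas M. \<forall>(V, d)\<in>atlas N.
        smooth_on (c ` {p \<in> U. f p \<in> V}) (d \<circ> f \<circ> inv_into U c))"

definition diffeomorphism ::
  "('a, 'm::finite) manifold \<Rightarrow> ('b, 'n::finite) manifold \<Rightarrow> ('a \<Rightarrow> 'b) \<Rightarrow> bool" where
  "diffeomorphism M N f \<longleftrightarrow> bij_betw f (pts M) (pts N) \<and>
     smooth_map M N f \<and> smooth_map N M (inv_into (pts M) f)"

definition open_submanifold :: "('a, 'n) manifold \<Rightarrow> 'a set \<Rightarrow> ('a, 'n) manifold" where
  "open_submanifold M W =
     \<lparr> mtop = subtopology (mtop M) W, atlas = (\<lambda>(U, c). (U \<inter> W, c)) ` atlas M \<rparr>"

text \<open>\<open>I \<times> M\<close> for an open set \<open>I\<close> of reals; the additional coordinate, with index \<open>None\<close>, is the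
  one of \<open>I\<close>.\<close>

definition interval_times ::
  "real set \<Rightarrow> ('a, 'n::finite) manifold \<Rightarrow> (real \<times> 'a, 'n option) manifold" where
  "interval_times I M =
     \<lparr> mtop = prod_topology (top_of_set I) (mtop M),
       atlas = (\<lambda>(U, c). (I \<times> U,
                 \<lambda>(t, p). \<chi> a. case a of None \<Rightarrow> t | Some i \<Rightarrow> c p $ i)) ` atlas M \<rparr>"

section \<open>Tangent vectors, vector fields, distributions\<close>

text \<open>The tangent space of \<open>M\<close> at \<open>p\<close> is \<open>real ^ 'n\<close>: a tangent vector is given by its components in
  one chart around \<open>p\<close> that is chosen once and for all. As this preferred chart
  varies with \<open>p\<close> in an uncontrolled way, smoothness of a vector field has to be tested on its
  components in fixed charts.\<close>

definition chart_at :: "('a, 'n) manifold \<Rightarrow> 'a \<Rightarrow> ('a, 'n) chart" where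
  "chart_at M p = (SOME C. C \<in> atlas M \<and> p \<in> fst C)"

text \<open>The derivative of a vector-valued function at \<open>p\<close> in direction of the tangent vector \<open>u\<close>. For a
  coordinate map \<open>c\<close>, \<open>mderiv M c p u\<close> is the vector of components of \<open>u\<close> in the chart \<open>c\<close>.\<close>

definition mderiv ::
  "('a, 'n::finite) manifold \<Rightarrow> ('a \<Rightarrow> 'v::real_normed_vector) \<Rightarrow> 'a \<Rightarrow> real ^ 'n \<Rightarrow> 'v" where
  "mderiv M F p u =
     (case chart_at M p of (U, c) \<Rightarrow> frechet_derivative (F \<circ> inv_into U c) (at (c p)) u)"

definition vector_field ::
  "('a, 'n::finite) manifold \<Rightarrow> 'a set \<Rightarrow> ('a \<Rightarrow> real ^ 'n) \<Rightarrow> bool" where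
  "vector_field M W X \<longleftrightarrow>
     (\<forall>(U, c)\<in>atlas M. smooth_fun M (U \<inter> W) (\<lambda>q. mderiv M c q (X q)))"

definition smooth_distribution ::
  "('a, 'n::finite) manifold \<Rightarrow> ('a \<Rightarrow> (real ^ 'n) set) \<Rightarrow> bool" where
  "smooth_distribution M D \<longleftrightarrow>
     (\<forall>p\<in>pts M. \<exists>W k X. openin (mtop M) W \<and> p \<in> W \<and>
        (\<forall>i<k. vector_field M W (X i)) \<and>
        (\<forall>q\<in>W. D q = span ((\<lambda>i. X i q) ` {..<k}) \<and> dim (D q) = (k::nat)))"

section \<open>Connections\<close>

text \<open>A connection acts on vector fields defined on open subsets of \<open>M\<close>.\<close>

type_synonym ('a, 'n) connection =
  "('a \<Rightarrow> real ^ 'n) \<Rightarrow> ('a \<Rightarrow> real ^ 'n) \<Rightarrow> 'a \<Rightarrow> real ^ 'n"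

type_synonym ('a, 'n) bilinear_field = "'a \<Rightarrow> real ^ 'n \<Rightarrow> real ^ 'n \<Rightarrow> real"

type_synonym ('a, 'n) tensor21 = "'a \<Rightarrow> real ^ 'n \<Rightarrow> real ^ 'n \<Rightarrow> real ^ 'n"

definition affine_connection ::
  "('a, 'n::finite) manifold \<Rightarrow> ('a, 'n) connection \<Rightarrow> bool" where
  "affine_connection M nabla \<longleftrightarrow>
     (\<forall>W X Y Z f. openin (mtop M) W \<longrightarrow> vector_field M W X \<longrightarrow> vector_field M W Y \<longrightarrow>
        vector_field M W Z \<longrightarrow> smooth_fun M W (f :: 'a \<Rightarrow> real) \<longrightarrow>
        vector_field M W (nabla X Y) \<and>
        (\<forall>p\<in>W.
           nabla (\<lambda>q. X q + Y q) Z p = nabla X Z p + nabla Y Z p \<and>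
           nabla (\<lambda>q. f q *\<^sub>R X q) Y p = f p *\<^sub>R nabla X Y p \<and>
           nabla X (\<lambda>q. Y q + Z q) p = nabla X Y p + nabla X Z p \<and>
           nabla X (\<lambda>q. f q *\<^sub>R Y q) p = mderiv M f p (X p) *\<^sub>R Y p + f p *\<^sub>R nabla X Y p))"

text \<open>The bracket \<open>[X, Y]\<close> is given by its action \<open>X (Y f) - Y (X f)\<close> on functions \<open>f\<close>.\<close>

definition torsion_free ::
  "('a, 'n::finite) manifold \<Rightarrow> ('a, 'n) connection \<Rightarrow> bool" where
  "torsion_free M nabla \<longleftrightarrow>
     (\<forall>W X Y f. openin (mtop M) W \<longrightarrow> vector_field M W X \<longrightarrow> vector_field M W Y \<longrightarrow>
        smooth_fun M W (f :: 'a \<Rightarrow> real) \<longrightarrow>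
        (\<forall>p\<in>W. mderiv M f p (nabla X Y p - nabla Y X p) =
           mderiv M (\<lambda>q. mderiv M f q (Y q)) p (X p) -
           mderiv M (\<lambda>q. mderiv M f q (X q)) p (Y p)))"

definition metric_connection ::
  "('a, 'n::finite) manifold \<Rightarrow> ('a, 'n) bilinear_field \<Rightarrow> ('a, 'n) connection \<Rightarrow> bool" where
  "metric_connection M h nabla \<longleftrightarrow>
     (\<forall>W X Y Z. openin (mtop M) W \<longrightarrow> vector_field M W X \<longrightarrow> vector_field M W Y \<longrightarrow>
        vector_field M W Z \<longrightarrow>
        (\<forall>p\<in>W. mderiv M (\<lambda>q. h q (Y q) (Z q)) p (X p) =
           h p (nabla X Y p) (Z p) + h p (Y p) (nabla X Z p)))"

definition levi_civita_connection ::
  "('a, 'n::finite) manifold \<Rightarrow> ('a, 'n) bilinear_field \<Rightarrow> ('a, 'n) connection \<Rightarrow> bool" where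
  "levi_civita_connection M h nabla \<longleftrightarrow>
     affine_connection M nabla \<and> torsion_free M nabla \<and> metric_connection M h nabla"

section \<open>Affine hypersurfaces\<close>

text \<open>Hypersurfaces of dimension \<open>CARD('n)\<close> lie in \<open>real ^ 'n option\<close>, and the differential
  \<open>mderiv M \<phi> p\<close> embeds the tangent space at \<open>p\<close> into that space.\<close>

definition hypersurface_immersion ::
  "('a, 'n::finite) manifold \<Rightarrow> ('a \<Rightarrow> real ^ 'n option) \<Rightarrow> bool" where
  "hypersurface_immersion M \<phi> \<longleftrightarrow> smooth_fun M (pts M) \<phi> \<and> (\<forall>p\<in>pts M. inj (mderiv M \<phi> p))"

text \<open>The derivative \<open>D\<^sub>X Y\<close> of the field \<open>Y\<close>, regarded as an ambient-valued map, along \<open>X\<close>.\<close>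

definition flat_deriv ::
  "('a, 'n::finite) manifold \<Rightarrow> ('a \<Rightarrow> real ^ 'n option) \<Rightarrow>
   ('a \<Rightarrow> real ^ 'n) \<Rightarrow> ('a \<Rightarrow> real ^ 'n) \<Rightarrow> 'a \<Rightarrow> real ^ 'n option" where
  "flat_deriv M \<phi> X Y p = mderiv M (\<lambda>q. mderiv M \<phi> q (Y q)) p (X p)"

definition transversal_field ::
  "('a, 'n::finite) manifold \<Rightarrow> ('a \<Rightarrow> real ^ 'n option) \<Rightarrow> ('a \<Rightarrow> real ^ 'n option) \<Rightarrow> bool" where
  "transversal_field M \<phi> \<xi> \<longleftrightarrow>
     smooth_fun M (pts M) \<xi> \<and> (\<forall>p\<in>pts M. \<xi> p \<notin> range (mderiv M \<phi> p))"

definition gauss_formula ::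
  "('a, 'n::finite) manifold \<Rightarrow> ('a \<Rightarrow> real ^ 'n option) \<Rightarrow> ('a \<Rightarrow> real ^ 'n option) \<Rightarrow>
   ('a, 'n) connection \<Rightarrow> ('a, 'n) bilinear_field \<Rightarrow> bool" where
  "gauss_formula M \<phi> \<xi> nabla h \<longleftrightarrow>
     (\<forall>W X Y. openin (mtop M) W \<longrightarrow> vector_field M W X \<longrightarrow> vector_field M W Y \<longrightarrow>
        (\<forall>p\<in>W. flat_deriv M \<phi> X Y p =
           mderiv M \<phi> p (nabla X Y p) + h p (X p) (Y p) *\<^sub>R \<xi> p))"

text \<open>\<open>D\<^sub>X \<xi> = - S X\<close>; this includes that \<open>D\<^sub>X \<xi>\<close> is tangent.\<close>

definition weingarten_formula ::
  "('a, 'n::finite) manifold \<Rightarrow> ('a \<Rightarrow> real ^ 'n option) \<Rightarrow> ('a \<Rightarrow> real ^ 'n option) \<Rightarrow>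
   ('a \<Rightarrow> real ^ 'n \<Rightarrow> real ^ 'n) \<Rightarrow> bool" where
  "weingarten_formula M \<phi> \<xi> S \<longleftrightarrow>
     (\<forall>p\<in>pts M. \<forall>u. mderiv M \<xi> p u = - mderiv M \<phi> p (S p u))"

definition volume_condition ::
  "('a, 'n::finite) manifold \<Rightarrow> ('a \<Rightarrow> real ^ 'n option) \<Rightarrow> ('a \<Rightarrow> real ^ 'n option) \<Rightarrow>
   ('a, 'n) bilinear_field \<Rightarrow> bool" where
  "volume_condition M \<phi> \<xi> h \<longleftrightarrow>
     (\<forall>p\<in>pts M. \<forall>X :: 'n \<Rightarrow> real ^ 'n.
        \<bar>det (\<chi> a. case a of None \<Rightarrow> \<xi> p | Some i \<Rightarrow> mderiv M \<phi> p (X i))\<bar> =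
        sqrt \<bar>det (\<chi> i j. h p (X i) (X j))\<bar>)"

text \<open>\<open>\<xi>\<close>, \<open>nabla\<close>, \<open>h\<close> and \<open>S\<close> are the affine normal, the induced connection, the affine metric and
  the affine shape operator of the positive definite hypersurface \<open>\<phi>\<close>. They are uniquely
  determined by \<open>\<phi>\<close>; positive definiteness of \<open>h\<close> implies nondegeneracy of \<open>\<phi>\<close> and fixes the sign
  of \<open>\<xi>\<close>.\<close>

definition blaschke_structure ::
  "('a, 'n::finite) manifold \<Rightarrow> ('a \<Rightarrow> real ^ 'n option) \<Rightarrow> ('a \<Rightarrow> real ^ 'n option) \<Rightarrow>
   ('a, 'n) connection \<Rightarrow> ('a, 'n) bilinear_field \<Rightarrow> ('a \<Rightarrow> real ^ 'n \<Rightarrow> real ^ 'n) \<Rightarrow> bool" where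
  "blaschke_structure M \<phi> \<xi> nabla h S \<longleftrightarrow>
     hypersurface_immersion M \<phi> \<and> transversal_field M \<phi> \<xi> \<and>
     gauss_formula M \<phi> \<xi> nabla h \<and> weingarten_formula M \<phi> \<xi> S \<and> volume_condition M \<phi> \<xi> h \<and>
     (\<forall>p\<in>pts M. \<forall>u. u \<noteq> 0 \<longrightarrow> h p u u > 0)"

definition hyperbolic_affine_hypersphere ::
  "('a, 'n::finite) manifold \<Rightarrow> ('a \<Rightarrow> real ^ 'n option) \<Rightarrow> ('a \<Rightarrow> real ^ 'n option) \<Rightarrow>
   ('a, 'n) connection \<Rightarrow> ('a, 'n) bilinear_field \<Rightarrow> ('a \<Rightarrow> real ^ 'n \<Rightarrow> real ^ 'n) \<Rightarrow>
   real \<Rightarrow> bool" where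
  "hyperbolic_affine_hypersphere M \<phi> \<xi> nabla h S lam \<longleftrightarrow>
     blaschke_structure M \<phi> \<xi> nabla h S \<and> lam < 0 \<and> (\<forall>p\<in>pts M. \<forall>u. S p u = lam *\<^sub>R u)"

definition affine_center ::
  "('a, 'n::finite) manifold \<Rightarrow> ('a \<Rightarrow> real ^ 'n option) \<Rightarrow> ('a \<Rightarrow> real ^ 'n option) \<Rightarrow>
   real ^ 'n option \<Rightarrow> bool" where
  "affine_center M \<phi> \<xi> c \<longleftrightarrow> (\<forall>p\<in>pts M. \<exists>s. \<phi> p + s *\<^sub>R \<xi> p = c)"

definition difference_tensor ::
  "('a, 'n::finite) manifold \<Rightarrow> ('a, 'n) connection \<Rightarrow> ('a, 'n) connection \<Rightarrow>
   ('a, 'n) tensor21 \<Rightarrow> bool" where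
  "difference_tensor M nabla nabla' K \<longleftrightarrow>
     (\<forall>W X Y. openin (mtop M) W \<longrightarrow> vector_field M W X \<longrightarrow> vector_field M W Y \<longrightarrow>
        (\<forall>p\<in>W. K p (X p) (Y p) = nabla X Y p - nabla' X Y p))"

section \<open>Calabi product with a point\<close>

text \<open>Here \<open>'n\<close> is the index type of the space containing \<open>\<psi>\<close>, so that \<open>CARD('n)\<close> is the dimension
  of the product.\<close>

definition calabi_product_point ::
  "real \<Rightarrow> real \<Rightarrow> ('b \<Rightarrow> real ^ 'n) \<Rightarrow> real \<times> 'b \<Rightarrow> real ^ ('n::finite) option" where
  "calabi_product_point c1 c2 \<psi> = (\<lambda>(t, p). \<chi> a. case a of
     Some i \<Rightarrow> c1 * exp (t / sqrt (real CARD('n))) * \<psi> p $ i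
   | None \<Rightarrow> c2 * exp (- sqrt (real CARD('n)) * t))"

text \<open>The manifold \<open>M1\<close> has dimension \<open>CARD('k)\<close>. Taking its points from the type \<open>real ^ 'k\<close> is no
  restriction, since a second countable manifold has at most continuum many points.\<close>

definition locally_calabi_product_with_point ::
  "('a, 'k::finite option) manifold \<Rightarrow> ('a \<Rightarrow> real ^ 'k option option) \<Rightarrow> bool" where
  "locally_calabi_product_with_point M \<phi> \<longleftrightarrow>
     (\<forall>p\<in>pts M. \<exists>N I (M1 :: (real ^ 'k, 'k) manifold) \<psi> \<xi> nabla h S \<theta> c1 c2 A b.
        openin (mtop M) N \<and> p \<in> N \<and>
        open I \<and> is_interval I \<and> smooth_manifold M1 \<and>
        hyperbolic_affine_hypersphere M1 \<psi> \<xi> nabla h S (-1) \<and> affine_center M1 \<psi> \<xi> 0 \<and>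
        diffeomorphism (interval_times I M1) (open_submanifold M N) \<theta> \<and>
        c1 \<noteq> 0 \<and> c2 \<noteq> 0 \<and> linear A \<and> bij A \<and>
        (\<forall>t\<in>I. \<forall>q\<in>pts M1. \<phi> (\<theta> (t, q)) = A (calabi_product_point c1 c2 \<psi> (t, q)) + b))"

end

theory Submission
  imports Defs
begin

text \<open>In a chart, after moving the center to the origin, let \<open>f\<close> be the position vector, \<open>\<nu>\<close> its conormal,
  \<open>\<tau>\<close> the field \<open>T\<close> and \<open>\<alpha> = h(T, \<cdot>)\<close>. Put \<open>\<mu> = lam1 - lam2\<close>, so that \<open>lam = \<mu> lam2\<close>, and
  \<open>\<delta> = \<mu> - lam2\<close>, which is nonzero because \<open>lam < 0\<close>. Consider
  \<open>F = f\<^sub>* T - lam2 f\<close> and \<open>G = F - \<delta> f\<close>, and dually \<open>Fs = \<nu>\<^sub>* T + lam2 \<nu>\<close> and \<open>Gs = Fs + \<delta> \<nu>\<close>.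
  If \<open>B\<close> (\<open>covT\<close> below) denotes the Levi-Civita derivative of \<open>T\<close>, then \<open>dF = f\<^sub>* B + \<mu> \<alpha> F\<close> and
  \<open>dFs = \<nu>\<^sub>* B - \<mu> \<alpha> Fs\<close>. The symmetry of \<open>\<langle>dFs, dF\<rangle>\<close> shows \<open>d\<alpha> = 0\<close>, so \<open>B\<close> is symmetric and
  \<open>B T = 0\<close>. Then \<open>F\<close>, \<open>G\<close>, \<open>Fs\<close>, \<open>Gs\<close> are eigenvectors of the derivative along \<open>T\<close>, and comparing
  the Lie derivatives of \<open>\<langle>dFs, dF\<rangle>\<close>, \<open>\<langle>dFs, dG\<rangle>\<close> and \<open>\<langle>dGs, dF\<rangle>\<close> forces \<open>B = 0\<close>.

  Consequently \<open>\<alpha> = dt\<close>, while \<open>exp(- \<mu> t) F\<close> and \<open>exp(\<mu> t) Fs\<close> are constant, and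
  \<open>\<gamma> = exp(- lam2 t) G\<close> does not change along \<open>T\<close> and lies in the fixed hyperplane annihilated by \<open>Fs\<close>.
  As \<open>\<delta> f = F - G\<close>, this is the Calabi product, with \<open>\<gamma>\<close> as the lower dimensional sphere. Both
  \<open>\<mu> = - n lam2\<close> and the volume normalisation of \<open>\<gamma>\<close> are read off from the volume condition for \<open>f\<close>
  at different values of \<open>t\<close>, so apolarity is not needed.\<close>

section \<open>Smooth maps between Euclidean spaces\<close>

text \<open>Where \<open>F\<close> and \<open>G\<close> come from: once \<open>covT\<close> vanishes
  on \<open>T\<close>, the position vector satisfies f'' = lam1 f' - lam f along \<open>T\<close>,
  where a prime is the derivative along \<open>T\<close>. The relation between \<open>lam1\<close>
  and \<open>lam2\<close> says that \<open>lam2\<close> is a root of x^2 - lam1 x + lam. The other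
  root is \<open>\<mu>\<close>, because the roots have sum \<open>lam1\<close> and product
  \<open>lam\<close>, and \<open>\<delta>\<close> is their difference. So \<open>F\<close> is f' -
  lam2 f, \<open>G\<close> is f' - \<mu> f, and each is an eigenvector belonging to the other root.
  On the conormal side the difference tensor enters with the opposite sign, which negates both roots
  and explains \<open>Fs\<close> and \<open>Gs\<close>. The obstacle is that the hypotheses on
  \<open>K\<close> are pointwise algebra and say nothing about the derivative of \<open>T\<close>.
  It is reached by pairing ambient-valued maps with conormal ones: these pairings are known in
  closed form with \<open>covT\<close> as the only unknown, and mixed second derivatives of
  vector-valued functions commute. The eigenvalues along \<open>T\<close> then play off three such
  pairings against each other.\<close>

abbreviation fd :: "('v::real_normed_vector \<Rightarrow> 'w::real_normed_vector) \<Rightarrow> 'v \<Rightarrow> 'v \<Rightarrow> 'w" where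
  "fd f x \<equiv> frechet_derivative f (at x)"

lemma fd_eq: "(f has_derivative f') (at x) \<Longrightarrow> fd f x = f'"
  by (metis frechet_derivative_at)

lemma fd_cong:
  assumes "open S" "x \<in> S" "\<And>y. y \<in> S \<Longrightarrow> f y = g y"
  shows "fd f x = fd g x"
proof -
  have "(f has_derivative f') (at x) \<longleftrightarrow> (g has_derivative f') (at x)" for f'
    using has_derivative_transform_within_open[OF _ assms(1,2), of f f' UNIV g]
      has_derivative_transform_within_open[OF _ assms(1,2), of g f' UNIV f] assms(3) by auto
  then show ?thesis by (simp add: frechet_derivative_def)
qed

section \<open>Closure properties of k times continuously differentiable maps\<close>

lemma Ck_on_cong:
  assumes "open S" "\<And>x. x \<in> S \<Longrightarrow> f x = g x" "Ck_on k S f"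
  shows "Ck_on k S g"
  using assms(2,3)
proof (induction k arbitrary: f g)
  case 0
  then show ?case using continuous_on_cong by (metis Ck_on.simps(1))
next
  case (Suc k)
  have "(f has_derivative fd f x) (at x)" if "x \<in> S" for x
    using Suc.prems that frechet_derivative_works by auto
  then have "g differentiable (at x)" if "x \<in> S" for x
    using has_derivative_transform_within_open[OF _ assms(1) that] Suc.prems(1) that
    unfolding differentiable_def by blast
  moreover have "Ck_on k S (\<lambda>x. fd g x v)" for v
    by (rule Suc.IH[of "\<lambda>x. fd f x v"])
      (use Suc.prems fd_cong[OF assms(1), of _ f g] in auto)
  ultimately show ?case by simp
qed

lemma Ck_on_subset: "Ck_on k S f \<Longrightarrow> T \<subseteq> S \<Longrightarrow> Ck_on k T f"
  by (induction k arbitrary: f) (auto intro: continuous_on_subset)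

lemma Ck_on_continuous: "Ck_on k S f \<Longrightarrow> continuous_on S f"
  by (cases k)
    (auto simp: continuous_at_imp_continuous_on differentiable_imp_continuous_within)

lemma Ck_on_Suc_imp: "Ck_on (Suc k) S f \<Longrightarrow> Ck_on k S f"
proof (induction k arbitrary: f)
  case 0
  then show ?case using Ck_on_continuous by (metis Ck_on.simps(1))
next
  case (Suc k)
  then show ?case by (metis Ck_on.simps(2))
qed

lemma Ck_on_const: "Ck_on k S (\<lambda>x. c)"
  by (induction k arbitrary: c) auto

lemma Ck_on_SucI:
  assumes "open S" "\<And>x. x \<in> S \<Longrightarrow> (f has_derivative f' x) (at x)" "\<And>v. Ck_on k S (\<lambda>x. f' x v)"
  shows "Ck_on (Suc k) S f"
proof -
  have "Ck_on k S (\<lambda>x. fd f x v)" for v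
    by (rule Ck_on_cong[OF assms(1) _ assms(3)]) (simp add: fd_eq[OF assms(2)])
  then show ?thesis using assms(2) by (auto simp: differentiable_def)
qed

lemma Ck_on_SucD:
  assumes "Ck_on (Suc k) S f"
  shows "x \<in> S \<Longrightarrow> (f has_derivative fd f x) (at x)" "Ck_on k S (\<lambda>x. fd f x v)"
  using assms frechet_derivative_works by auto

lemma Ck_on_linear:
  assumes L: "bounded_linear L" and S: "open S"
  shows "Ck_on k S f \<Longrightarrow> Ck_on k S (\<lambda>x. L (f x))"
proof (induction k arbitrary: f)
  case 0
  then show ?case using L by (simp add: bounded_linear.continuous_on)
next
  case (Suc k)
  show ?case
    by (rule Ck_on_SucI[OF S bounded_linear.has_derivative[OF L Ck_on_SucD(1)[OF Suc.prems]]])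
      (simp_all add: Suc.IH Ck_on_SucD(2)[OF Suc.prems])
qed

lemma Ck_on_add:
  assumes S: "open S"
  shows "Ck_on k S f \<Longrightarrow> Ck_on k S g \<Longrightarrow> Ck_on k S (\<lambda>x. f x + g x)"
proof (induction k arbitrary: f g)
  case 0
  then show ?case by (simp add: continuous_on_add)
next
  case (Suc k)
  show ?case
    by (rule Ck_on_SucI[OF S has_derivative_add[OF Ck_on_SucD(1)[OF Suc.prems(1)] Ck_on_SucD(1)[OF Suc.prems(2)]]])
      (simp_all add: Suc.IH Ck_on_SucD(2)[OF Suc.prems(1)] Ck_on_SucD(2)[OF Suc.prems(2)])
qed

lemma Ck_on_sum:
  assumes "open S" "finite A" "\<And>a. a \<in> A \<Longrightarrow> Ck_on k S (f a)"
  shows "Ck_on k S (\<lambda>x. \<Sum>a\<in>A. f a x)"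
  using assms(2,3) by (induction) (auto intro: Ck_on_const Ck_on_add assms(1))

lemma Ck_on_bilinear:
  assumes b: "bounded_bilinear B" and S: "open S"
  shows "Ck_on k S f \<Longrightarrow> Ck_on k S g \<Longrightarrow> Ck_on k S (\<lambda>x. B (f x) (g x))"
proof (induction k arbitrary: f g)
  case 0
  then show ?case by (simp add: bounded_bilinear.continuous_on[OF b])
next
  case (Suc k)
  show ?case
    by (rule Ck_on_SucI[OF S bounded_bilinear.FDERIV[OF b Ck_on_SucD(1)[OF Suc.prems(1)] Ck_on_SucD(1)[OF Suc.prems(2)]]])
      (simp_all add: Suc.IH S Ck_on_add Ck_on_SucD(2)[OF Suc.prems(1)] Ck_on_SucD(2)[OF Suc.prems(2)]
        Ck_on_Suc_imp[OF Suc.prems(1)] Ck_on_Suc_imp[OF Suc.prems(2)])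
qed

text \<open>\<open>Ck_on\<close> controls derivatives in fixed directions only. Expanding the
  direction in a basis reduces a direction that moves with the point to finitely many fixed
  ones.\<close>

lemma fd_basis_expansion:
  fixes g :: "'v::euclidean_space \<Rightarrow> 'w::real_normed_vector"
  assumes "g differentiable (at y)"
  shows "fd g y v = (\<Sum>b\<in>Basis. (v \<bullet> b) *\<^sub>R fd g y b)"
proof -
  have "linear (fd g y)" using assms by (rule linear_frechet_derivative)
  then have "fd g y (\<Sum>b\<in>Basis. (v \<bullet> b) *\<^sub>R b) = (\<Sum>b\<in>Basis. (v \<bullet> b) *\<^sub>R fd g y b)"
    by (simp add: linear_sum linear_scale)
  then show ?thesis by (simp add: euclidean_representation)
qed

lemma Ck_on_compose:
  fixes g :: "'v::euclidean_space \<Rightarrow> 'w::real_normed_vector"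
  assumes S: "open S" and fS: "f ` S \<subseteq> T"
  shows "Ck_on k S f \<Longrightarrow> Ck_on k T g \<Longrightarrow> Ck_on k S (\<lambda>x. g (f x))"
proof (induction k arbitrary: g)
  case 0
  then show ?case using fS by (auto intro: continuous_on_compose2)
next
  case (Suc k)
  have dg: "g differentiable (at (f x))" if "x \<in> S" for x
    using Suc.prems(2) fS that by auto
  have *: "((\<lambda>x. g (f x)) has_derivative (\<lambda>v. fd g (f x) (fd f x v))) (at x)" if "x \<in> S" for x
    using has_derivative_compose[OF Ck_on_SucD(1)[OF Suc.prems(1) that] Ck_on_SucD(1)[OF Suc.prems(2)]] fS that
    by blast
  \<comment> \<open>The chain rule evaluates the derivative of \<open>g\<close> in the direction
    \<open>fd f x v\<close>, which depends on \<open>x\<close>. After expansion each summand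
    contains a derivative of \<open>g\<close> in a fixed direction, composed with \<open>f\<close>,
    to which the induction hypothesis applies.\<close>
  have "Ck_on k S (\<lambda>x. \<Sum>b\<in>Basis. (fd f x v \<bullet> b) *\<^sub>R fd g (f x) b)" for v
    by (intro Ck_on_sum Ck_on_bilinear[OF bounded_bilinear_scaleR] S finite_Basis
        Ck_on_linear[OF bounded_linear_inner_left] Suc.IH Ck_on_SucD(2)[OF Suc.prems(1)]
        Ck_on_SucD(2)[OF Suc.prems(2)] Ck_on_Suc_imp[OF Suc.prems(1)])
  then have "Ck_on k S (\<lambda>x. fd g (f x) (fd f x v))" for v
    by (rule Ck_on_cong[OF S, rotated]) (rule fd_basis_expansion[OF dg, symmetric])
  then show ?case by (intro Ck_on_SucI[OF S *]) auto
qed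

section \<open>Closure properties of smooth maps\<close>

lemma smooth_on_cong: "open S \<Longrightarrow> (\<And>x. x \<in> S \<Longrightarrow> f x = g x) \<Longrightarrow> smooth_on S f \<Longrightarrow> smooth_on S g"
  unfolding smooth_on_def using Ck_on_cong by blast

lemma smooth_on_subset: "smooth_on S f \<Longrightarrow> T \<subseteq> S \<Longrightarrow> smooth_on T f"
  unfolding smooth_on_def using Ck_on_subset by blast

lemma smooth_on_const: "smooth_on S (\<lambda>x. c)"
  by (simp add: smooth_on_def Ck_on_const)

lemma smooth_on_ident: "smooth_on S (\<lambda>x. x)"
  unfolding smooth_on_def
proof
  fix k show "Ck_on k S (\<lambda>x. x)" by (cases k) (auto intro: Ck_on_const)
qed

lemma smooth_on_linear: "bounded_linear L \<Longrightarrow> open S \<Longrightarrow> smooth_on S f \<Longrightarrow> smooth_on S (\<lambda>x. L (f x))"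
  unfolding smooth_on_def using Ck_on_linear by blast

lemma smooth_on_add: "open S \<Longrightarrow> smooth_on S f \<Longrightarrow> smooth_on S g \<Longrightarrow> smooth_on S (\<lambda>x. f x + g x)"
  unfolding smooth_on_def using Ck_on_add by blast

lemma smooth_on_sum:
  "open S \<Longrightarrow> finite A \<Longrightarrow> (\<And>a. a \<in> A \<Longrightarrow> smooth_on S (f a)) \<Longrightarrow> smooth_on S (\<lambda>x. \<Sum>a\<in>A. f a x)"
  unfolding smooth_on_def by (auto intro: Ck_on_sum)

lemma smooth_on_bilinear:
  "bounded_bilinear B \<Longrightarrow> open S \<Longrightarrow> smooth_on S f \<Longrightarrow> smooth_on S g \<Longrightarrow> smooth_on S (\<lambda>x. B (f x) (g x))"
  unfolding smooth_on_def using Ck_on_bilinear by blast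

lemmas smooth_on_scaleR = smooth_on_bilinear[OF bounded_bilinear_scaleR]
lemmas smooth_on_mult = smooth_on_bilinear[OF bounded_bilinear_mult]
lemmas smooth_on_inner = smooth_on_bilinear[OF bounded_bilinear_inner]

lemma smooth_on_compose:
  fixes g :: "'v::euclidean_space \<Rightarrow> 'w::real_normed_vector"
  shows "open S \<Longrightarrow> f ` S \<subseteq> T \<Longrightarrow> smooth_on S f \<Longrightarrow> smooth_on T g \<Longrightarrow> smooth_on S (\<lambda>x. g (f x))"
  unfolding smooth_on_def using Ck_on_compose by blast

lemma smooth_on_continuous: "smooth_on S f \<Longrightarrow> continuous_on S f"
  unfolding smooth_on_def using Ck_on.simps(1) by blast

lemma smooth_on_differentiable: "smooth_on S f \<Longrightarrow> x \<in> S \<Longrightarrow> f differentiable (at x)"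
  unfolding smooth_on_def using Ck_on.simps(2) by blast

lemma smooth_on_has_derivative: "smooth_on S f \<Longrightarrow> x \<in> S \<Longrightarrow> (f has_derivative fd f x) (at x)"
  using smooth_on_differentiable frechet_derivative_works by blast

lemma smooth_on_fd: "smooth_on S f \<Longrightarrow> smooth_on S (\<lambda>x. fd f x v)"
  unfolding smooth_on_def using Ck_on.simps(2) by blast

lemma smooth_on_linear_fd: "smooth_on S f \<Longrightarrow> x \<in> S \<Longrightarrow> linear (fd f x)"
  using smooth_on_differentiable linear_frechet_derivative by blast

lemma smooth_on_fd_field:
  fixes f :: "'v::euclidean_space \<Rightarrow> 'w::real_normed_vector"
  assumes "open S" "smooth_on S f" "smooth_on S X"
  shows "smooth_on S (\<lambda>x. fd f x (X x))"
proof -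
  have "smooth_on S (\<lambda>x. \<Sum>b\<in>Basis. (X x \<bullet> b) *\<^sub>R fd f x b)"
    by (intro smooth_on_sum smooth_on_scaleR smooth_on_inner smooth_on_const smooth_on_fd assms finite_Basis)
  then show ?thesis
    by (rule smooth_on_cong[OF assms(1), rotated])
      (metis fd_basis_expansion smooth_on_differentiable assms(2))
qed

lemma smooth_onI_derivative:
  assumes "open S" "\<And>x. x \<in> S \<Longrightarrow> (f has_derivative f' x) (at x)" "\<And>v. smooth_on S (\<lambda>x. f' x v)"
  shows "smooth_on S f"
  unfolding smooth_on_def
proof
  fix k
  have "Ck_on (Suc k) S f" using assms(3) by (intro Ck_on_SucI[OF assms(1,2)]) (auto simp: smooth_on_def)
  then show "Ck_on k S f" by (rule Ck_on_Suc_imp)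
qed

lemma smooth_on_vec_nth:
  "open S \<Longrightarrow> smooth_on S (f :: _ \<Rightarrow> real^'n) \<Longrightarrow> smooth_on S (\<lambda>x. f x $ i)"
  by (rule smooth_on_linear[OF bounded_linear_vec_nth])

section \<open>Exponential function, reciprocal and logarithm\<close>

lemma smooth_on_exp_real: "smooth_on UNIV (exp :: real \<Rightarrow> real)"
  unfolding smooth_on_def
proof
  fix k show "Ck_on k UNIV (exp :: real \<Rightarrow> real)"
  proof (induction k)
    case 0 then show ?case by (simp add: continuous_on_exp)
  next
    case (Suc k)
    have *: "((exp::real\<Rightarrow>real) has_derivative (*) (exp x)) (at x)" for x
      using DERIV_exp[of x] by (simp add: has_field_derivative_def)
    have "Ck_on k UNIV (\<lambda>x. exp x * v)" for v :: real
      by (intro Ck_on_bilinear[OF bounded_bilinear_mult] Ck_on_const Suc) auto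
    then show ?case by (intro Ck_on_SucI[OF open_UNIV *])
  qed
qed

lemma smooth_on_inverse_real: "smooth_on (- {0}) (inverse :: real \<Rightarrow> real)"
  unfolding smooth_on_def
proof
  have o: "open (- {0::real})" by auto
  fix k show "Ck_on k (- {0}) (inverse :: real \<Rightarrow> real)"
  proof (induction k)
    case 0 then show ?case by (auto intro!: continuous_intros)
  next
    case (Suc k)
    have *: "((inverse::real\<Rightarrow>real) has_derivative (\<lambda>v. - (inverse x * v * inverse x))) (at x)" if "x \<in> - {0}" for x
      using has_derivative_inverse'[of x] that by auto
    have "Ck_on k (-{0}) (\<lambda>x. - 1 * (inverse x * v * inverse x))" for v :: real
      by (intro Ck_on_bilinear[OF bounded_bilinear_mult] Ck_on_const Suc o)
    then show ?case by (intro Ck_on_SucI[OF o *]) auto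
  qed
qed

lemma smooth_on_ln_real: "smooth_on {0<..} (ln :: real \<Rightarrow> real)"
proof (rule smooth_onI_derivative)
  show o: "open {0::real<..}" by auto
  show "((ln::real\<Rightarrow>real) has_derivative (*) (inverse x)) (at x)" if "x \<in> {0<..}" for x
    using DERIV_ln[of x] that by (simp add: has_field_derivative_def)
  show "smooth_on {0::real<..} (\<lambda>x. inverse x * v)" for v :: real
    by (intro smooth_on_mult smooth_on_const smooth_on_subset[OF smooth_on_inverse_real] o) auto
qed

lemma smooth_on_exp: "open S \<Longrightarrow> smooth_on S f \<Longrightarrow> smooth_on S (\<lambda>x. exp (f x :: real))"
  for f :: "'v::real_normed_vector \<Rightarrow> real"
  by (rule smooth_on_compose[OF _ _ _ smooth_on_exp_real]) auto

section \<open>Determinants and linear systems depending on parameters\<close>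

lemma Ck_on_vec:
  fixes f :: "_ \<Rightarrow> real^'n"
  assumes "open S" "\<And>i. Ck_on k S (\<lambda>x. f x $ i)"
  shows "Ck_on k S f"
proof -
  have "Ck_on k S (\<lambda>x. \<Sum>i\<in>UNIV. (f x $ i) *\<^sub>R axis i (1::real))"
    by (intro Ck_on_sum Ck_on_bilinear[OF bounded_bilinear_scaleR] Ck_on_const assms) auto
  then show ?thesis by (simp add: basis_expansion flip: scalar_mult_eq_scaleR)
qed

lemma Ck_on_prod:
  fixes f :: "'a \<Rightarrow> _ \<Rightarrow> real"
  assumes "open S" "finite A" "\<And>a. a \<in> A \<Longrightarrow> Ck_on k S (f a)"
  shows "Ck_on k S (\<lambda>x. \<Prod>a\<in>A. f a x)"
  using assms(2,3)
  by (induction) (auto intro: Ck_on_const Ck_on_bilinear[OF bounded_bilinear_mult] assms(1))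

lemma Ck_on_det:
  fixes A :: "_ \<Rightarrow> real^'n^'n"
  assumes "open S" "\<And>i j. Ck_on k S (\<lambda>x. A x $ i $ j)"
  shows "Ck_on k S (\<lambda>x. det (A x))"
  unfolding det_def
  by (intro Ck_on_sum Ck_on_bilinear[OF bounded_bilinear_mult] Ck_on_prod Ck_on_const assms
      finite_permutations) auto

lemma Ck_on_divide:
  fixes f g :: "'v::real_normed_vector \<Rightarrow> real"
  assumes "open S" "Ck_on k S f" "Ck_on k S g" "\<And>x. x \<in> S \<Longrightarrow> g x \<noteq> 0"
  shows "Ck_on k S (\<lambda>x. f x / g x)"
proof -
  have "Ck_on k S (\<lambda>x. inverse (g x))"
    by (rule Ck_on_compose[of S g "-{0}" k inverse])
      (use assms smooth_on_inverse_real in \<open>auto simp: smooth_on_def\<close>)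
  then show ?thesis
    unfolding divide_inverse by (intro Ck_on_bilinear[OF bounded_bilinear_mult] assms)
qed

text \<open>Cramer's rule writes each component of the solution as a quotient of determinants. This
  gives regularity to maps known only as pointwise solutions, such as the conormal and the
  derivative of a local inverse.\<close>

lemma Ck_on_solve:
  fixes A :: "'v::real_normed_vector \<Rightarrow> real^'n^'n" and b y :: "'v \<Rightarrow> real^'n"
  assumes S: "open S" and A: "\<And>i j. Ck_on k S (\<lambda>x. A x $ i $ j)" and b: "Ck_on k S b"
    and det: "\<And>x. x \<in> S \<Longrightarrow> det (A x) \<noteq> 0" and sol: "\<And>x. x \<in> S \<Longrightarrow> A x *v y x = b x"
  shows "Ck_on k S y"
proof (rule Ck_on_vec[OF S])
  fix l
  have "Ck_on k S (\<lambda>x. det (\<chi> i j. if j = l then b x $ i else A x $ i $ j) / det (A x))"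
  proof (intro Ck_on_divide Ck_on_det S det A)
    fix i j
    show "Ck_on k S (\<lambda>x. (\<chi> i j. if j = l then b x $ i else A x $ i $ j) $ i $ j)"
      using A Ck_on_linear[OF bounded_linear_vec_nth S b] by (cases "j = l") auto
  qed
  then show "Ck_on k S (\<lambda>x. y x $ l)"
    by (rule Ck_on_cong[OF S, rotated]) (use cramer[OF det] sol in auto)
qed

lemma smooth_on_divide:
  fixes f g :: "'v::real_normed_vector \<Rightarrow> real"
  shows "open S \<Longrightarrow> smooth_on S f \<Longrightarrow> smooth_on S g \<Longrightarrow> (\<And>x. x \<in> S \<Longrightarrow> g x \<noteq> 0) \<Longrightarrow>
    smooth_on S (\<lambda>x. f x / g x)"
  unfolding smooth_on_def using Ck_on_divide by blast

section \<open>Symmetry of second derivatives and derivatives along moving directions\<close>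

lemma smooth_on_line_derivative:
  assumes "smooth_on S g" "a + s *\<^sub>R w \<in> S"
  shows "((\<lambda>s. g (a + s *\<^sub>R w)) has_derivative (\<lambda>h. h *\<^sub>R fd g (a + s *\<^sub>R w) w)) (at s)"
proof -
  have "((\<lambda>s. a + s *\<^sub>R w) has_derivative (\<lambda>h. h *\<^sub>R w)) (at s)" by (auto intro!: derivative_eq_intros)
  from has_derivative_compose[OF this smooth_on_has_derivative[OF assms]]
  show ?thesis by (simp add: linear_scale[OF smooth_on_linear_fd[OF assms]])
qed

text \<open>The mixed second difference over a small parallelogram is symmetric in \<open>u\<close>
  and \<open>v\<close>. The mean value theorem, applied twice in either order, identifies it with
  \<open>t * t\<close> times one or the other mixed derivative at a nearby point, and both are
  continuous.\<close>

lemma fd_commute_real: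
  fixes g :: "'v::euclidean_space \<Rightarrow> real"
  assumes S: "open S" "x \<in> S" and g: "smooth_on S g"
  shows "fd (\<lambda>y. fd g y u) x v = fd (\<lambda>y. fd g y v) x u"
proof -
  let ?P = "\<lambda>u v y. fd (\<lambda>y. fd g y u) y v"
  \<comment> \<open>The first mean value step moves along \<open>u\<close> and acts on the
    difference of \<open>g\<close> over the edge \<open>t *\<^sub>R v\<close>; the second moves
    along \<open>v\<close> and acts on the derivative in direction \<open>u\<close>.\<close>
  have key: "\<exists>s\<in>{0<..<t}. \<exists>r\<in>{0<..<t}. g (x + t *\<^sub>R u + t *\<^sub>R v) - g (x + t *\<^sub>R u) - g (x + t *\<^sub>R v) + g x
      = t * (t * ?P u v (x + s *\<^sub>R u + r *\<^sub>R v))"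
    if t: "t > 0" and sub: "\<And>s r. 0 \<le> s \<Longrightarrow> s \<le> t \<Longrightarrow> 0 \<le> r \<Longrightarrow> r \<le> t \<Longrightarrow> x + s *\<^sub>R u + r *\<^sub>R v \<in> S" for t u v
  proof -
    have "\<exists>s\<in>{0<..<t}. (\<lambda>s. g (x + s *\<^sub>R u + t *\<^sub>R v) - g (x + s *\<^sub>R u)) t -
         (\<lambda>s. g (x + s *\<^sub>R u + t *\<^sub>R v) - g (x + s *\<^sub>R u)) 0 =
       (\<lambda>h. h * (fd g (x + s *\<^sub>R u + t *\<^sub>R v) u - fd g (x + s *\<^sub>R u) u)) (t - 0)"
    proof (rule mvt_simple[OF t])
      fix s assume s: "0 \<le> s" "s \<le> t"
      have i: "x + s *\<^sub>R u + t *\<^sub>R v \<in> S" "x + s *\<^sub>R u \<in> S"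
        using sub[of s t] sub[of s 0] s t by auto
      have eq: "x + s *\<^sub>R u + t *\<^sub>R v = (x + t *\<^sub>R v) + s *\<^sub>R u" for s by simp
      have "((\<lambda>s. g (x + s *\<^sub>R u + t *\<^sub>R v) - g (x + s *\<^sub>R u)) has_derivative
          (\<lambda>h. h *\<^sub>R fd g (x + s *\<^sub>R u + t *\<^sub>R v) u - h *\<^sub>R fd g (x + s *\<^sub>R u) u)) (at s)"
        unfolding eq by (intro has_derivative_diff smooth_on_line_derivative[OF g i(2)]
            smooth_on_line_derivative[OF g i(1)[unfolded eq]])
      then show "((\<lambda>s. g (x + s *\<^sub>R u + t *\<^sub>R v) - g (x + s *\<^sub>R u)) has_derivative
          (\<lambda>h. h * (fd g (x + s *\<^sub>R u + t *\<^sub>R v) u - fd g (x + s *\<^sub>R u) u))) (at s within {0..t})"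
        by (simp add: has_derivative_at_withinI right_diff_distrib)
    qed
    then obtain s where s: "s \<in> {0<..<t}" and e1: "g (x + t *\<^sub>R u + t *\<^sub>R v) - g (x + t *\<^sub>R u) - g (x + t *\<^sub>R v) + g x
       = t * (fd g (x + s *\<^sub>R u + t *\<^sub>R v) u - fd g (x + s *\<^sub>R u) u)" by auto
    have "\<exists>r\<in>{0<..<t}. (\<lambda>r. fd g (x + s *\<^sub>R u + r *\<^sub>R v) u) t - (\<lambda>r. fd g (x + s *\<^sub>R u + r *\<^sub>R v) u) 0 =
       (\<lambda>h. h * ?P u v (x + s *\<^sub>R u + r *\<^sub>R v)) (t - 0)"
    proof (rule mvt_simple[OF t])
      fix r assume r: "0 \<le> r" "r \<le> t"
      have i: "x + s *\<^sub>R u + r *\<^sub>R v \<in> S"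
        using sub[of s r] s r by auto
      show "((\<lambda>r. fd g (x + s *\<^sub>R u + r *\<^sub>R v) u) has_derivative
          (\<lambda>h. h * ?P u v (x + s *\<^sub>R u + r *\<^sub>R v))) (at r within {0..t})"
        using smooth_on_line_derivative[OF smooth_on_fd[OF g] i] by (simp add: has_derivative_at_withinI)
    qed
    then obtain r where "r \<in> {0<..<t}" "fd g (x + s *\<^sub>R u + t *\<^sub>R v) u - fd g (x + s *\<^sub>R u) u
       = t * ?P u v (x + s *\<^sub>R u + r *\<^sub>R v)" by auto
    then show ?thesis using s e1 by (intro bexI[of _ s] bexI[of _ r]) auto
  qed
  show ?thesis
  proof (rule ccontr)
    assume ne: "?P u v x \<noteq> ?P v u x"
    \<comment> \<open>Half of the supposed gap: two numbers closer than \<open>e\<close> to the two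
      distinct values cannot coincide.\<close>
    define e where "e = \<bar>?P u v x - ?P v u x\<bar> / 2"
    have e: "e > 0" using ne by (simp add: e_def)
    have c: "isCont (?P u v) x" "isCont (?P v u) x"
      using smooth_on_continuous[OF smooth_on_fd[OF smooth_on_fd[OF g]]] S
      by (auto simp: continuous_on_eq_continuous_at)
    obtain d1 where d1: "d1 > 0" "\<And>y. dist y x < d1 \<Longrightarrow> dist (?P u v y) (?P u v x) < e"
      using c(1) e unfolding continuous_at_eps_delta by blast
    obtain d2 where d2: "d2 > 0" "\<And>y. dist y x < d2 \<Longrightarrow> dist (?P v u y) (?P v u x) < e"
      using c(2) e unfolding continuous_at_eps_delta by blast
    obtain d3 where d3: "d3 > 0" "\<And>y. dist y x < d3 \<Longrightarrow> y \<in> S"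
      using S open_dist by blast
    define d where "d = min d1 (min d2 d3)"
    \<comment> \<open>The parallelogram with sides \<open>t *\<^sub>R u\<close> and
      \<open>t *\<^sub>R v\<close> then stays within \<open>d / 2\<close> of \<open>x\<close>. The
      summand 1 keeps the denominator positive when both directions are zero.\<close>
    define t where "t = d / (2 * (norm u + norm v + 1))"
    have dp: "d > 0" using d1 d2 d3 by (auto simp: d_def)
    have np: "norm u + norm v + 1 > 0" by (simp add: add_nonneg_pos)
    have tp: "t > 0" using dp np by (simp add: t_def)
    have near: "dist (x + s *\<^sub>R u + r *\<^sub>R v) x < d" if "0 \<le> s" "s \<le> t" "0 \<le> r" "r \<le> t" for s r
    proof -
      have "dist (x + s *\<^sub>R u + r *\<^sub>R v) x \<le> s * norm u + r * norm v"
        using that norm_triangle_ineq[of "s *\<^sub>R u" "r *\<^sub>R v"] by (auto simp: dist_norm algebra_simps)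
      also have "\<dots> \<le> t * norm u + t * norm v" using that by (intro add_mono mult_right_mono) auto
      also have "\<dots> \<le> t * (norm u + norm v + 1)" using tp by (simp add: algebra_simps)
      also have "\<dots> = d / 2" using np by (simp add: t_def field_simps)
      finally show ?thesis using dp by simp
    qed
    obtain s r where sr: "s \<in> {0<..<t}" "r \<in> {0<..<t}" "g (x + t *\<^sub>R u + t *\<^sub>R v) - g (x + t *\<^sub>R u) - g (x + t *\<^sub>R v) + g x
      = t * (t * ?P u v (x + s *\<^sub>R u + r *\<^sub>R v))"
      using key[OF tp, of u v] near d3 by (auto simp: d_def)
    obtain s' r' where sr': "s' \<in> {0<..<t}" "r' \<in> {0<..<t}" "g (x + t *\<^sub>R v + t *\<^sub>R u) - g (x + t *\<^sub>R v) - g (x + t *\<^sub>R u) + g x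
      = t * (t * ?P v u (x + s' *\<^sub>R v + r' *\<^sub>R u))"
    proof -
      have "x + s *\<^sub>R v + r *\<^sub>R u \<in> S" if "0 \<le> s" "s \<le> t" "0 \<le> r" "r \<le> t" for s r
        using near[of r s] that d3(2)[of "x + r *\<^sub>R u + s *\<^sub>R v"] by (simp add: d_def ac_simps)
      then show ?thesis using key[OF tp, of v u] that by blast
    qed
    have "x + t *\<^sub>R v + t *\<^sub>R u = x + t *\<^sub>R u + t *\<^sub>R v" by simp
    then have "t * (t * ?P u v (x + s *\<^sub>R u + r *\<^sub>R v)) = t * (t * ?P v u (x + s' *\<^sub>R v + r' *\<^sub>R u))"
      using sr(3) sr'(3) by (simp add: algebra_simps)
    then have eq: "?P u v (x + s *\<^sub>R u + r *\<^sub>R v) = ?P v u (x + s' *\<^sub>R v + r' *\<^sub>R u)" using tp by simp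
    have "x + s' *\<^sub>R v + r' *\<^sub>R u = x + r' *\<^sub>R u + s' *\<^sub>R v" by simp
    moreover have "dist (x + r' *\<^sub>R u + s' *\<^sub>R v) x < d" using near[of r' s'] sr' by simp
    ultimately have "dist (x + s' *\<^sub>R v + r' *\<^sub>R u) x < d" by metis
    then have "dist (?P v u (x + s' *\<^sub>R v + r' *\<^sub>R u)) (?P v u x) < e" using d2 by (auto simp: d_def)
    moreover have "dist (?P u v (x + s *\<^sub>R u + r *\<^sub>R v)) (?P u v x) < e"
      using near[of s r] sr d1 by (auto simp: d_def)
    ultimately show False using eq by (auto simp: e_def dist_real_def abs_if split: if_splits)
  qed
qed

lemma fd_commute:
  fixes g :: "'v::euclidean_space \<Rightarrow> 'w::euclidean_space"
  assumes S: "open S" "x \<in> S" and g: "smooth_on S g"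
  shows "fd (\<lambda>y. fd g y u) x v = fd (\<lambda>y. fd g y v) x u"
proof (rule euclidean_eqI)
  fix b :: 'w assume "b \<in> Basis"
  have sb: "smooth_on S (\<lambda>y. g y \<bullet> b)" by (intro smooth_on_inner smooth_on_const S g)
  have 1: "fd (\<lambda>y. h y \<bullet> b) y w = fd h y w \<bullet> b" if "smooth_on S h" "y \<in> S" for h :: "'v \<Rightarrow> 'w" and y w
    using bounded_linear.has_derivative[OF bounded_linear_inner_left smooth_on_has_derivative[OF that], of b]
    by (simp add: fd_eq)
  have 2: "fd (\<lambda>y. fd (\<lambda>y. g y \<bullet> b) y u) x v = fd (\<lambda>y. fd g y u) x v \<bullet> b" for u v
    using fd_cong[OF S, of "\<lambda>y. fd (\<lambda>y. g y \<bullet> b) y u" "\<lambda>y. fd g y u \<bullet> b"]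
      1[OF g] 1[OF smooth_on_fd[OF g] S(2)] by metis
  show "fd (\<lambda>y. fd g y u) x v \<bullet> b = fd (\<lambda>y. fd g y v) x u \<bullet> b"
    using fd_commute_real[OF S sb, of u v] by (simp add: 2)
qed

text \<open>The product rule for a derivative along a vector field: the second derivative of
  \<open>g\<close>, plus \<open>g\<close> differentiated along the derivative of the field. The
  second term is tangential when \<open>g\<close> is an immersion, so it never affects the
  transversal component.\<close>

lemma fd_fd_field:
  fixes g :: "'v::euclidean_space \<Rightarrow> 'w::real_normed_vector"
  assumes S: "open S" "x \<in> S" and g: "smooth_on S g" and X: "X differentiable (at x)"
  shows "fd (\<lambda>y. fd g y (X y)) x u = fd (\<lambda>y. fd g y (X x)) x u + fd g x (fd X x u)"
proof -
  have h: "((\<lambda>y. \<Sum>b\<in>Basis. (X y \<bullet> b) *\<^sub>R fd g y b) has_derivative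
      (\<lambda>u. \<Sum>b\<in>Basis. ((X x \<bullet> b) *\<^sub>R fd (\<lambda>y. fd g y b) x u + (fd X x u \<bullet> b) *\<^sub>R fd g x b))) (at x)"
    using X by (intro has_derivative_sum has_derivative_scaleR has_derivative_inner_left smooth_on_has_derivative[OF smooth_on_fd[OF g] S(2)])
     (auto simp: frechet_derivative_works[symmetric])
  have h': "((\<lambda>y. fd g y (X y)) has_derivative
      (\<lambda>u. \<Sum>b\<in>Basis. ((X x \<bullet> b) *\<^sub>R fd (\<lambda>y. fd g y b) x u + (fd X x u \<bullet> b) *\<^sub>R fd g x b))) (at x)"
    by (rule has_derivative_transform_within_open[OF h S])
      (use fd_basis_expansion smooth_on_differentiable[OF g] in metis)
  have k: "((\<lambda>y. \<Sum>b\<in>Basis. (w \<bullet> b) *\<^sub>R fd g y b) has_derivative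
      (\<lambda>u. \<Sum>b\<in>Basis. (w \<bullet> b) *\<^sub>R fd (\<lambda>y. fd g y b) x u)) (at x)" for w
    by (intro has_derivative_sum has_derivative_scaleR_right smooth_on_has_derivative[OF smooth_on_fd[OF g] S(2)])
  have k': "((\<lambda>y. fd g y w) has_derivative
      (\<lambda>u. \<Sum>b\<in>Basis. (w \<bullet> b) *\<^sub>R fd (\<lambda>y. fd g y b) x u)) (at x)" for w
    by (rule has_derivative_transform_within_open[OF k S])
      (use fd_basis_expansion smooth_on_differentiable[OF g] in metis)
  have "fd (\<lambda>y. fd g y (X y)) x u = (\<Sum>b\<in>Basis. (X x \<bullet> b) *\<^sub>R fd (\<lambda>y. fd g y b) x u)
      + (\<Sum>b\<in>Basis. (fd X x u \<bullet> b) *\<^sub>R fd g x b)"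
    using fd_eq[OF h'] by (simp add: sum.distrib)
  then show ?thesis
    using fd_eq[OF k'[of "X x"]] fd_basis_expansion[OF smooth_on_differentiable[OF g S(2)], of "fd X x u"]
    by metis
qed

section \<open>Smooth local inverses\<close>

lemma det_nonzero_of_inj:
  fixes L :: "real^'n \<Rightarrow> real^'n"
  assumes "linear L" "inj L"
  shows "det (matrix L) \<noteq> 0"
  using assms det_nz_iff_inj by blast

text \<open>The derivative of the inverse solves a linear system whose coefficients are as smooth as the
  inverse itself, which gains one order of differentiability by Cramer's rule.\<close>

lemma Ck_on_local_inverse:
  fixes f g :: "real^'n \<Rightarrow> real^'n"
  assumes S: "open S" "open T" and f: "smooth_on S f" and g: "g ` T \<subseteq> S" "continuous_on T g"
    and fg: "\<And>y. y \<in> T \<Longrightarrow> f (g y) = y"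
    and dg: "\<And>y. y \<in> T \<Longrightarrow> g differentiable (at y)"
    and inj: "\<And>x. x \<in> S \<Longrightarrow> inj (fd f x)"
  shows "Ck_on k T g"
proof (induction k)
  case 0
  show ?case using g by simp
next
  case (Suc k)
  let ?M = "\<lambda>y. matrix (fd f (g y))"
  have sol: "?M y *v fd g y v = v" if y: "y \<in> T" for y v
  proof -
    have gy: "g y \<in> S" using g y by auto
    have "((\<lambda>y. f (g y)) has_derivative (\<lambda>v. fd f (g y) (fd g y v))) (at y)"
      using has_derivative_compose[of g "fd g y" y UNIV f "fd f (g y)"] dg[OF y]
        smooth_on_has_derivative[OF f gy] frechet_derivative_works by blast
    then have "((\<lambda>y. y) has_derivative (\<lambda>v. fd f (g y) (fd g y v))) (at y)"
      by (rule has_derivative_transform_within_open[OF _ S(2) y]) (use fg in auto)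
    then have "fd f (g y) (fd g y v) = v" using has_derivative_ident[of "at y"] has_derivative_unique by metis
    moreover have "?M y *v fd g y v = fd f (g y) (fd g y v)"
      using matrix_works[OF smooth_on_linear_fd[OF f gy, folded linear_matrix_vector_mul_eq]]
        smooth_on_linear_fd[OF f gy] matrix_works by (metis linear_matrix_vector_mul_eq)
    ultimately show ?thesis by simp
  qed
  have det: "det (?M y) \<noteq> 0" if "y \<in> T" for y
    using det_nonzero_of_inj smooth_on_linear_fd[OF f] inj that g by blast
  have M: "Ck_on k T (\<lambda>y. ?M y $ i $ j)" for i j
  proof -
    have "Ck_on k T (\<lambda>y. fd f (g y) (axis j 1) $ i)"
      by (rule Ck_on_linear[OF bounded_linear_vec_nth S(2)],
          rule Ck_on_compose[OF S(2) g(1) Suc, of "\<lambda>x. fd f x (axis j 1)"])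
        (use smooth_on_fd[OF f] in \<open>auto simp: smooth_on_def\<close>)
    then show ?thesis by (simp add: matrix_def)
  qed
  have "Ck_on k T (\<lambda>y. fd g y v)" for v
    by (rule Ck_on_solve[OF S(2) M Ck_on_const det sol])
  then show ?case using dg by simp
qed

text \<open>The inverse function theorem yields a differentiable inverse, and
  \<open>Ck_on_local_inverse\<close> raises it to any order. Injectivity of the derivative is
  carried along on all of \<open>U\<close>, because it identifies coordinate fields away from
  \<open>x0\<close>.\<close>

lemma smooth_inverse_function:
  fixes f :: "real^'n \<Rightarrow> real^'n"
  assumes S: "open S" "x0 \<in> S" and f: "smooth_on S f" and inj: "inj (fd f x0)"
  obtains U V g where "open U" "U \<subseteq> S" "x0 \<in> U" "open V" "f x0 \<in> V" "homeomorphism U V f g"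
    "smooth_on V g" "\<And>y v. y \<in> V \<Longrightarrow> fd f (g y) (fd g y v) = v" "\<And>x. x \<in> U \<Longrightarrow> inj (fd f x)"
proof -
  \<comment> \<open>The inverse function theorem wants the derivative as a continuous map into the
    bounded linear maps. \<open>Blinfun\<close> is meaningful on \<open>S\<close> only, where the
    derivative exists.\<close>
  define f' where "f' x = Blinfun (fd f x)" for x
  have f': "blinfun_apply (f' x) = fd f x" if "x \<in> S" for x
    unfolding f'_def using smooth_on_has_derivative[OF f that]
    by (intro bounded_linear_Blinfun_apply) (auto simp: has_derivative_bounded_linear)
  have cf': "continuous_on S f'"
  proof (rule continuous_on_blinfun_componentwise)
    fix i :: "real^'n" assume "i \<in> Basis"
    show "continuous_on S (\<lambda>x. blinfun_apply (f' x) i)"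
      using smooth_on_continuous[OF smooth_on_fd[OF f, of i]] f' continuous_on_cong by force
  qed
  have "linear (fd f x0)" by (rule smooth_on_linear_fd[OF f S(2)])
  then obtain L where L: "linear L" "L \<circ> fd f x0 = id"
    using inj linear_injective_left_inverse by blast
  have bl: "bounded_linear L" using L(1) by (simp add: linear_conv_bounded_linear)
  have idb: "Blinfun L o\<^sub>L f' x0 = id_blinfun"
    using L(2) by (auto intro!: blinfun_eqI simp: f'[OF S(2)] bounded_linear_Blinfun_apply[OF bl] fun_eq_iff)
  obtain U V g g' where *: "open U" "U \<subseteq> S" "x0 \<in> U" "open V" "f x0 \<in> V" "homeomorphism U V f g"
      "\<And>y. y \<in> V \<Longrightarrow> (g has_derivative (g' y)) (at y)"
      "\<And>y. y \<in> V \<Longrightarrow> g' y = inv (blinfun_apply (f'(g y)))"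
      "\<And>y. y \<in> V \<Longrightarrow> bij (blinfun_apply (f'(g y)))"
    using inverse_function_theorem[OF S(1) _ cf' S(2) idb, of f] f' smooth_on_has_derivative[OF f]
    by metis
  have gU: "g y \<in> U" "f (g y) = y" if "y \<in> V" for y
    using *(6) that by (auto simp: homeomorphism_def)
  have injU: "inj (fd f x)" if "x \<in> U" for x
  proof -
    have "f x \<in> V" "g (f x) = x" using *(6) that by (auto simp: homeomorphism_def)
    then show ?thesis using *(9)[of "f x"] f' that *(2) by (auto simp: bij_def)
  qed
  have sg: "smooth_on V g"
    unfolding smooth_on_def
  proof
    fix k
    show "Ck_on k V g"
      by (rule Ck_on_local_inverse[OF *(1,4) smooth_on_subset[OF f *(2)]])
        (use gU *(6) injU in \<open>auto simp: homeomorphism_def intro: differentiableI[OF *(7)]\<close>)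
  qed
  have inv: "fd f (g y) (fd g y v) = v" if y: "y \<in> V" for y v
  proof -
    have f'g: "blinfun_apply (f' (g y)) = fd f (g y)" using f' gU(1)[OF y] *(2) by blast
    have "fd g y = inv (fd f (g y))" using fd_eq[OF *(7)[OF y]] *(8)[OF y] f'g by simp
    moreover have "surj (fd f (g y))" using *(9)[OF y] f'g bij_is_surj by metis
    ultimately show ?thesis using surj_f_inv_f by metis
  qed
  show ?thesis by (rule that[OF *(1-6) sg inv injU])
qed

section \<open>Derivatives of pairings and of exponentially weighted maps\<close>

lemma fd_inner:
  assumes "smooth_on S p" "smooth_on S q" "x \<in> S"
  shows "((\<lambda>y. p y \<bullet> q y) has_derivative (\<lambda>u. p x \<bullet> fd q x u + fd p x u \<bullet> q x)) (at x)"
    "fd (\<lambda>y. p y \<bullet> q y) x u = p x \<bullet> fd q x u + fd p x u \<bullet> q x"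
proof -
  show *: "((\<lambda>y. p y \<bullet> q y) has_derivative (\<lambda>u. p x \<bullet> fd q x u + fd p x u \<bullet> q x)) (at x)"
    by (rule has_derivative_inner[OF smooth_on_has_derivative[OF assms(1,3)] smooth_on_has_derivative[OF assms(2,3)]])
  show "fd (\<lambda>y. p y \<bullet> q y) x u = p x \<bullet> fd q x u + fd p x u \<bullet> q x"
    using fd_eq[OF *] by simp
qed

text \<open>The workhorse for the pairings below: a pairing known in closed form on an open set
  yields, by differentiation, a relation between the pairings of the next order. Differentiability
  of the closed form comes for free.\<close>

lemma fd_inner_cong:
  assumes "open S" "smooth_on S p" "smooth_on S q" "x \<in> S" "\<And>y. y \<in> S \<Longrightarrow> p y \<bullet> q y = k y"
  shows "p x \<bullet> fd q x u + fd p x u \<bullet> q x = fd k x u" "k differentiable (at x)"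
proof -
  have "(k has_derivative (\<lambda>u. p x \<bullet> fd q x u + fd p x u \<bullet> q x)) (at x)"
    by (rule has_derivative_transform_within_open[OF fd_inner(1)[OF assms(2,3,4)] assms(1,4)]) (rule assms(5))
  then show "p x \<bullet> fd q x u + fd p x u \<bullet> q x = fd k x u" "k differentiable (at x)"
    by (auto simp: fd_eq differentiable_def)
qed

lemma fd_add_scaled:
  assumes "smooth_on S p" "smooth_on S q" "x \<in> S"
  shows "fd (\<lambda>y. p y + r *\<^sub>R q y) x u = fd p x u + r *\<^sub>R fd q x u"
  using has_derivative_add[OF smooth_on_has_derivative[OF assms(1,3)]
      has_derivative_scaleR_right[OF smooth_on_has_derivative[OF assms(2,3)], of r]]
  by (simp add: fd_eq)

lemma fd_exp_scaleR:
  fixes t :: "'v::real_normed_vector \<Rightarrow> real" and p :: "'v \<Rightarrow> 'w::real_normed_vector"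
  assumes "smooth_on S t" "smooth_on S p" "x \<in> S"
  shows "((\<lambda>y. exp (c * t y) *\<^sub>R p y) has_derivative
    (\<lambda>u. exp (c * t x) *\<^sub>R (fd p x u + (c * fd t x u) *\<^sub>R p x))) (at x)"
proof -
  have "((\<lambda>y. exp (c * t y)) has_derivative (\<lambda>u. (c * fd t x u) * exp (c * t x))) (at x)"
    by (intro has_derivative_exp has_derivative_mult_right smooth_on_has_derivative[OF assms(1,3)])
  from has_derivative_scaleR[OF this smooth_on_has_derivative[OF assms(2,3)]]
  show ?thesis by (simp add: algebra_simps)
qed

lemma constant_on_ball:
  fixes p :: "'v::real_normed_vector \<Rightarrow> 'w::real_normed_vector"
  assumes "\<And>x. x \<in> ball x0 r \<Longrightarrow> (p has_derivative (\<lambda>_. 0)) (at x)" "x \<in> ball x0 r"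
  shows "p x = p x0"
proof -
  have "x0 \<in> ball x0 r" using assms(2) by (auto intro: le_less_trans[OF zero_le_dist])
  then show ?thesis
    using has_derivative_zero_unique[OF convex_ball, of x0 r p x x0] assms has_derivative_at_withinI by blast
qed

section \<open>Linear algebra with one additional coordinate\<close>

text \<open>The chart of \<open>interval_times\<close> over Euclidean space: the index
  \<open>None\<close> carries the interval coordinate, and \<open>tail\<close> recovers the
  others.\<close>

definition emb :: "real \<Rightarrow> real ^ 'n \<Rightarrow> real ^ 'n option" where
  "emb t q = (\<chi> a. case a of None \<Rightarrow> t | Some i \<Rightarrow> q $ i)"

definition tail :: "real ^ 'n option \<Rightarrow> real ^ 'n" where
  "tail y = (\<chi> i. y $ Some i)"

lemma emb_nth [simp]: "emb t q $ None = t" "emb t q $ Some i = q $ i"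
  by (simp_all add: emb_def)

lemma tail_nth [simp]: "tail y $ i = y $ Some i"
  by (simp add: tail_def)

lemma vec_option_eq_iff: "x = y \<longleftrightarrow> x $ None = y $ None \<and> tail x = tail y"
  unfolding vec_eq_iff by (metis option.exhaust tail_nth)

lemma tail_emb [simp]: "tail (emb t q) = q"
  by (simp add: vec_eq_iff)

lemma emb_collapse [simp]: "emb (y $ None) (tail y) = y"
  by (simp add: vec_option_eq_iff)

lemma emb_eq_iff [simp]: "emb t q = emb s r \<longleftrightarrow> t = s \<and> q = r"
  by (metis emb_nth(1) tail_emb)

lemma emb_add: "emb t q + emb s r = emb (t + s) (q + r)"
  by (simp add: vec_option_eq_iff vec_eq_iff)

lemma emb_scaleR: "c *\<^sub>R emb t q = emb (c * t) (c *\<^sub>R q)"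
  by (simp add: vec_option_eq_iff vec_eq_iff)

lemma emb_0 [simp]: "emb 0 0 = 0"
  by (simp add: vec_option_eq_iff vec_eq_iff)

lemma emb_zero_iff [simp]: "emb t q = 0 \<longleftrightarrow> t = 0 \<and> q = 0"
  by (metis emb_0 emb_eq_iff)

lemma emb_split: "emb t q = t *\<^sub>R axis None 1 + emb 0 q"
  by (simp add: vec_option_eq_iff vec_eq_iff axis_def)

lemma emb_axis: "emb t 0 = t *\<^sub>R axis None 1"
  by (simp add: vec_option_eq_iff vec_eq_iff axis_def)

lemma bounded_linear_emb: "bounded_linear (emb 0 :: real ^ 'n::finite \<Rightarrow> _)"
  unfolding linear_conv_bounded_linear[symmetric]
  by (intro linearI) (simp_all add: emb_add emb_scaleR)

lemma tail_add: "tail (x + y) = tail x + tail y"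
  by (simp add: vec_eq_iff)

lemma tail_scaleR: "tail (c *\<^sub>R x) = c *\<^sub>R tail x"
  by (simp add: vec_eq_iff)

lemma tail_0: "tail 0 = 0"
  by (simp add: vec_eq_iff)

lemma bounded_linear_tail: "bounded_linear (tail :: real ^ 'n::finite option \<Rightarrow> _)"
  unfolding linear_conv_bounded_linear[symmetric]
  by (intro linearI) (simp_all add: tail_add tail_scaleR)

lemma norm_emb_le: "norm (emb t q) \<le> \<bar>t\<bar> + norm q" for q :: "real ^ 'n::finite"
proof -
  have "norm (emb 0 q) = norm q"
    by (simp add: norm_eq_sqrt_inner inner_vec_def UNIV_option_conv sum.reindex)
  then show ?thesis
    using norm_triangle_ineq[of "t *\<^sub>R axis None 1" "emb 0 q"] by (simp add: emb_split[symmetric])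
qed

section \<open>Determinants with one or two distinguished rows\<close>

lemma prod_option: "(\<Prod>a\<in>UNIV. h a) = h None * (\<Prod>i\<in>UNIV. h (Some i))"
  for h :: "'n::finite option \<Rightarrow> real"
  by (simp add: UNIV_option_conv prod.reindex)

text \<open>Laplace expansion along the row \<open>None\<close>: a permutation that moves
  \<open>None\<close> picks a zero entry of that row. Those fixing \<open>None\<close> are the
  permutations of \<open>range Some\<close>, which \<open>map_permutation\<close> identifies with
  the permutations of the smaller index type, preserving signs.\<close>

lemma det_option_block:
  fixes A :: "real ^ 'n::finite option ^ 'n option"
  assumes "A $ None = axis None 1"
  shows "det A = det (\<chi> i j. A $ Some i $ Some j)"
proof -
  let ?U = "UNIV :: 'n option set" and ?R = "range Some :: 'n option set"
  let ?t = "\<lambda>p. of_int (sign p) * (\<Prod>i\<in>?U. A $ i $ p i)"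
  have bij: "bij_betw Some (UNIV :: 'n set) ?R" by (simp add: bij_betw_def)
  have sub: "{p. p permutes ?R} \<subseteq> {p. p permutes ?U}" by (rule Collect_mono, rule impI, rule permutes_subset[of _ ?R]) simp_all
  have "det A = (\<Sum>p\<in>{p. p permutes ?R}. ?t p)"
    unfolding det_def
  proof (rule sum.mono_neutral_right[OF finite_permutations[OF finite] sub], rule ballI)
    fix p assume p: "p \<in> {p. p permutes ?U} - {p. p permutes ?R}"
    have "p None \<noteq> None"
    proof
      assume "p None = None"
      then have "p x = x" if "x \<in> ?U - ?R" for x using that by (cases x) auto
      then have "p permutes ?R" using p permutes_superset[of p ?U ?R] by blast
      then show False using p by simp
    qed
    then have "A $ None $ p None = 0" by (simp add: assms axis_def)
    then show "?t p = 0" by (simp add: UNIV_option_conv)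
  qed
  also have "\<dots> = (\<Sum>p\<in>{p. p permutes (UNIV :: 'n set)}. of_int (sign p) * (\<Prod>i\<in>UNIV. A $ Some i $ Some (p i)))"
  proof (rule sum.reindex_bij_witness[of _ "map_permutation UNIV Some" "map_permutation ?R the"])
    fix p :: "'n \<Rightarrow> 'n" assume "p \<in> {p. p permutes UNIV}"
    then have p: "p permutes UNIV" by simp
    show "map_permutation UNIV Some p \<in> {p. p permutes ?R}"
      using map_permutation_permutes[OF bij p] by simp
    show "map_permutation ?R the (map_permutation UNIV Some p) = p"
      by (rule map_permutation_compose_inv[OF bij p]) simp
  next
    fix p assume "p \<in> {p. p permutes ?R}"
    then have p: "p permutes ?R" by simp
    have bij': "bij_betw the ?R (UNIV :: 'n set)"
      by (rule bij_betwI[where g = Some]) auto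
    have inj: "inj_on the ?R" using bij' by (simp add: bij_betw_def)
    show "map_permutation ?R the p \<in> {p. p permutes UNIV}"
      using map_permutation_permutes[OF bij' p] by simp
    show "map_permutation UNIV Some (map_permutation ?R the p) = p"
      by (rule map_permutation_compose_inv[OF bij' p]) auto
    have None: "p None = None" using p by (rule permutes_not_in) auto
    have "p (Some i) = Some (map_permutation ?R the p i)" for i
    proof -
      have "p (Some i) \<in> ?R" using permutes_in_image[OF p, of "Some i"] by simp
      moreover have "map_permutation ?R the p (the (Some i)) = the (p (Some i))"
        by (rule map_permutation_apply[OF inj]) simp
      ultimately show ?thesis by auto
    qed
    moreover have "sign (map_permutation ?R the p) = sign p"
      by (rule sign_map_permutation[OF inj p]) simp
    ultimately show "of_int (sign (map_permutation ?R the p)) * (\<Prod>i\<in>UNIV. A $ Some i $ Some (map_permutation ?R the p i)) = ?t p"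
      by (simp add: UNIV_option_conv prod.reindex None assms)
  qed
  finally show ?thesis by (simp add: det_def)
qed

text \<open>As a function of the two rows the determinant is bilinear and alternating, so a linear
  change of these rows contributes its own 2 by 2 determinant.\<close>

lemma det_two_rows:
  fixes u v :: "real ^ 'n::finite" and R :: "'n \<Rightarrow> real ^ 'n"
  assumes "i \<noteq> j"
  shows "det (\<chi> a. if a = i then p *s u + q *s v else if a = j then r *s u + s *s v else R a)
    = (p * s - q * r) * det (\<chi> a. if a = i then u else if a = j then v else R a)"
proof -
  define D where "D x y = det (\<chi> a. if a = i then x else if a = j then y else R a)" for x y
  have l: "D (p *s x + q *s x') y = p * D x y + q * D x' y" for p q x x' y
    unfolding D_def by (simp add: det_row_add det_row_mul)
  have swap: "D x y = det (\<chi> a. if a = j then y else if a = i then x else R a)" for x y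
    unfolding D_def using assms by (intro arg_cong[where f = det]) (auto simp: vec_eq_iff)
  have r: "D x (p *s y + q *s y') = p * D x y + q * D x y'" for p q x y y'
    unfolding swap by (simp add: det_row_add det_row_mul)
  have 0: "D x x = 0" for x
    unfolding D_def by (rule det_identical_rows[OF assms]) (simp add: row_def)
  \<comment> \<open>Polarisation: expanding the vanishing value at two equal rows
    \<open>u + v\<close> gives antisymmetry.\<close>
  have "D u v + D v u = D (1 *s u + 1 *s v) (1 *s u + 1 *s v)" unfolding l r by (simp add: 0)
  then have "D v u = - D u v" using 0[of "1 *s u + 1 *s v"] by linarith
  then have "D (p *s u + q *s v) (r *s u + s *s v) = (p * s - q * r) * D u v"
    unfolding l r by (simp add: 0 algebra_simps)
  then show ?thesis unfolding D_def .
qed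

lemma det_map_rows:
  fixes L :: "real ^ 'n::finite \<Rightarrow> real ^ 'n"
  assumes "linear L"
  shows "det (\<chi> a. L (R a)) = det (matrix L) * det (\<chi> a. R a)"
proof -
  have "L (R a) $ b = (\<Sum>k\<in>UNIV. R a $ k * matrix L $ b $ k)" for a b
    using matrix_works[OF assms[folded linear_matrix_vector_mul_eq], of "R a"] by (simp add: matrix_vector_mult_def vec_eq_iff mult.commute)
  then have "(\<chi> a. L (R a)) = (\<chi> a. R a) ** transpose (matrix L)"
    by (simp add: vec_eq_iff matrix_matrix_mult_def transpose_def)
  then show ?thesis by (simp add: det_mul det_transpose mult.commute)
qed

text \<open>\<open>D\<close> and \<open>p\<close> together define an endomorphism \<open>L\<close>
  of the ambient space, injective by \<open>ind\<close> and hence bijective by dimension. Its images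
  of the standard basis are the rows of the determinant. It is used for splitting ambient vectors
  into a tangential part and a multiple of the position vector.\<close>

lemma linear_frame:
  fixes D :: "real ^ 'n::finite \<Rightarrow> real ^ 'n option"
  assumes D: "linear D" and ind: "\<And>z r. D z + r *\<^sub>R p = 0 \<Longrightarrow> z = 0 \<and> r = 0"
  shows "\<exists>z r. w = D z + r *\<^sub>R p"
    and "det (\<chi> a. case a of None \<Rightarrow> p | Some i \<Rightarrow> D (axis i 1)) \<noteq> 0"
proof -
  define L where "L y = D (tail y) + (y $ None) *\<^sub>R p" for y
  have L: "linear L"
    unfolding L_def
    by (intro linearI) (simp_all add: tail_add tail_scaleR linear_add[OF D] linear_scale[OF D] algebra_simps)
  have inj: "inj L"
  proof (unfold linear_injective_0[OF L], intro allI impI)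
    fix y assume "L y = 0"
    then have "tail y = 0" "y $ None = 0" using ind unfolding L_def by blast+
    then show "y = 0" using emb_collapse[of y] by simp
  qed
  then have "surj L" using linear_inj_imp_surj[OF L] by blast
  then obtain y where "w = L y" by (meson surjD)
  then show "\<exists>z r. w = D z + r *\<^sub>R p" by (auto simp: L_def)
  have "(\<chi> a. case a of None \<Rightarrow> p | Some i \<Rightarrow> D (axis i 1)) = (\<chi> a. L (axis a 1))"
  proof -
    have "tail (axis None 1 :: real ^ 'n option) = 0" "tail (axis (Some i) 1 :: real ^ 'n option) = axis i 1" for i
      by (simp_all add: vec_eq_iff axis_def)
    then have "L (axis None 1) = p" "L (axis (Some i) 1) = D (axis i 1)" for i
      by (simp_all add: L_def linear_0[OF D], simp_all add: axis_def)
    then show ?thesis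
      by (intro arg_cong[where f = vec_lambda] ext) (simp split: option.split)
  qed
  then have "det (\<chi> a. case a of None \<Rightarrow> p | Some i \<Rightarrow> D (axis i 1)) = det (matrix L) *
      det (\<chi> a. (axis a 1 :: real ^ 'n option))"
    by (simp add: det_map_rows[OF L])
  moreover have "(\<chi> a. (axis a 1 :: real ^ 'n option)) = (mat 1 :: real ^ 'n option ^ 'n option)"
    by (auto simp: vec_eq_iff mat_def axis_def)
  ultimately show "det (\<chi> a. case a of None \<Rightarrow> p | Some i \<Rightarrow> D (axis i 1)) \<noteq> 0"
    using det_nz_iff_inj[OF L] inj by simp
qed

text \<open>The functional is the inner product with a vector \<open>n\<close>. An orthogonal map
  taking the axis \<open>None\<close> to the direction of \<open>n\<close> carries the coordinate
  hyperplane onto the kernel. This parametrises the orthogonal complement of \<open>T\<close> by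
  \<open>real ^ 'k\<close>.\<close>

lemma linear_functional_kernel_param:
  fixes a :: "real ^ 'n::finite option \<Rightarrow> real"
  assumes a: "linear a" and nz: "a \<noteq> (\<lambda>_. 0)"
  obtains L :: "real ^ 'n \<Rightarrow> real ^ 'n option" where "linear L" "inj L" "range L = {u. a u = 0}"
proof -
  define n where "n = (\<chi> i. a (axis i 1))"
  have n: "a u = n \<bullet> u" for u
  proof -
    have "a u = a (\<Sum>i\<in>UNIV. u $ i *\<^sub>R axis i 1)"
      by (simp add: basis_expansion flip: scalar_mult_eq_scaleR)
    then show ?thesis using a by (simp add: linear_sum linear_scale inner_vec_def n_def mult.commute)
  qed
  have n0: "n \<noteq> 0" using nz n by auto
  have "norm (norm n *\<^sub>R axis None (1::real) :: real ^ 'n option) = norm n" by simp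
  from orthogonal_transformation_exists[OF this]
  obtain Q :: "real ^ 'n option \<Rightarrow> real ^ 'n option"
    where Q: "orthogonal_transformation Q" "Q (norm n *\<^sub>R axis None 1) = n" by blast
  have lQ: "linear Q" using Q(1) by (rule orthogonal_transformation_linear)
  have iQ: "inj Q" "surj Q" using Q(1) orthogonal_transformation_inj orthogonal_transformation_surj by blast+
  have key: "a (Q y) = norm n * (y $ None)" for y
  proof -
    have "a (Q y) = Q (norm n *\<^sub>R axis None 1) \<bullet> Q y" using n Q(2) by simp
    also have "\<dots> = (norm n *\<^sub>R axis None 1) \<bullet> y" using Q(1) by (simp add: orthogonal_transformation_def)
    finally show ?thesis by (simp add: inner_axis')
  qed
  show thesis
  proof (rule that[of "\<lambda>w. Q (emb 0 w)"])
    show "linear (\<lambda>w. Q (emb 0 w))"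
      using linear_compose[OF bounded_linear.linear[OF bounded_linear_emb] lQ] by (simp add: o_def)
    show "inj (\<lambda>w. Q (emb 0 w))" using iQ(1) by (intro injI) (metis injD tail_emb)
    show "range (\<lambda>w. Q (emb 0 w)) = {u. a u = 0}"
    proof
      show "range (\<lambda>w. Q (emb 0 w)) \<subseteq> {u. a u = 0}" by (auto simp: key)
      show "{u. a u = 0} \<subseteq> range (\<lambda>w. Q (emb 0 w))"
      proof
        fix u assume u: "u \<in> {u. a u = 0}"
        obtain y where y: "u = Q y" using iQ(2) by (meson surjD)
        have "y $ None = 0" using u n0 by (simp add: y key)
        then have "y = emb 0 (tail y)" by (simp add: vec_option_eq_iff)
        then show "u \<in> range (\<lambda>w. Q (emb 0 w))" using y by (metis rangeI)
      qed
    qed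
  qed
qed

section \<open>Affine spheres in a chart\<close>

text \<open>The center is the origin, so the affine normal is \<open>- lam\<close> times the
  position vector; \<open>gauss\<close> is the Gauss formula with this normal for coordinate fields.
  Accordingly \<open>H\<close> holds the coefficients of the affine metric and
  \<open>\<Gamma>\<close> the Christoffel symbols of the induced connection.\<close>

locale centroaffine_chart =
  fixes \<Omega> :: "(real ^ 'm::finite) set" and f :: "real ^ 'm \<Rightarrow> real ^ 'm option"
    and H :: "real ^ 'm \<Rightarrow> real ^ 'm \<Rightarrow> real ^ 'm \<Rightarrow> real"
    and \<Gamma> :: "real ^ 'm \<Rightarrow> real ^ 'm \<Rightarrow> real ^ 'm \<Rightarrow> real ^ 'm"
    and lam :: real
  assumes open_\<Omega>: "open \<Omega>" and smooth_f: "smooth_on \<Omega> f"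
    and indep: "\<And>x u r. x \<in> \<Omega> \<Longrightarrow> fd f x u + r *\<^sub>R f x = 0 \<Longrightarrow> u = 0 \<and> r = 0"
    and gauss: "\<And>x u v. x \<in> \<Omega> \<Longrightarrow> fd (\<lambda>y. fd f y v) x u = fd f x (\<Gamma> x u v) - (lam * H x u v) *\<^sub>R f x"
    and H_pos: "\<And>x u. x \<in> \<Omega> \<Longrightarrow> u \<noteq> 0 \<Longrightarrow> H x u u > 0"
    and lam_neg: "lam < 0"
begin

section \<open>Conormal map and symmetries of the metric coefficients\<close>

definition frame :: "real ^ 'm \<Rightarrow> real ^ 'm option ^ 'm option" where
  "frame x = (\<chi> a. case a of None \<Rightarrow> f x | Some i \<Rightarrow> fd f x (axis i 1))"

text \<open>The conormal: it annihilates the tangent space and has pairing \<open>1\<close> with the affine normal \<open>- lam f\<close>.\<close>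

definition \<nu> :: "real ^ 'm \<Rightarrow> real ^ 'm option" where
  "\<nu> x = (SOME w. frame x *v w = axis None (- 1 / lam))"

lemma fd_f_expand:
  assumes "x \<in> \<Omega>"
  shows "fd f x u = (\<Sum>i\<in>UNIV. u $ i *\<^sub>R fd f x (axis i 1))"
proof -
  have l: "linear (fd f x)" by (rule smooth_on_linear_fd[OF smooth_f assms])
  have "fd f x u = fd f x (\<Sum>i\<in>UNIV. u $ i *\<^sub>R axis i 1)"
    by (simp add: basis_expansion flip: scalar_mult_eq_scaleR)
  then show ?thesis using l by (simp add: linear_sum linear_scale)
qed

lemma frame_mult_nth:
  "(frame x *v w) $ None = w \<bullet> f x" "(frame x *v w) $ Some i = w \<bullet> fd f x (axis i 1)"
  by (simp_all add: frame_def matrix_vector_mult_def inner_vec_def mult.commute)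

lemma det_frame: assumes "x \<in> \<Omega>" shows "det (frame x) \<noteq> 0"
  unfolding frame_def by (rule linear_frame(2)[OF smooth_on_linear_fd[OF smooth_f assms] indep[OF assms]])

text \<open>The tangent vectors and the position vector span the ambient space. Equations between
  conormal quantities, whose expansions are unknown, are proved by pairing with this frame.\<close>

lemma covector_eqI:
  assumes "x \<in> \<Omega>" "\<And>v. p \<bullet> fd f x v = q \<bullet> fd f x v" "p \<bullet> f x = q \<bullet> f x"
  shows "p = q"
proof -
  have "frame x *v p = frame x *v q"
    unfolding vec_eq_iff by (metis assms(2,3) frame_mult_nth option.exhaust)
  then show ?thesis using det_frame[OF assms(1)]
    by (metis invertible_det_nz inj_matrix_vector_mult injD)
qed

lemma frame_\<nu>: "x \<in> \<Omega> \<Longrightarrow> frame x *v \<nu> x = axis None (- 1 / lam)"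
  unfolding \<nu>_def by (rule someI_ex) (use cramer[OF det_frame] in blast)

lemma \<nu>_f: "x \<in> \<Omega> \<Longrightarrow> \<nu> x \<bullet> f x = - 1 / lam"
  using frame_\<nu> frame_mult_nth(1) by (metis axis_nth)

lemma \<nu>_df: assumes "x \<in> \<Omega>" shows "\<nu> x \<bullet> fd f x u = 0"
proof -
  have "\<nu> x \<bullet> fd f x (axis i 1) = 0" for i
    using frame_\<nu>[OF assms] frame_mult_nth(2)[of x "\<nu> x" i] by (simp add: axis_def)
  then show ?thesis by (subst fd_f_expand[OF assms]) (simp add: inner_sum_right)
qed

text \<open>The choice in \<open>\<nu>\<close> is harmless: the linear system has a unique solution,
  which is as smooth as its coefficients.\<close>

lemma smooth_\<nu>: "smooth_on \<Omega> \<nu>"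
  unfolding smooth_on_def
proof (rule allI, rule Ck_on_solve[OF open_\<Omega> _ _ det_frame frame_\<nu>])
  fix k i j
  have "smooth_on \<Omega> (\<lambda>x. frame x $ i $ j)"
    using smooth_on_vec_nth[OF open_\<Omega>] smooth_f smooth_on_fd[OF smooth_f]
    by (cases i) (auto simp: frame_def)
  then show "Ck_on k \<Omega> (\<lambda>x. frame x $ i $ j)" by (simp add: smooth_on_def)
qed (auto intro: Ck_on_const)

abbreviation "d2f x u v \<equiv> fd (\<lambda>y. fd f y v) x u"

lemma smooth_df: "smooth_on \<Omega> (\<lambda>x. fd f x v)"
  by (rule smooth_on_fd[OF smooth_f])

lemma smooth_d2f: "smooth_on \<Omega> (\<lambda>x. d2f x u v)"
  by (rule smooth_on_fd[OF smooth_df])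

text \<open>Pairing with the conormal removes the tangential part, and the factors
  \<open>- lam\<close> and \<open>- 1 / lam\<close> cancel. From this formula \<open>H\<close>
  inherits bilinearity, symmetry and smoothness.\<close>

lemma H_eq: "x \<in> \<Omega> \<Longrightarrow> H x u v = \<nu> x \<bullet> d2f x u v"
  using lam_neg by (simp add: gauss \<nu>_f \<nu>_df inner_diff_right)

lemma d2f_sym: "x \<in> \<Omega> \<Longrightarrow> d2f x u v = d2f x v u"
  by (rule fd_commute[OF open_\<Omega> _ smooth_f])

lemma H_sym: "x \<in> \<Omega> \<Longrightarrow> H x u v = H x v u"
  by (simp add: H_eq d2f_sym)

lemma linear_H_left: assumes "x \<in> \<Omega>" shows "linear (\<lambda>u. H x u v)"
  unfolding H_eq[OF assms]
  using linear_compose[OF smooth_on_linear_fd[OF smooth_df assms] bounded_linear.linear[OF bounded_linear_inner_right]]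
  by (simp add: o_def)

lemma H_linear:
  assumes x: "x \<in> \<Omega>"
  shows "H x (u + u') v = H x u v + H x u' v" "H x (r *\<^sub>R u) v = r * H x u v"
    "H x (u - u') v = H x u v - H x u' v" "H x 0 v = 0"
    "H x v (u + u') = H x v u + H x v u'" "H x v (r *\<^sub>R u) = r * H x v u"
    "H x v (u - u') = H x v u - H x v u'" "H x v 0 = 0"
  using linear_add[OF linear_H_left[OF x]] linear_scale[OF linear_H_left[OF x]]
    linear_diff[OF linear_H_left[OF x]] linear_0[OF linear_H_left[OF x]]
  by (simp_all add: H_sym[OF x, of v])

lemma H_nondegenerate:
  assumes x: "x \<in> \<Omega>" and "\<And>v. H x u v = H x w v" shows "u = w"
proof (rule ccontr)
  assume "u \<noteq> w"
  then have "H x (u - w) (u - w) > 0" using H_pos[OF x, of "u - w"] by simp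
  then show False using assms(2) by (simp add: H_linear[OF x])
qed

lemma d\<nu>_f: assumes x: "x \<in> \<Omega>" shows "fd \<nu> x u \<bullet> f x = 0"
  using fd_inner_cong(1)[OF open_\<Omega> smooth_\<nu> smooth_f x \<nu>_f, of u] \<nu>_df[OF x] by simp

text \<open>Derivative of the relation that the conormal annihilates tangent vectors. It makes the
  pairing of the two differentials a nondegenerate substitute for the metric.\<close>

lemma d\<nu>_df: assumes x: "x \<in> \<Omega>" shows "fd \<nu> x u \<bullet> fd f x v = - H x u v"
  using fd_inner_cong(1)[OF open_\<Omega> smooth_\<nu> smooth_df x \<nu>_df, of v u] H_eq[OF x] by simp

lemma \<Gamma>_sym: assumes x: "x \<in> \<Omega>" shows "\<Gamma> x u v = \<Gamma> x v u"
proof -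
  have "fd f x (\<Gamma> x u v) = fd f x (\<Gamma> x v u)"
    using gauss[OF x, of v u] gauss[OF x, of u v] d2f_sym[OF x, of u v] H_sym[OF x, of u v] by simp
  then have "fd f x (\<Gamma> x u v - \<Gamma> x v u) + 0 *\<^sub>R f x = 0"
    by (simp add: linear_diff[OF smooth_on_linear_fd[OF smooth_f x]])
  then show ?thesis using indep[OF x] by fastforce
qed

text \<open>The \<open>\<xi>\<close>-component of the third derivatives of \<open>f\<close>. Its total symmetry is the Codazzi equation
  for the affine metric.\<close>

definition "third x w u v = \<nu> x \<bullet> fd (\<lambda>y. d2f y u v) x w"

lemma third_sym:
  assumes x: "x \<in> \<Omega>" shows "third x w u v = third x w v u" "third x w u v = third x u w v"
proof -
  show "third x w u v = third x w v u"
    unfolding third_def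
    using fd_cong[OF open_\<Omega> x d2f_sym[of _ u v]] by simp
  show "third x w u v = third x u w v"
    unfolding third_def using fd_commute[OF open_\<Omega> x smooth_df] by simp
qed

lemma third_eq:
  assumes x: "x \<in> \<Omega>" shows "third x w u v = fd (\<lambda>y. H y u v) x w + H x w (\<Gamma> x u v)"
proof -
  have "\<nu> x \<bullet> fd (\<lambda>y. d2f y u v) x w + fd \<nu> x w \<bullet> d2f x u v = fd (\<lambda>y. H y u v) x w"
    by (rule fd_inner_cong(1)[OF open_\<Omega> smooth_\<nu> smooth_d2f x]) (simp add: H_eq)
  then show ?thesis
    by (simp add: third_def gauss[OF x] inner_diff_right d\<nu>_df[OF x] d\<nu>_f[OF x])
qed

lemma smooth_H: "smooth_on \<Omega> (\<lambda>x. H x u v)"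
  by (rule smooth_on_cong[OF open_\<Omega> _ smooth_on_inner[OF open_\<Omega> smooth_\<nu> smooth_d2f]]) (simp add: H_eq)

end

text \<open>\<open>\<tau>\<close> has the components of \<open>T\<close>, and
  \<open>\<Gamma>h\<close> plays the role of the Levi-Civita Christoffel symbols. The difference
  tensor is \<open>\<Gamma> - \<Gamma>h\<close>, and the second distribution appears as the
  orthogonal complement of \<open>\<tau>\<close>.\<close>

locale sphere_chart = centroaffine_chart \<Omega> f H \<Gamma> lam
  for \<Omega> :: "(real ^ 'm::finite) set" and f H \<Gamma> lam +
  fixes \<tau> :: "real ^ 'm \<Rightarrow> real ^ 'm"
    and \<Gamma>h :: "real ^ 'm \<Rightarrow> real ^ 'm \<Rightarrow> real ^ 'm \<Rightarrow> real ^ 'm"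
    and lam1 lam2 :: real
  assumes smooth_\<tau>: "smooth_on \<Omega> \<tau>"
    and unit: "\<And>x. x \<in> \<Omega> \<Longrightarrow> H x (\<tau> x) (\<tau> x) = 1"
    and \<Gamma>h_sym: "\<And>x u v. x \<in> \<Omega> \<Longrightarrow> \<Gamma>h x u v = \<Gamma>h x v u"
    and metric: "\<And>x u v w. x \<in> \<Omega> \<Longrightarrow> fd (\<lambda>y. H y v w) x u = H x (\<Gamma>h x u v) w + H x v (\<Gamma>h x u w)"
    and K_T: "\<And>x. x \<in> \<Omega> \<Longrightarrow> \<Gamma> x (\<tau> x) (\<tau> x) - \<Gamma>h x (\<tau> x) (\<tau> x) = lam1 *\<^sub>R \<tau> x"
    and K_U: "\<And>x u. x \<in> \<Omega> \<Longrightarrow> H x (\<tau> x) u = 0 \<Longrightarrow> \<Gamma> x (\<tau> x) u - \<Gamma>h x (\<tau> x) u = lam2 *\<^sub>R u"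
    and lam_eq: "- lam + lam1 * lam2 - lam2\<^sup>2 = 0"
begin

definition "\<mu> = lam1 - lam2"
definition "\<delta> = \<mu> - lam2"

lemma lam_prod: "lam = \<mu> * lam2"
  using lam_eq by (simp add: \<mu>_def algebra_simps power2_eq_square)

text \<open>A negative product \<open>\<mu> * lam2\<close> excludes zero factors as well as equal
  ones, since equal factors would make \<open>lam\<close> a square.\<close>

lemma nonzero: "lam \<noteq> 0" "\<mu> \<noteq> 0" "lam2 \<noteq> 0" "\<delta> \<noteq> 0"
proof -
  show "lam \<noteq> 0" "\<mu> \<noteq> 0" "lam2 \<noteq> 0" using lam_neg lam_prod by auto
  show "\<delta> \<noteq> 0"
  proof
    assume "\<delta> = 0"
    then have "lam = lam2 * lam2" using lam_prod by (simp add: \<delta>_def)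
    then show False using lam_neg by (metis not_square_less_zero)
  qed
qed

section \<open>The cubic form and its values on T\<close>

definition "cubic x u v w = H x (\<Gamma> x u v - \<Gamma>h x u v) w"

text \<open>By metric compatibility the cubic form is the transversal part of the third derivative
  of \<open>f\<close> minus three Levi-Civita terms. Their sum is totally symmetric because
  \<open>\<Gamma>h\<close> is, so the symmetry of \<open>third\<close> carries over.\<close>

lemma cubic_sym:
  assumes x: "x \<in> \<Omega>" shows "cubic x u v w = cubic x v u w" "cubic x u v w = cubic x w v u"
proof -
  show "cubic x u v w = cubic x v u w"
    using \<Gamma>_sym[OF x] \<Gamma>h_sym[OF x] by (simp add: cubic_def)
  have *: "cubic x u v w = third x w u v - (H x (\<Gamma>h x w u) v + H x u (\<Gamma>h x w v) + H x w (\<Gamma>h x u v))" for u v w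
    using third_eq[OF x, of w u v] metric[OF x, of u v w] H_sym[OF x]
    by (simp add: cubic_def H_linear[OF x])
  show "cubic x u v w = cubic x w v u"
    unfolding * using third_sym[OF x] \<Gamma>h_sym[OF x, of w u] \<Gamma>h_sym[OF x, of u v]
     \<Gamma>h_sym[OF x, of w v] H_sym[OF x] by (simp add: add.commute)
qed

abbreviation "\<alpha> x u \<equiv> H x (\<tau> x) u"

text \<open>Total symmetry allows the hypotheses on \<open>K\<close> to be used in either remaining
  slot after splitting \<open>u\<close> along \<open>\<tau>\<close> and its complement. The
  coefficient \<open>\<mu>\<close> is the excess of \<open>lam1\<close>, the value on
  \<open>\<tau>\<close>, over \<open>lam2\<close>.\<close>

lemma cubic_\<tau>:
  assumes x: "x \<in> \<Omega>" shows "cubic x (\<tau> x) u v = lam2 * H x u v + \<mu> * \<alpha> x u * \<alpha> x v"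
proof -
  have sym23: "cubic x p q r = cubic x p r q" for p q r using cubic_sym[OF x] by metis
  define u2 where "u2 = u - \<alpha> x u *\<^sub>R \<tau> x"
  have u: "u = \<alpha> x u *\<^sub>R \<tau> x + u2" by (simp add: u2_def)
  have a2: "\<alpha> x u2 = 0" by (simp add: u2_def H_linear[OF x] unit[OF x])
  have "cubic x (\<tau> x) u v = cubic x (\<tau> x) v u" by (rule sym23)
  also have "\<dots> = \<alpha> x u * cubic x (\<tau> x) v (\<tau> x) + cubic x (\<tau> x) v u2"
    by (subst u) (simp add: cubic_def H_linear[OF x])
  also have "cubic x (\<tau> x) v (\<tau> x) = lam1 * \<alpha> x v"
    by (subst sym23) (simp add: cubic_def K_T[OF x] H_linear[OF x])
  also have "cubic x (\<tau> x) v u2 = lam2 * H x u2 v"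
    by (subst sym23) (simp add: cubic_def K_U[OF x a2] H_linear[OF x])
  finally show ?thesis
    by (simp add: u2_def H_linear[OF x] \<mu>_def algebra_simps)
qed

lemma \<Gamma>_\<tau>:
  assumes x: "x \<in> \<Omega>" shows "\<Gamma> x u (\<tau> x) = \<Gamma>h x u (\<tau> x) + lam2 *\<^sub>R u + (\<mu> * \<alpha> x u) *\<^sub>R \<tau> x"
proof -
  have "\<Gamma> x (\<tau> x) u - \<Gamma>h x (\<tau> x) u = lam2 *\<^sub>R u + (\<mu> * \<alpha> x u) *\<^sub>R \<tau> x"
    by (rule H_nondegenerate[OF x])
      (use cubic_\<tau>[OF x, of u] in \<open>simp add: cubic_def H_linear[OF x]\<close>)
  then show ?thesis using \<Gamma>_sym[OF x] \<Gamma>h_sym[OF x] by (simp add: algebra_simps)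
qed

text \<open>\<open>covT x u\<close> is the Levi-Civita derivative of \<open>\<tau>\<close> in direction \<open>u\<close>; the aim is that it vanishes.\<close>

definition "covT x u = \<Gamma>h x u (\<tau> x) + fd \<tau> x u"

section \<open>T and its conormal image as ambient maps\<close>

definition "Tv x = fd f x (\<tau> x)"
definition "Nv x = fd \<nu> x (\<tau> x)"

lemma smooth_Tv: "smooth_on \<Omega> Tv"
  unfolding Tv_def[abs_def] by (rule smooth_on_fd_field[OF open_\<Omega> smooth_f smooth_\<tau>])

lemma smooth_Nv: "smooth_on \<Omega> Nv"
  unfolding Nv_def[abs_def] by (rule smooth_on_fd_field[OF open_\<Omega> smooth_\<nu> smooth_\<tau>])

lemma linear_df: "x \<in> \<Omega> \<Longrightarrow> linear (fd f x)"
  by (rule smooth_on_linear_fd[OF smooth_f])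

lemma dTv:
  assumes x: "x \<in> \<Omega>"
  shows "fd Tv x u = fd f x (covT x u + lam2 *\<^sub>R u + (\<mu> * \<alpha> x u) *\<^sub>R \<tau> x) - (lam * \<alpha> x u) *\<^sub>R f x"
proof -
  have "fd Tv x u = d2f x u (\<tau> x) + fd f x (fd \<tau> x u)"
    unfolding Tv_def[abs_def]
    by (rule fd_fd_field[OF open_\<Omega> x smooth_f smooth_on_differentiable[OF smooth_\<tau> x]])
  then show ?thesis
    by (simp add: gauss[OF x] \<Gamma>_\<tau>[OF x] covT_def H_sym[OF x, of u] linear_add[OF linear_df[OF x]])
qed

lemma Nv_f: "x \<in> \<Omega> \<Longrightarrow> Nv x \<bullet> f x = 0"
  by (simp add: Nv_def d\<nu>_f)

lemma Nv_df: "x \<in> \<Omega> \<Longrightarrow> Nv x \<bullet> fd f x v = - \<alpha> x v"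
  by (simp add: Nv_def d\<nu>_df)

text \<open>\<open>H\<close> is known to be smooth for fixed directions, whereas the first slot of
  \<open>\<alpha>\<close> moves with the point. Writing \<open>\<alpha>\<close> as a pairing of
  \<open>\<nu>\<close> with the derivative of \<open>fd f _ v\<close> along \<open>\<tau>\<close>
  yields differentiability and the formula together.\<close>

lemma d\<alpha>:
  assumes x: "x \<in> \<Omega>"
  shows "fd (\<lambda>y. \<alpha> y v) x u = H x (covT x u) v + \<alpha> x (\<Gamma>h x u v)" "(\<lambda>y. \<alpha> y v) differentiable (at x)"
proof -
  let ?g = "\<lambda>z. fd f z v"
  have gt: "smooth_on \<Omega> (\<lambda>y. fd ?g y (\<tau> y))"
    by (rule smooth_on_fd_field[OF open_\<Omega> smooth_df smooth_\<tau>])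
  have 1: "\<nu> x \<bullet> fd (\<lambda>y. fd ?g y (\<tau> y)) x u + fd \<nu> x u \<bullet> fd ?g x (\<tau> x) = fd (\<lambda>y. \<alpha> y v) x u"
    by (rule fd_inner_cong(1)[OF open_\<Omega> smooth_\<nu> gt x]) (simp add: H_eq)
  have 2: "\<nu> x \<bullet> fd (\<lambda>y. d2f y (\<tau> x) v) x u + fd \<nu> x u \<bullet> d2f x (\<tau> x) v = fd (\<lambda>y. H y (\<tau> x) v) x u"
    by (rule fd_inner_cong(1)[OF open_\<Omega> smooth_\<nu> smooth_d2f x]) (simp add: H_eq)
  have "fd (\<lambda>y. \<alpha> y v) x u = fd (\<lambda>y. H y (\<tau> x) v) x u + H x (fd \<tau> x u) v"
    using 1 2 fd_fd_field[OF open_\<Omega> x smooth_df smooth_on_differentiable[OF smooth_\<tau> x], of v u]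
    by (simp add: H_eq[OF x] inner_add_right)
  then show "fd (\<lambda>y. \<alpha> y v) x u = H x (covT x u) v + \<alpha> x (\<Gamma>h x u v)"
    by (simp add: metric[OF x] covT_def H_linear[OF x])
  show "(\<lambda>y. \<alpha> y v) differentiable (at x)"
    by (rule fd_inner_cong(2)[OF open_\<Omega> smooth_\<nu> gt x]) (simp add: H_eq)
qed

text \<open>The conormal counterpart of \<open>dTv\<close>. As the pairing of the two differentials
  is \<open>- H\<close>, the \<open>covT\<close> term has the same sign as there, while the terms
  from the difference tensor change sign.\<close>

lemma dNv_df:
  assumes x: "x \<in> \<Omega>"
  shows "fd Nv x u \<bullet> fd f x v = - H x (covT x u) v + lam2 * H x u v + \<mu> * \<alpha> x u * \<alpha> x v"
proof -
  have "Nv x \<bullet> d2f x u v + fd Nv x u \<bullet> fd f x v = fd (\<lambda>y. - \<alpha> y v) x u"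
    by (rule fd_inner_cong(1)[OF open_\<Omega> smooth_Nv smooth_df x Nv_df])
  also have "fd (\<lambda>y. - \<alpha> y v) x u = - fd (\<lambda>y. \<alpha> y v) x u"
    by (rule fun_cong[OF fd_eq[OF has_derivative_minus]])
      (use d\<alpha>(2)[OF x] in \<open>simp add: frechet_derivative_works\<close>)
  also have "\<dots> = - (H x (covT x u) v + \<alpha> x (\<Gamma>h x u v))" by (simp add: d\<alpha>(1)[OF x])
  finally have "fd Nv x u \<bullet> fd f x v = - H x (covT x u) v + (\<alpha> x (\<Gamma> x u v) - \<alpha> x (\<Gamma>h x u v))"
    by (simp add: gauss[OF x] inner_diff_right Nv_df[OF x] Nv_f[OF x])
  also have "\<alpha> x (\<Gamma> x u v) - \<alpha> x (\<Gamma>h x u v) = cubic x u v (\<tau> x)"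
    by (simp add: cubic_def H_sym[OF x, of "\<Gamma> x u v - \<Gamma>h x u v" "\<tau> x"] H_linear(5-8)[OF x])
  also have "\<dots> = cubic x (\<tau> x) u v" using cubic_sym[OF x] by metis
  finally show ?thesis by (simp add: cubic_\<tau>[OF x])
qed

lemma dNv_f: assumes x: "x \<in> \<Omega>" shows "fd Nv x u \<bullet> f x = \<alpha> x u"
  using fd_inner_cong(1)[OF open_\<Omega> smooth_Nv smooth_f x Nv_f, of u] Nv_df[OF x, of u] by simp

text \<open>The unit length of \<open>\<tau>\<close> says that \<open>Nv \<bullet> Tv\<close> is
  constantly \<open>- 1\<close>. In its derivative the contributions of the difference tensor cancel
  and two equal \<open>covT\<close> terms remain.\<close>

lemma covT_\<tau>_orth: assumes x: "x \<in> \<Omega>" shows "\<alpha> x (covT x u) = 0"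
proof -
  have "Nv x \<bullet> fd Tv x u + fd Nv x u \<bullet> Tv x = fd (\<lambda>y. - 1) x u"
    by (rule fd_inner_cong(1)[OF open_\<Omega> smooth_Nv smooth_Tv x]) (simp add: Tv_def Nv_df unit)
  then show ?thesis
    using dNv_df[OF x, of u "\<tau> x"]
    by (simp add: dTv[OF x] Nv_df[OF x] Nv_f[OF x] inner_diff_right H_linear[OF x] Tv_def unit[OF x]
       H_sym[OF x, of "covT x u" "\<tau> x"] H_sym[OF x, of u "\<tau> x"])
qed

section \<open>The four ambient fields and their pairings\<close>

definition "F x = Tv x + (- lam2) *\<^sub>R f x"
definition "Fs x = Nv x + lam2 *\<^sub>R \<nu> x"
definition "G x = F x + (- \<delta>) *\<^sub>R f x"
definition "Gs x = Fs x + \<delta> *\<^sub>R \<nu> x"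

lemma smooth_F: "smooth_on \<Omega> F" and smooth_Fs: "smooth_on \<Omega> Fs"
  and smooth_G: "smooth_on \<Omega> G" and smooth_Gs: "smooth_on \<Omega> Gs"
proof -
  show F: "smooth_on \<Omega> F" and Fs: "smooth_on \<Omega> Fs"
    unfolding F_def[abs_def] Fs_def[abs_def]
    by (intro smooth_on_add smooth_on_scaleR smooth_on_const smooth_Tv smooth_Nv smooth_f smooth_\<nu> open_\<Omega>)+
  show "smooth_on \<Omega> G" and "smooth_on \<Omega> Gs"
    unfolding G_def[abs_def] Gs_def[abs_def]
    by (intro smooth_on_add smooth_on_scaleR smooth_on_const F Fs smooth_f smooth_\<nu> open_\<Omega>)+
qed

text \<open>Subtracting \<open>lam2 *\<^sub>R f\<close> cancels the term
  \<open>lam2 *\<^sub>R u\<close>, and \<open>lam = \<mu> * lam2\<close> makes the remaining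
  multiples of \<open>Tv\<close> and \<open>f\<close> combine to a multiple of
  \<open>F\<close>.\<close>

lemma dF: assumes x: "x \<in> \<Omega>" shows "fd F x u = fd f x (covT x u) + (\<mu> * \<alpha> x u) *\<^sub>R F x"
proof -
  have "fd F x u = fd Tv x u + (- lam2) *\<^sub>R fd f x u"
    unfolding F_def[abs_def] by (rule fd_add_scaled[OF smooth_Tv smooth_f x])
  then show ?thesis
    by (simp add: dTv[OF x] linear_add[OF linear_df[OF x]] linear_scale[OF linear_df[OF x]] F_def Tv_def
       lam_prod algebra_simps)
qed

lemma dG: "x \<in> \<Omega> \<Longrightarrow> fd G x u = fd F x u + (- \<delta>) *\<^sub>R fd f x u"
  unfolding G_def[abs_def] by (rule fd_add_scaled[OF smooth_F smooth_f])

lemma dGs: "x \<in> \<Omega> \<Longrightarrow> fd Gs x u = fd Fs x u + \<delta> *\<^sub>R fd \<nu> x u"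
  unfolding Gs_def[abs_def] by (rule fd_add_scaled[OF smooth_Fs smooth_\<nu>])

lemma dFs: "x \<in> \<Omega> \<Longrightarrow> fd Fs x u = fd Nv x u + lam2 *\<^sub>R fd \<nu> x u"
  unfolding Fs_def[abs_def] by (rule fd_add_scaled[OF smooth_Nv smooth_\<nu>])

lemma dFs_df:
  assumes x: "x \<in> \<Omega>" shows "fd Fs x u \<bullet> fd f x v = - H x (covT x u) v + \<mu> * \<alpha> x u * \<alpha> x v"
  by (simp add: dFs[OF x] inner_add_left dNv_df[OF x] d\<nu>_df[OF x])

lemma dFs_f: assumes x: "x \<in> \<Omega>" shows "fd Fs x u \<bullet> f x = \<alpha> x u"
  by (simp add: dFs[OF x] inner_add_left dNv_f[OF x] d\<nu>_f[OF x])

lemma Fs_df: assumes x: "x \<in> \<Omega>" shows "Fs x \<bullet> fd f x v = - \<alpha> x v"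
  by (simp add: Fs_def inner_add_left Nv_df[OF x] \<nu>_df[OF x])

lemma Fs_f: assumes x: "x \<in> \<Omega>" shows "Fs x \<bullet> f x = - 1 / \<mu>"
proof -
  have "lam2 / lam = 1 / \<mu>" using nonzero lam_prod by (simp add: field_simps)
  then show ?thesis by (simp add: Fs_def inner_add_left Nv_f[OF x] \<nu>_f[OF x])
qed

lemma Fs_F: assumes x: "x \<in> \<Omega>" shows "Fs x \<bullet> F x = - \<delta> / \<mu>"
  using nonzero by (simp add: F_def Tv_def inner_add_right inner_diff_right Fs_df[OF x] Fs_f[OF x] unit[OF x]
      \<delta>_def field_simps)

lemma Fs_G: assumes x: "x \<in> \<Omega>" shows "Fs x \<bullet> G x = 0"
  using nonzero by (simp add: G_def inner_add_right inner_diff_right Fs_F[OF x] Fs_f[OF x])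

lemma dFs_F: assumes x: "x \<in> \<Omega>" shows "fd Fs x u \<bullet> F x = \<delta> * \<alpha> x u"
  using covT_\<tau>_orth[OF x, of u]
  by (simp add: F_def Tv_def inner_add_right inner_diff_right dFs_df[OF x] dFs_f[OF x] unit[OF x] H_sym[OF x, of "covT x u" "\<tau> x"]
     \<delta>_def algebra_simps)

lemma dFs_dF:
  assumes x: "x \<in> \<Omega>"
  shows "fd Fs x u \<bullet> fd F x v = - H x (covT x u) (covT x v) + \<mu> * \<delta> * \<alpha> x u * \<alpha> x v"
  by (simp add: dF[OF x] inner_add_right dFs_df[OF x] dFs_F[OF x] covT_\<tau>_orth[OF x])

text \<open>The one-form \<open>Fs \<bullet> fd F\<close> equals \<open>- \<delta>\<close> times
  \<open>\<alpha>\<close>. In its exterior derivative the second derivatives of \<open>F\<close>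
  cancel, and what remains is the skew part of the form in \<open>dFs_dF\<close>, which is
  symmetric.\<close>

lemma d\<alpha>_sym:
  assumes x: "x \<in> \<Omega>" shows "fd (\<lambda>y. \<alpha> y v) x u = fd (\<lambda>y. \<alpha> y u) x v"
proof -
  have Fs_dF: "Fs y \<bullet> fd F y v = - \<delta> * \<alpha> y v" if "y \<in> \<Omega>" for y v
    using nonzero by (simp add: dF[OF that] inner_add_right Fs_df[OF that] Fs_F[OF that] covT_\<tau>_orth[OF that])
  have *: "- \<delta> * fd (\<lambda>y. \<alpha> y v) x u = Fs x \<bullet> fd (\<lambda>y. fd F y v) x u + fd Fs x u \<bullet> fd F x v" for u v
  proof -
    have "((\<lambda>y. - \<delta> * \<alpha> y v) has_derivative (\<lambda>u. - \<delta> * fd (\<lambda>y. \<alpha> y v) x u)) (at x)"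
      using d\<alpha>(2)[OF x, of v] by (intro has_derivative_mult_right) (simp add: frechet_derivative_works)
    moreover have "Fs x \<bullet> fd (\<lambda>y. fd F y v) x u + fd Fs x u \<bullet> fd F x v = fd (\<lambda>y. - \<delta> * \<alpha> y v) x u"
      by (rule fd_inner_cong(1)[OF open_\<Omega> smooth_Fs smooth_on_fd[OF smooth_F] x Fs_dF])
    ultimately show ?thesis by (simp add: fd_eq)
  qed
  have "- \<delta> * fd (\<lambda>y. \<alpha> y v) x u = - \<delta> * fd (\<lambda>y. \<alpha> y u) x v"
    unfolding * using fd_commute[OF open_\<Omega> x smooth_F, of u v] dFs_dF[OF x, of u v] dFs_dF[OF x, of v u]
      H_sym[OF x, of "covT x u"] by simp
  then show ?thesis using nonzero by simp
qed

lemma covT_sym: assumes x: "x \<in> \<Omega>" shows "H x (covT x u) v = H x (covT x v) u"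
  using d\<alpha>_sym[OF x, of v u] \<Gamma>h_sym[OF x, of u v] by (simp add: d\<alpha>(1)[OF x])

lemma covT_\<tau>: assumes x: "x \<in> \<Omega>" shows "covT x (\<tau> x) = 0"
  by (rule H_nondegenerate[OF x])
    (use covT_sym[OF x, of "\<tau> x"] covT_\<tau>_orth[OF x] H_sym[OF x, of "covT x _" "\<tau> x"] in \<open>simp add: H_linear[OF x]\<close>)

section \<open>Eigenvector equations, Lie derivatives along T, and parallelism of T\<close>

lemma eigen_F: assumes x: "x \<in> \<Omega>" shows "fd F x (\<tau> x) = \<mu> *\<^sub>R F x"
  by (simp add: dF[OF x] covT_\<tau>[OF x] unit[OF x] linear_0[OF linear_df[OF x]])

lemma eigen_G: assumes x: "x \<in> \<Omega>" shows "fd G x (\<tau> x) = lam2 *\<^sub>R G x"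
  by (simp add: dG[OF x] eigen_F[OF x] G_def F_def Tv_def \<delta>_def algebra_simps)

lemma eigen_Fs: assumes x: "x \<in> \<Omega>" shows "fd Fs x (\<tau> x) = (- \<mu>) *\<^sub>R Fs x"
  by (rule covector_eqI[OF x])
    (use nonzero in \<open>simp_all add: dFs_df[OF x] dFs_f[OF x] Fs_df[OF x] Fs_f[OF x] unit[OF x] covT_\<tau>[OF x] H_linear[OF x]\<close>)

lemma eigen_Gs: assumes x: "x \<in> \<Omega>" shows "fd Gs x (\<tau> x) = (- lam2) *\<^sub>R Gs x"
proof -
  have "fd Gs x (\<tau> x) = (- \<mu>) *\<^sub>R Fs x + \<delta> *\<^sub>R (Fs x - lam2 *\<^sub>R \<nu> x)"
    by (simp add: dGs[OF x] eigen_Fs[OF x] Fs_def Nv_def)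
  then show ?thesis by (simp add: Gs_def \<delta>_def algebra_simps)
qed

lemma fd_along_\<tau>:
  fixes p :: "real ^ 'm \<Rightarrow> real ^ 'm option"
  assumes p: "smooth_on \<Omega> p" and ev: "\<And>y. y \<in> \<Omega> \<Longrightarrow> fd p y (\<tau> y) = a *\<^sub>R p y" and x: "x \<in> \<Omega>"
  shows "fd (\<lambda>y. fd p y u) x (\<tau> x) = a *\<^sub>R fd p x u - fd p x (fd \<tau> x u)"
proof -
  have "fd (\<lambda>y. fd p y u) x (\<tau> x) = fd (\<lambda>y. fd p y (\<tau> x)) x u"
    by (rule fd_commute[OF open_\<Omega> x p])
  also have "\<dots> = fd (\<lambda>y. fd p y (\<tau> y)) x u - fd p x (fd \<tau> x u)"
    using fd_fd_field[OF open_\<Omega> x p smooth_on_differentiable[OF smooth_\<tau> x], of u] by simp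
  also have "fd (\<lambda>y. fd p y (\<tau> y)) x u = fd (\<lambda>y. a *\<^sub>R p y) x u"
    using fd_cong[OF open_\<Omega> x ev] by simp
  also have "\<dots> = a *\<^sub>R fd p x u"
    using fd_eq[OF has_derivative_scaleR_right[OF smooth_on_has_derivative[OF p x], of a]] by simp
  finally show ?thesis .
qed

text \<open>The Lie derivative commutes with the differential, so it multiplies the differentials of
  \<open>p\<close> and \<open>q\<close> by \<open>a\<close> and \<open>b\<close> and their pairing
  by \<open>a + b\<close>. The two correction terms arise because constant fields do not commute
  with \<open>\<tau>\<close>: the bracket of \<open>\<tau>\<close> with \<open>u\<close> is
  \<open>- fd \<tau> x u\<close>.\<close>

lemma lie_derivative:
  fixes p q :: "real ^ 'm \<Rightarrow> real ^ 'm option"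
  assumes p: "smooth_on \<Omega> p" "\<And>y. y \<in> \<Omega> \<Longrightarrow> fd p y (\<tau> y) = a *\<^sub>R p y"
    and q: "smooth_on \<Omega> q" "\<And>y. y \<in> \<Omega> \<Longrightarrow> fd q y (\<tau> y) = b *\<^sub>R q y" and x: "x \<in> \<Omega>"
  shows "fd (\<lambda>y. fd p y u \<bullet> fd q y v) x (\<tau> x) = (a + b) * (fd p x u \<bullet> fd q x v)
    - fd p x (fd \<tau> x u) \<bullet> fd q x v - fd p x u \<bullet> fd q x (fd \<tau> x v)"
  using fd_inner(2)[OF smooth_on_fd[OF p(1)] smooth_on_fd[OF q(1)] x, of u v "\<tau> x"]
  by (simp add: fd_along_\<tau>[OF p x] fd_along_\<tau>[OF q x] inner_diff_left inner_diff_right algebra_simps)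

lemma dFs_dG:
  assumes x: "x \<in> \<Omega>"
  shows "fd Fs x u \<bullet> fd G x v = - H x (covT x u) (covT x v) + \<delta> * H x (covT x u) v"
  by (simp add: dG[OF x] inner_diff_right inner_add_right dFs_dF[OF x] dFs_df[OF x] algebra_simps)

lemma dGs_dF:
  assumes x: "x \<in> \<Omega>"
  shows "fd Gs x u \<bullet> fd F x v = - H x (covT x u) (covT x v) - \<delta> * H x (covT x u) v"
proof -
  have "fd \<nu> x u \<bullet> F x = - \<alpha> x u"
    by (simp add: F_def Tv_def inner_add_right inner_diff_right d\<nu>_df[OF x] d\<nu>_f[OF x] H_sym[OF x, of u])
  then have "fd \<nu> x u \<bullet> fd F x v = - H x u (covT x v) - \<mu> * \<alpha> x v * \<alpha> x u"
    by (simp add: dF[OF x] inner_add_right d\<nu>_df[OF x])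
  moreover have "H x u (covT x v) = H x (covT x u) v"
    using covT_sym[OF x, of u v] H_sym[OF x, of u] by simp
  ultimately have *: "fd \<nu> x u \<bullet> fd F x v = - H x (covT x u) v - \<mu> * \<alpha> x v * \<alpha> x u" by simp
  show ?thesis
    by (simp add: dGs[OF x] inner_add_left dFs_dF[OF x] *) (simp add: algebra_simps)
qed

text \<open>The three bilinear forms below are eigenvectors of the Lie derivative along \<open>\<tau>\<close> with eigenvalues
  \<open>0\<close>, \<open>- \<delta>\<close> and \<open>\<delta>\<close>, while on the complement of \<open>\<tau>\<close> twice the first is the sum of the other two.\<close>

lemma covT_orth_zero:
  assumes x: "x \<in> \<Omega>" and uv: "\<alpha> x u = 0" "\<alpha> x v = 0"
  shows "H x (covT x u) v = 0"
proof -
  let ?P1 = "\<lambda>y u v. fd Fs y u \<bullet> fd F y v" and ?P2 = "\<lambda>y u v. fd Fs y u \<bullet> fd G y v"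
    and ?P3 = "\<lambda>y u v. fd Gs y u \<bullet> fd F y v"
  have rel: "?P2 y u v + ?P3 y u v = 2 * ?P1 y u v - 2 * \<mu> * \<delta> * (\<alpha> y u * \<alpha> y v)" if "y \<in> \<Omega>" for y u v
    by (simp add: dFs_dF[OF that] dFs_dG[OF that] dGs_dF[OF that])
  have h: "((\<lambda>y. fd p y u \<bullet> fd q y v) has_derivative fd (\<lambda>y. fd p y u \<bullet> fd q y v) x) (at x)"
    if "smooth_on \<Omega> p" "smooth_on \<Omega> q" for p q :: "real ^ 'm \<Rightarrow> real ^ 'm option"
    using smooth_on_has_derivative[OF smooth_on_inner[OF open_\<Omega> smooth_on_fd[OF that(1)] smooth_on_fd[OF that(2)]] x] .
  have ha: "((\<lambda>y. \<alpha> y u * \<alpha> y v) has_derivative (\<lambda>w. \<alpha> x u * fd (\<lambda>y. \<alpha> y v) x w + fd (\<lambda>y. \<alpha> y u) x w * \<alpha> x v)) (at x)"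
    using d\<alpha>(2)[OF x] by (intro has_derivative_mult) (simp_all add: frechet_derivative_works)
  have "((\<lambda>y. ?P2 y u v + ?P3 y u v) has_derivative (\<lambda>w. fd (\<lambda>y. ?P2 y u v) x w + fd (\<lambda>y. ?P3 y u v) x w)) (at x)"
    by (intro has_derivative_add h smooth_F smooth_Fs smooth_G smooth_Gs)
  moreover have "((\<lambda>y. ?P2 y u v + ?P3 y u v) has_derivative (\<lambda>w. 2 * fd (\<lambda>y. ?P1 y u v) x w - 2 * \<mu> * \<delta> *
     (\<alpha> x u * fd (\<lambda>y. \<alpha> y v) x w + fd (\<lambda>y. \<alpha> y u) x w * \<alpha> x v))) (at x)"
    by (rule has_derivative_transform_within_open[OF _ open_\<Omega> x rel[symmetric]])
      (intro has_derivative_diff has_derivative_mult_right ha h smooth_F smooth_Fs)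
  ultimately have "(\<lambda>w. fd (\<lambda>y. ?P2 y u v) x w + fd (\<lambda>y. ?P3 y u v) x w) = (\<lambda>w. 2 * fd (\<lambda>y. ?P1 y u v) x w -
     2 * \<mu> * \<delta> * (\<alpha> x u * fd (\<lambda>y. \<alpha> y v) x w + fd (\<lambda>y. \<alpha> y u) x w * \<alpha> x v))"
    by (rule has_derivative_unique)
  \<comment> \<open>The constant fields \<open>u\<close> and \<open>v\<close> are orthogonal to
    \<open>\<tau>\<close> at \<open>x\<close> only, but \<open>\<alpha> y u * \<alpha> y v\<close>
    has a double zero there, so its derivative drops out.\<close>
  from fun_cong[OF this, of "\<tau> x"]
  have "fd (\<lambda>y. ?P2 y u v) x (\<tau> x) + fd (\<lambda>y. ?P3 y u v) x (\<tau> x) = 2 * fd (\<lambda>y. ?P1 y u v) x (\<tau> x)"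
    unfolding uv by simp
  then have "\<delta> * (?P3 x u v - ?P2 x u v) = (?P2 x (fd \<tau> x u) v + ?P3 x (fd \<tau> x u) v) - 2 * ?P1 x (fd \<tau> x u) v
     + (?P2 x u (fd \<tau> x v) + ?P3 x u (fd \<tau> x v)) - 2 * ?P1 x u (fd \<tau> x v)"
    using lie_derivative[OF smooth_Fs eigen_Fs smooth_F eigen_F x, of u v]
      lie_derivative[OF smooth_Fs eigen_Fs smooth_G eigen_G x, of u v]
      lie_derivative[OF smooth_Gs eigen_Gs smooth_F eigen_F x, of u v]
    by (simp only: \<delta>_def ring_distribs left_diff_distrib mult_minus_left)
  \<comment> \<open>One argument is still \<open>u\<close> or \<open>v\<close>, so the extra term of
    \<open>rel\<close> vanishes although the derivative of \<open>\<tau>\<close> need not be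
    orthogonal to \<open>\<tau>\<close>.\<close>
  also have "\<dots> = 0" unfolding rel[OF x] using uv by simp
  finally have "?P3 x u v = ?P2 x u v" using nonzero by simp
  then show ?thesis using nonzero by (simp add: dFs_dG[OF x] dGs_dF[OF x])
qed

text \<open>The values of \<open>covT\<close> are orthogonal to \<open>\<tau>\<close> and
  \<open>covT\<close> is symmetric, so both arguments may be replaced by their components orthogonal
  to \<open>\<tau>\<close>.\<close>

lemma covT_zero: assumes x: "x \<in> \<Omega>" shows "covT x u = 0"
proof (rule H_nondegenerate[OF x])
  fix v
  define u2 where "u2 = u - \<alpha> x u *\<^sub>R \<tau> x"
  define v2 where "v2 = v - \<alpha> x v *\<^sub>R \<tau> x"
  have a: "\<alpha> x u2 = 0" "\<alpha> x v2 = 0" by (simp_all add: u2_def v2_def H_linear[OF x] unit[OF x])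
  have o: "H x (covT x w) (\<tau> x) = 0" for w using covT_\<tau>_orth[OF x] H_sym[OF x] by metis
  have red: "H x (covT x w) v = H x (covT x w) (v - \<alpha> x v *\<^sub>R \<tau> x)" for w v by (simp add: H_linear[OF x] o)
  have "H x (covT x u) v = H x (covT x u) v2" unfolding v2_def by (rule red)
  also have "\<dots> = H x (covT x v2) u" by (rule covT_sym[OF x])
  also have "\<dots> = H x (covT x v2) u2" unfolding u2_def by (rule red)
  also have "\<dots> = 0" by (rule covT_orth_zero[OF x a(2,1)])
  finally show "H x (covT x u) v = H x 0 v" by (simp add: H_linear[OF x])
qed

lemma dF_eq: assumes x: "x \<in> \<Omega>" shows "fd F x u = (\<mu> * \<alpha> x u) *\<^sub>R F x"
  by (simp add: dF[OF x] covT_zero[OF x] linear_0[OF linear_df[OF x]])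

lemma dFs_eq: assumes x: "x \<in> \<Omega>" shows "fd Fs x u = (- (\<mu> * \<alpha> x u)) *\<^sub>R Fs x"
  by (rule covector_eqI[OF x])
    (use nonzero in \<open>simp_all add: dFs_df[OF x] dFs_f[OF x] Fs_df[OF x] Fs_f[OF x] covT_zero[OF x] H_linear[OF x]\<close>)

section \<open>Adapted coordinates\<close>

lemma exp_ODE:
  fixes p :: "real ^ 'm \<Rightarrow> 'w::real_normed_vector"
  assumes B: "ball x0 r \<subseteq> \<Omega>" and p: "smooth_on (ball x0 r) p"
    and t: "smooth_on (ball x0 r) t" "\<And>x u. x \<in> ball x0 r \<Longrightarrow> fd t x u = \<alpha> x u" "t x0 = 0"
    and dp: "\<And>x u. x \<in> ball x0 r \<Longrightarrow> fd p x u = (c * \<alpha> x u) *\<^sub>R p x" and x: "x \<in> ball x0 r"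
  shows "p x = exp (c * t x) *\<^sub>R p x0"
proof -
  have "((\<lambda>y. exp (- c * t y) *\<^sub>R p y) has_derivative (\<lambda>_. 0)) (at y)" if "y \<in> ball x0 r" for y
    using fd_exp_scaleR[OF t(1) p that, of "- c"] by (simp add: t(2)[OF that] dp[OF that])
  from constant_on_ball[OF this x] have "exp (- c * t x) *\<^sub>R p x = p x0" by (simp add: t(3))
  then have "exp (c * t x) *\<^sub>R exp (- c * t x) *\<^sub>R p x = exp (c * t x) *\<^sub>R p x0" by simp
  then show ?thesis by (simp add: exp_minus)
qed

text \<open>Since \<open>F\<close> changes only by a scalar factor with logarithmic derivative
  \<open>\<mu> * \<alpha>\<close>, the logarithm of any nonvanishing component of \<open>F\<close>,
  divided by \<open>\<mu>\<close>, is a primitive of \<open>\<alpha>\<close>. The component used is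
  the one measured by \<open>Fs x0\<close>, normalised to 1 at \<open>x0\<close>.\<close>

lemma splitting:
  assumes x0: "x0 \<in> \<Omega>"
  obtains r t \<gamma> where "r > 0" "ball x0 r \<subseteq> \<Omega>" "smooth_on (ball x0 r) t" "t x0 = 0"
    "\<And>x u. x \<in> ball x0 r \<Longrightarrow> fd t x u = \<alpha> x u"
    "smooth_on (ball x0 r) \<gamma>"
    "\<And>x u. x \<in> ball x0 r \<Longrightarrow> fd \<gamma> x u = (- \<delta> * exp (- lam2 * t x)) *\<^sub>R fd f x (u - \<alpha> x u *\<^sub>R \<tau> x)"
    "\<And>x. x \<in> ball x0 r \<Longrightarrow> G x = exp (lam2 * t x) *\<^sub>R \<gamma> x"
    "\<And>x. x \<in> ball x0 r \<Longrightarrow> F x = exp (\<mu> * t x) *\<^sub>R F x0"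
    "\<And>x. x \<in> ball x0 r \<Longrightarrow> Fs x0 \<bullet> \<gamma> x = 0"
proof -
  define c where "c = Fs x0 \<bullet> F x0"
  have c: "c \<noteq> 0" using nonzero by (simp add: c_def Fs_F[OF x0])
  have s: "smooth_on \<Omega> (\<lambda>x. Fs x0 \<bullet> F x / c)"
    by (intro smooth_on_divide smooth_on_inner smooth_on_const smooth_F open_\<Omega> c)
  have "isCont (\<lambda>x. Fs x0 \<bullet> F x / c) x0"
    using smooth_on_continuous[OF s] open_\<Omega> x0 by (simp add: continuous_on_eq_continuous_at)
  moreover have s0: "Fs x0 \<bullet> F x0 / c = 1" using c by (simp add: c_def)
  \<comment> \<open>Distance less than 1 from 1 keeps the quotient positive, so that its logarithm
    is smooth.\<close>
  ultimately obtain d where d: "d > 0" "\<And>x. dist x x0 < d \<Longrightarrow> dist (Fs x0 \<bullet> F x / c) 1 < 1"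
    unfolding continuous_at_eps_delta by (metis zero_less_one)
  obtain e where e: "e > 0" "ball x0 e \<subseteq> \<Omega>" using open_\<Omega> x0 openE by blast
  define r where "r = min d e"
  have r: "r > 0" "ball x0 r \<subseteq> \<Omega>" using d e by (auto simp: r_def)
  have pos: "Fs x0 \<bullet> F x / c > 0" if "x \<in> ball x0 r" for x
    using d(2)[of x] that by (auto simp: r_def dist_commute dist_real_def abs_if split: if_splits)
  define t where "t x = ln (Fs x0 \<bullet> F x / c) * (1 / \<mu>)" for x
  have ob: "open (ball x0 r)" by simp
  have ti: "smooth_on (ball x0 r) t"
    unfolding t_def[abs_def]
    by (intro smooth_on_mult smooth_on_const smooth_on_compose[OF ob _ _ smooth_on_ln_real] ob
        smooth_on_subset[OF s r(2)]) (use pos in auto)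
  have t0: "t x0 = 0" using c by (simp add: t_def c_def)
  have dt: "fd t x u = \<alpha> x u" if x: "x \<in> ball x0 r" for x u
  proof -
    have x': "x \<in> \<Omega>" using x r by blast
    have "((\<lambda>x. Fs x0 \<bullet> F x / c) has_derivative (\<lambda>u. (Fs x0 \<bullet> fd F x u) / c)) (at x)"
      using c by (auto intro!: derivative_eq_intros smooth_on_has_derivative[OF smooth_F x'])
    then have "((\<lambda>x. ln (Fs x0 \<bullet> F x / c)) has_derivative (\<lambda>u. (Fs x0 \<bullet> fd F x u) / c * inverse (Fs x0 \<bullet> F x / c))) (at x)"
      by (rule has_derivative_ln[rotated]) (rule pos[OF x])
    then have "(t has_derivative (\<lambda>u. (Fs x0 \<bullet> fd F x u) / c * inverse (Fs x0 \<bullet> F x / c) * (1 / \<mu>))) (at x)"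
      unfolding t_def[abs_def] by (rule has_derivative_mult_left)
    moreover have "Fs x0 \<bullet> F x \<noteq> 0" using pos[OF x] by auto
    ultimately show ?thesis
      using c nonzero by (simp add: fd_eq dF_eq[OF x'])
  qed
  have Feq: "F x = exp (\<mu> * t x) *\<^sub>R F x0" if "x \<in> ball x0 r" for x
    by (rule exp_ODE[OF r(2) smooth_on_subset[OF smooth_F r(2)] ti dt t0 _ that]) (use dF_eq r(2) in auto)
  have Fseq: "Fs x = exp (- \<mu> * t x) *\<^sub>R Fs x0" if "x \<in> ball x0 r" for x
    by (rule exp_ODE[OF r(2) smooth_on_subset[OF smooth_Fs r(2)] ti dt t0 _ that]) (use dFs_eq r(2) in auto)
  define \<gamma> where "\<gamma> x = exp (- lam2 * t x) *\<^sub>R G x" for x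
  have sG: "smooth_on (ball x0 r) G" by (rule smooth_on_subset[OF smooth_G r(2)])
  have s\<gamma>: "smooth_on (ball x0 r) \<gamma>"
    unfolding \<gamma>_def[abs_def]
    by (intro smooth_on_scaleR smooth_on_exp smooth_on_mult smooth_on_const ti sG ob)
  have d\<gamma>: "fd \<gamma> x u = (- \<delta> * exp (- lam2 * t x)) *\<^sub>R fd f x (u - \<alpha> x u *\<^sub>R \<tau> x)" if x: "x \<in> ball x0 r" for x u
  proof -
    have x': "x \<in> \<Omega>" using x r by blast
    have "fd \<gamma> x u = exp (- lam2 * t x) *\<^sub>R (fd G x u + (- lam2 * fd t x u) *\<^sub>R G x)"
      using fd_exp_scaleR[OF ti sG x, of "- lam2"] unfolding \<gamma>_def[abs_def] by (simp add: fd_eq)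
    \<comment> \<open>Here \<open>\<mu> - lam2 = \<delta>\<close> becomes a common factor and
      \<open>F + lam2 *\<^sub>R f\<close> is \<open>Tv\<close>.\<close>
    also have "fd G x u + (- lam2 * fd t x u) *\<^sub>R G x = - \<delta> *\<^sub>R (fd f x u - \<alpha> x u *\<^sub>R Tv x)"
      by (simp add: dt[OF x] dG[OF x'] dF_eq[OF x'] G_def F_def \<delta>_def algebra_simps)
    also have "fd f x u - \<alpha> x u *\<^sub>R Tv x = fd f x (u - \<alpha> x u *\<^sub>R \<tau> x)"
      by (simp add: Tv_def linear_diff[OF linear_df[OF x']] linear_scale[OF linear_df[OF x']])
    finally show ?thesis by simp
  qed
  show thesis
  proof (rule that[OF r ti t0 dt s\<gamma> d\<gamma> _ Feq])
    fix x assume x: "x \<in> ball x0 r"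
    then have x': "x \<in> \<Omega>" using r by blast
    show "G x = exp (lam2 * t x) *\<^sub>R \<gamma> x" by (simp add: \<gamma>_def exp_minus)
    \<comment> \<open>\<open>Fs x\<close> is a multiple of \<open>Fs x0\<close>, which turns the
      pointwise relation \<open>Fs_G\<close> into membership in one fixed hyperplane.\<close>
    have "exp (- \<mu> * t x) * (Fs x0 \<bullet> G x) = 0" using Fs_G[OF x'] Fseq[OF x] by simp
    then show "Fs x0 \<bullet> \<gamma> x = 0" by (simp add: \<gamma>_def)
  qed
qed

end

text \<open>A hyperbolic affine hypersphere of mean curvature \<open>- 1\<close> centered at the origin, in one chart: the
  position vector \<open>\<psi>\<close> is its own affine normal.\<close>

definition hyperbolic_sphere_on ::
  "(real ^ 'k::finite) set \<Rightarrow> (real ^ 'k \<Rightarrow> real ^ 'k option) \<Rightarrow> (real ^ 'k \<Rightarrow> real ^ 'k \<Rightarrow> real ^ 'k \<Rightarrow> real) \<Rightarrow> bool" where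
  "hyperbolic_sphere_on B \<psi> h \<longleftrightarrow> smooth_on B \<psi> \<and> (\<forall>q\<in>B.
     (\<forall>z r. fd \<psi> q z + r *\<^sub>R \<psi> q = 0 \<longrightarrow> z = 0 \<and> r = 0) \<and>
     (\<forall>v w. \<exists>z. fd (\<lambda>p. fd \<psi> p w) q v = fd \<psi> q z + h q v w *\<^sub>R \<psi> q) \<and>
     (\<forall>u. u \<noteq> 0 \<longrightarrow> h q u u > 0) \<and>
     (\<forall>X :: 'k \<Rightarrow> real ^ 'k. \<bar>det (\<chi> a. case a of None \<Rightarrow> \<psi> q | Some i \<Rightarrow> fd \<psi> q (X i))\<bar> =
        sqrt \<bar>det (\<chi> i j. h q (X i) (X j))\<bar>))"

text \<open>The shape of a frame of a Calabi product: the rows for the position vector and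
  \<open>T\<close> lie in the plane of the axis \<open>None\<close> and \<open>y\<close>, the others
  are scaled tangent vectors of the lower dimensional factor. The plane contributes a 2 by 2
  determinant and each other row a factor \<open>\<rho>\<close>.\<close>

lemma det_split_rows:
  fixes A :: "real ^ 'k::finite option option \<Rightarrow> real ^ 'k option option" and e :: "'k \<Rightarrow> real ^ 'k option"
  assumes "linear A"
  shows "det (\<chi> a. case a of None \<Rightarrow> A (emb p1 (p2 *\<^sub>R y)) | Some None \<Rightarrow> A (emb s1 (s2 *\<^sub>R y))
      | Some (Some i) \<Rightarrow> A (emb 0 (\<rho> *\<^sub>R e i)))
    = det (matrix A) * ((p1 * s2 - p2 * s1) * (\<rho> ^ CARD('k) * det (\<chi> a. case a of None \<Rightarrow> y | Some i \<Rightarrow> e i)))"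
    (is "det ?M = _")
proof -
  define R where "R a = (case a of None \<Rightarrow> emb p1 (p2 *\<^sub>R y) | Some None \<Rightarrow> emb s1 (s2 *\<^sub>R y)
      | Some (Some i) \<Rightarrow> emb 0 (\<rho> *\<^sub>R e i))" for a
  define u where "u = (axis None 1 :: real ^ 'k option option)"
  define v where "v = emb 0 y"
  define b where "b a = (case a of None \<Rightarrow> u | Some None \<Rightarrow> v | Some (Some i) \<Rightarrow> emb 0 (e i))" for a
  have uv: "p *s u + s *s v = emb p (s *\<^sub>R y)" for p s
    by (simp add: scalar_mult_eq_scaleR u_def v_def emb_scaleR emb_axis[symmetric] emb_add)
  have "?M = (\<chi> a. A (R a))"
    by (intro arg_cong[where f = vec_lambda] ext) (simp add: R_def split: option.split)
  then have "det ?M = det (matrix A) * det (\<chi> a. R a)" by (simp add: det_map_rows[OF assms])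
  also have "(\<chi> a. R a) = (\<chi> a. if a = None then p1 *s u + p2 *s v else if a = Some None then s1 *s u + s2 *s v else R a)"
    by (intro arg_cong[where f = vec_lambda] ext) (simp add: R_def uv split: option.split)
  also have "det \<dots> = (p1 * s2 - p2 * s1) * det (\<chi> a. if a = None then u else if a = Some None then v else R a)"
    by (rule det_two_rows) simp
  also have "(\<chi> a. if a = None then u else if a = Some None then v else R a) =
     (\<chi> a. (case a of Some (Some i) \<Rightarrow> \<rho> | _ \<Rightarrow> 1) *s b a)"
    by (intro arg_cong[where f = vec_lambda] ext)
      (auto simp: R_def b_def scalar_mult_eq_scaleR emb_scaleR split: option.split)
  also have "det \<dots> = (\<Prod>a\<in>(UNIV :: 'k option option set). (case a of Some (Some i) \<Rightarrow> \<rho> | _ \<Rightarrow> 1)) * det (\<chi> a. b a)"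
    using det_rows_mul[of "\<lambda>a. case a of Some (Some i) \<Rightarrow> \<rho> | _ \<Rightarrow> 1" b] .
  also have "(\<Prod>a\<in>(UNIV :: 'k option option set). (case a of Some (Some i) \<Rightarrow> \<rho> | _ \<Rightarrow> 1)) = \<rho> ^ CARD('k)"
    by (simp add: prod_option)
  also have "det (\<chi> a. b a) = det (\<chi> i j. (\<chi> a. b a) $ Some i $ Some j)"
    by (rule det_option_block) (simp add: b_def u_def)
  also have "(\<chi> i j. (\<chi> a. b a) $ Some i $ Some j) = (\<chi> a. case a of None \<Rightarrow> y | Some i \<Rightarrow> e i)"
    by (auto simp: vec_eq_iff b_def v_def split: option.split)
  finally show ?thesis .
qed

lemma det_scale:
  fixes M :: "'n::finite \<Rightarrow> 'n \<Rightarrow> real"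
  shows "det (\<chi> i j. c * M i j) = c ^ CARD('n) * det (\<chi> i j. M i j)"
proof -
  have "(\<chi> i j. c * M i j) = (\<chi> i. c *s (\<chi> j. M i j))" by (simp add: vec_eq_iff)
  then show ?thesis using det_rows_mul[of "\<lambda>_. c" "\<lambda>i. \<chi> j. M i j"] by simp
qed

locale sphere_chart_volume = sphere_chart \<Omega> f H \<Gamma> lam \<tau> \<Gamma>h lam1 lam2
  for \<Omega> :: "(real ^ 'k::finite option) set" and f H \<Gamma> lam \<tau> \<Gamma>h lam1 lam2 +
  assumes volume: "\<And>x X. x \<in> \<Omega> \<Longrightarrow>
    \<bar>det (\<chi> a. case a of None \<Rightarrow> (- lam) *\<^sub>R f x | Some i \<Rightarrow> fd f x (X i))\<bar> = sqrt \<bar>det (\<chi> i j. H x (X i) (X j))\<bar>"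
begin

text \<open>The coordinates are \<open>t\<close> and a linear projection of \<open>\<gamma>\<close>.
  In them \<open>\<tau>\<close> is the first coordinate field and \<open>\<gamma>\<close> depends on
  the remaining coordinates alone, so the formula for \<open>f\<close> in terms of \<open>F\<close>
  and \<open>G\<close> separates the variables.\<close>

lemma calabi_coordinates:
  assumes x0: "x0 \<in> \<Omega>"
  obtains \<epsilon> U V g \<Psi> A c1 c2 \<psi> h1 where
    "\<epsilon> > 0" "open U" "U \<subseteq> \<Omega>" "x0 \<in> U" "open V" "homeomorphism U V \<Psi> g" "smooth_on U \<Psi>" "smooth_on V g"
    "\<Psi> x0 = 0" "\<And>s (q :: real ^ 'k). \<bar>s\<bar> < \<epsilon> \<Longrightarrow> q \<in> ball 0 \<epsilon> \<Longrightarrow> emb s q \<in> V"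
    "linear A" "bij A" "c1 \<noteq> 0" "c2 \<noteq> 0" "hyperbolic_sphere_on (ball (0 :: real ^ 'k) \<epsilon>) \<psi> h1"
    "\<And>s q. \<bar>s\<bar> < \<epsilon> \<Longrightarrow> q \<in> ball 0 \<epsilon> \<Longrightarrow> f (g (emb s q)) =
        A (emb (c2 * exp (- (real CARD('k option) * lam2 * s))) ((c1 * exp (lam2 * s)) *\<^sub>R \<psi> q))"
proof (rule splitting[OF x0])
  fix r t \<gamma> assume r: "r > 0" "ball x0 r \<subseteq> \<Omega>" and t: "smooth_on (ball x0 r) t" "t x0 = 0"
    "\<And>x u. x \<in> ball x0 r \<Longrightarrow> fd t x u = \<alpha> x u"
    and \<gamma>: "smooth_on (ball x0 r) \<gamma>"
    "\<And>x u. x \<in> ball x0 r \<Longrightarrow> fd \<gamma> x u = (- \<delta> * exp (- lam2 * t x)) *\<^sub>R fd f x (u - \<alpha> x u *\<^sub>R \<tau> x)"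
    and G\<gamma>: "\<And>x. x \<in> ball x0 r \<Longrightarrow> G x = exp (lam2 * t x) *\<^sub>R \<gamma> x"
    and F0: "\<And>x. x \<in> ball x0 r \<Longrightarrow> F x = exp (\<mu> * t x) *\<^sub>R F x0"
    and Fs\<gamma>: "\<And>x. x \<in> ball x0 r \<Longrightarrow> Fs x0 \<bullet> \<gamma> x = 0"
  have x0B: "x0 \<in> ball x0 r" using r by simp
  have G\<tau>: "G x = fd f x (\<tau> x) + (- \<mu>) *\<^sub>R f x" for x
    by (simp add: G_def F_def Tv_def \<delta>_def algebra_simps)
  have "linear (\<alpha> x0)" by (intro linearI) (simp_all add: H_linear[OF x0])
  moreover have "\<alpha> x0 \<noteq> (\<lambda>_. 0)" using unit[OF x0] by (metis zero_neq_one)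
  ultimately obtain L :: "real ^ 'k \<Rightarrow> real ^ 'k option" where L: "linear L" "inj L" "range L = {u. \<alpha> x0 u = 0}"
    by (rule linear_functional_kernel_param)
  have \<alpha>L: "\<alpha> x0 (L w) = 0" for w using L(3) by blast
  define c where "c = Fs x0 \<bullet> F x0"
  have c: "c \<noteq> 0" using nonzero by (simp add: c_def Fs_F[OF x0])
  \<comment> \<open>A basis adapted to the product: the first vector spans the line of
    \<open>F\<close>, the others span the hyperplane annihilated by \<open>Fs x0\<close>, starting
    with \<open>\<gamma> x0\<close>. Pairing with \<open>Fs x0\<close> thus reads off the first
    coordinate.\<close>
  define A where "A y = (y $ None) *\<^sub>R F x0 + ((tail y $ None) *\<^sub>R \<gamma> x0 + fd f x0 (L (tail (tail y))))" for y
  have lA: "linear A"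
    unfolding A_def
    by (intro linearI) (simp_all only: tail_add tail_scaleR vector_add_component vector_scaleR_component
      linear_add[OF L(1)] linear_scale[OF L(1)] linear_add[OF linear_df[OF x0]] linear_scale[OF linear_df[OF x0]],
      simp_all add: algebra_simps)
  have FsA: "Fs x0 \<bullet> A y = c * (y $ None)" for y
    by (simp add: A_def inner_add_right Fs\<gamma>[OF x0B] Fs_df[OF x0] \<alpha>L c_def)
  have "inj A"
  proof (unfold linear_injective_0[OF lA], intro allI impI)
    fix y assume y: "A y = 0"
    have y0: "y $ None = 0" using FsA[of y] y c by simp
    have "\<gamma> x0 = fd f x0 (\<tau> x0) + (- \<mu>) *\<^sub>R f x0" using G\<gamma>[OF x0B] t(2) G\<tau>[of x0] by simp
    then have "(tail y $ None) *\<^sub>R (fd f x0 (\<tau> x0) + (- \<mu>) *\<^sub>R f x0) + fd f x0 (L (tail (tail y))) = 0"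
      using y y0 unfolding A_def by simp
    then have "fd f x0 ((tail y $ None) *\<^sub>R \<tau> x0 + L (tail (tail y))) + (- ((tail y $ None) * \<mu>)) *\<^sub>R f x0 = 0"
      by (simp add: linear_add[OF linear_df[OF x0]] linear_scale[OF linear_df[OF x0]] algebra_simps)
    from indep[OF x0 this] nonzero have y1: "tail y $ None = 0" and "L (tail (tail y)) = 0" by auto
    then have "tail (tail y) = 0" using L(1,2) linear_injective_0 by blast
    then have "tail y = 0" using y1 emb_collapse[of "tail y"] by simp
    then show "y = 0" using y0 emb_collapse[of y] by simp
  qed
  then have bA: "bij A" using linear_inj_imp_surj[OF lA] by (simp add: bij_def)
  define Ai where "Ai = inv A"
  have AAi [simp]: "A (Ai w) = w" and AiA [simp]: "Ai (A y) = y" for w y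
    using bA by (simp_all add: Ai_def bij_is_surj surj_f_inv_f bij_is_inj inv_f_f)
  have lAi: "linear Ai"
  proof (intro linearI)
    show "Ai (v + w) = Ai v + Ai w" for v w by (metis AAi AiA linear_add[OF lA])
    show "Ai (k *\<^sub>R v) = k *\<^sub>R Ai v" for k v by (metis AAi AiA linear_scale[OF lA])
  qed
  have Ai_emb: "Ai w = emb 0 (tail (Ai w))" if "Fs x0 \<bullet> w = 0" for w
    using FsA[of "Ai w"] that c by (simp add: vec_option_eq_iff)
  \<comment> \<open>Dropping the coordinate along \<open>\<gamma> x0\<close> as well: at
    \<open>x0\<close> the image of the differential of \<open>\<gamma>\<close> is complementary to
    \<open>\<gamma> x0\<close> in the hyperplane, so the remaining components are local coordinates
    on the factor.\<close>
  define P where "P w = tail (tail (Ai w))" for w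
  have blP: "bounded_linear P"
    unfolding P_def linear_conv_bounded_linear[symmetric]
    by (intro linearI) (simp_all add: linear_add[OF lAi] linear_scale[OF lAi] tail_add tail_scaleR)
  define \<Psi> where "\<Psi> x = t x *\<^sub>R axis None 1 + emb 0 (P (\<gamma> x))" for x
  have \<Psi>_emb: "\<Psi> x = emb (t x) (P (\<gamma> x))" for x unfolding \<Psi>_def by (rule emb_split[symmetric])
  have ob: "open (ball x0 r)" by simp
  have s\<Psi>: "smooth_on (ball x0 r) \<Psi>"
    unfolding \<Psi>_def[abs_def]
    by (intro smooth_on_add smooth_on_scaleR smooth_on_const t(1) smooth_on_linear[OF bounded_linear_emb]
      smooth_on_linear[OF blP] \<gamma>(1) ob)
  have d\<Psi>: "fd \<Psi> x v = emb (\<alpha> x v) (P (fd \<gamma> x v))" if x: "x \<in> ball x0 r" for x v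
  proof -
    have "(\<Psi> has_derivative (\<lambda>v. fd t x v *\<^sub>R axis None 1 + emb 0 (P (fd \<gamma> x v)))) (at x)"
      unfolding \<Psi>_def[abs_def]
      by (intro has_derivative_add has_derivative_scaleR_left bounded_linear.has_derivative[OF bounded_linear_emb]
        bounded_linear.has_derivative[OF blP] smooth_on_has_derivative[OF t(1) x] smooth_on_has_derivative[OF \<gamma>(1) x])
    then show ?thesis by (simp add: fd_eq t(3)[OF x] emb_split[symmetric])
  qed
  have AL: "A (emb 0 (emb 0 w)) = fd f x0 (L w)" for w by (simp add: A_def)
  have P0: "P (fd f x0 (L w)) = w" for w unfolding AL[symmetric] P_def by simp
  have \<Psi>x0: "\<Psi> x0 = 0"
  proof -
    have "\<gamma> x0 = A (emb 0 (emb 1 0))"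
      by (simp add: A_def linear_0[OF L(1)] linear_0[OF linear_df[OF x0]])
    then have "P (\<gamma> x0) = 0" by (simp add: P_def)
    then show ?thesis by (simp add: \<Psi>_emb t(2))
  qed
  have "inj (fd \<Psi> x0)"
  proof (unfold linear_injective_0[OF smooth_on_linear_fd[OF s\<Psi> x0B]], intro allI impI)
    fix v assume "fd \<Psi> x0 v = 0"
    then have v: "\<alpha> x0 v = 0" "P (fd \<gamma> x0 v) = 0" by (simp_all add: d\<Psi>[OF x0B])
    then obtain w where w: "v = L w" using L(3) by blast
    have "P (fd \<gamma> x0 v) = - \<delta> *\<^sub>R w"
      using P0[of w] by (simp add: \<gamma>(2)[OF x0B] v(1) t(2) w \<alpha>L linear_neg[OF bounded_linear.linear[OF blP]] linear_scale[OF bounded_linear.linear[OF blP]])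
    then have "w = 0" using v(2) nonzero by simp
    then show "v = 0" using w linear_0[OF L(1)] by simp
  qed
  then obtain U V g where UV: "open U" "U \<subseteq> ball x0 r" "x0 \<in> U" "open V" "\<Psi> x0 \<in> V" "homeomorphism U V \<Psi> g"
    and sg: "smooth_on V g" and dg: "\<And>y v. y \<in> V \<Longrightarrow> fd \<Psi> (g y) (fd g y v) = v"
    and inj\<Psi>: "\<And>x. x \<in> U \<Longrightarrow> inj (fd \<Psi> x)"
    using smooth_inverse_function[OF ob x0B s\<Psi>] by metis
  obtain e where e: "e > 0" "ball 0 e \<subseteq> V" using UV(4,5) \<Psi>x0 openE by metis
  \<comment> \<open>Half the radius, because the norm of \<open>emb s q\<close> is bounded by the
    sum of the two norms.\<close>
  define \<epsilon> where "\<epsilon> = e / 2"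
  have \<epsilon>: "\<epsilon> > 0" using e by (simp add: \<epsilon>_def)
  let ?B = "ball (0 :: real ^ 'k) \<epsilon>"
  have oB: "open ?B" by simp
  have inV: "emb s q \<in> V" if "\<bar>s\<bar> < \<epsilon>" "q \<in> ?B" for s q
    using e(2) norm_emb_le[of s q] that by (auto simp: \<epsilon>_def)
  have gB: "g y \<in> ball x0 r" and gU: "g y \<in> U" and g\<Omega>: "g y \<in> \<Omega>" and \<Psi>g: "\<Psi> (g y) = y" if "y \<in> V" for y
    using UV(2,6) r(2) that by (auto simp: homeomorphism_def)
  have tg: "t (g y) = y $ None" and P\<gamma>g: "P (\<gamma> (g y)) = tail y" if "y \<in> V" for y
    using arg_cong[OF \<Psi>g[OF that], of "\<lambda>z. z $ None"] arg_cong[OF \<Psi>g[OF that], of tail] by (simp_all add: \<Psi>_emb)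
  have \<alpha>g: "\<alpha> (g y) (fd g y v) = v $ None" if "y \<in> V" for y v
    using arg_cong[OF dg[OF that], of "\<lambda>z. z $ None"] by (simp add: d\<Psi>[OF gB[OF that]])
  \<comment> \<open>\<open>\<Psi>\<close> sends \<open>\<tau>\<close> to the axis
    \<open>None\<close>, as \<open>\<gamma>\<close> is constant along \<open>\<tau>\<close> and
    \<open>\<alpha>\<close> is 1 on it; injectivity of the differential then identifies
    \<open>\<tau>\<close> with the coordinate field.\<close>
  have g\<tau>: "fd g y (axis None 1) = \<tau> (g y)" if y: "y \<in> V" for y
  proof -
    have "fd \<gamma> (g y) (\<tau> (g y)) = 0"
      by (simp add: \<gamma>(2)[OF gB[OF y]] unit[OF g\<Omega>[OF y]] linear_0[OF linear_df[OF g\<Omega>[OF y]]])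
    then have "fd \<Psi> (g y) (\<tau> (g y)) = axis None 1"
      by (simp add: d\<Psi>[OF gB[OF y]] unit[OF g\<Omega>[OF y]] linear_0[OF bounded_linear.linear[OF blP]] emb_axis)
    then show ?thesis using dg[OF y] inj\<Psi>[OF gU[OF y]] by (metis injD)
  qed
  have s\<gamma>g: "smooth_on V (\<lambda>y. \<gamma> (g y))"
    by (rule smooth_on_compose[OF UV(4) _ sg \<gamma>(1)]) (use gB in auto)
  have d\<gamma>g: "fd (\<lambda>y. \<gamma> (g y)) y v = fd \<gamma> (g y) (fd g y v)" if y: "y \<in> V" for y v
    using has_derivative_compose[OF smooth_on_has_derivative[OF sg y] smooth_on_has_derivative[OF \<gamma>(1) gB[OF y]]]
    by (simp add: fd_eq)
  have \<gamma>const: "\<gamma> (g (emb s q)) = \<gamma> (g (emb 0 q))" if s: "\<bar>s\<bar> < \<epsilon>" and q: "q \<in> ?B" for s q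
  proof -
    let ?p = "\<lambda>s. \<gamma> (g (emb 0 q + s *\<^sub>R axis None 1))"
    have eq: "emb 0 q + s *\<^sub>R axis None 1 = emb s q" for s by (subst (2) emb_split) simp
    have der: "(?p has_derivative (\<lambda>_. 0)) (at s')" if "s' \<in> ball 0 \<epsilon>" for s'
    proof -
      have y: "emb s' q \<in> V" using that q inV by (simp add: dist_real_def)
      have "fd \<gamma> (g (emb s' q)) (\<tau> (g (emb s' q))) = 0"
        by (simp add: \<gamma>(2)[OF gB[OF y]] unit[OF g\<Omega>[OF y]] linear_0[OF linear_df[OF g\<Omega>[OF y]]])
      then show ?thesis
        using smooth_on_line_derivative[OF s\<gamma>g, of "emb 0 q" s' "axis None 1"] y
        by (simp add: eq d\<gamma>g[OF y] g\<tau>[OF y])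
    qed
    have "s \<in> ball 0 \<epsilon>" using s by (simp add: dist_real_def)
    note constant_on_ball[of 0 \<epsilon> ?p s, OF der this]
    then have "?p s = ?p 0" by simp
    then show ?thesis by (simp only: eq)
  qed
  define \<psi>0 where "\<psi>0 q = tail (Ai (\<gamma> (g (emb 0 q))))" for q
  have \<gamma>\<psi>: "\<gamma> (g (emb s q)) = A (emb 0 (\<psi>0 q))" if s: "\<bar>s\<bar> < \<epsilon>" and q: "q \<in> ?B" for s q
  proof -
    have "Fs x0 \<bullet> \<gamma> (g (emb 0 q)) = 0" using Fs\<gamma> gB inV[of 0] q \<epsilon> by simp
    from Ai_emb[OF this] have "\<gamma> (g (emb 0 q)) = A (emb 0 (\<psi>0 q))" unfolding \<psi>0_def by (metis AAi)
    then show ?thesis using \<gamma>const[OF s q] by simp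
  qed
  have bl0: "bounded_linear (\<lambda>w. tail (Ai w))"
    unfolding linear_conv_bounded_linear[symmetric]
    by (intro linearI) (simp_all add: linear_add[OF lAi] linear_scale[OF lAi] tail_add tail_scaleR)
  have blA: "bounded_linear (\<lambda>w. A (emb 0 w))"
    unfolding linear_conv_bounded_linear[symmetric]
    using linear_compose[OF bounded_linear.linear[OF bounded_linear_emb] lA] by (simp add: o_def)
  have s_emb: "smooth_on ?B (\<lambda>q. emb s q)" for s
    by (subst emb_split) (intro smooth_on_add smooth_on_const smooth_on_linear[OF bounded_linear_emb] smooth_on_ident oB)
  have d_emb: "((\<lambda>q. emb s q) has_derivative emb 0) (at q)" for s and q :: "real ^ 'k"
  proof -
    have "((\<lambda>q. s *\<^sub>R axis None 1 + emb 0 q) has_derivative (\<lambda>v. 0 + emb 0 v)) (at q)"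
      by (intro has_derivative_add has_derivative_const bounded_linear_imp_has_derivative bounded_linear_emb)
    then show ?thesis by (simp add: emb_split[symmetric])
  qed
  have s\<psi>0: "smooth_on ?B \<psi>0"
    unfolding \<psi>0_def[abs_def]
    by (intro smooth_on_linear[OF bl0] oB smooth_on_compose[OF oB _ s_emb s\<gamma>g]) (use inV \<epsilon> in auto)
  \<comment> \<open>The coordinate fields of the factor. They are orthogonal to
    \<open>\<tau>\<close>, on which \<open>\<alpha>\<close> measures the first coordinate.\<close>
  define W where "W s q v = fd g (emb s q) (emb 0 v)" for s q v
  have dcomp: "((\<lambda>q. p (emb s q)) has_derivative (\<lambda>v. fd p (emb s q) (emb 0 v))) (at q)"
    if "smooth_on V p" "\<bar>s\<bar> < \<epsilon>" "q \<in> ?B" for p :: "_ \<Rightarrow> 'z::real_normed_vector" and s q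
    by (rule has_derivative_compose[OF d_emb smooth_on_has_derivative[OF that(1) inV[OF that(2,3)]]])
  have \<alpha>W: "\<alpha> (g (emb s q)) (W s q v) = 0" if s: "\<bar>s\<bar> < \<epsilon>" and q: "q \<in> ?B" for s q v
    unfolding W_def using \<alpha>g[OF inV[OF s q]] by simp
  have Wd: "fd \<Psi> (g (emb s q)) (W s q v) = emb 0 v" if s: "\<bar>s\<bar> < \<epsilon>" and q: "q \<in> ?B" for s q v
    unfolding W_def by (rule dg[OF inV[OF s q]])
  have E1: "A (emb 0 (fd \<psi>0 q v)) = (- \<delta> * exp (- lam2 * s)) *\<^sub>R fd f (g (emb s q)) (W s q v)"
    if s: "\<bar>s\<bar> < \<epsilon>" and q: "q \<in> ?B" for s q v
  proof -
    have "((\<lambda>q. A (emb 0 (\<psi>0 q))) has_derivative (\<lambda>v. A (emb 0 (fd \<psi>0 q v)))) (at q)"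
      by (rule bounded_linear.has_derivative[OF blA smooth_on_has_derivative[OF s\<psi>0 q]])
    then have "((\<lambda>q. \<gamma> (g (emb s q))) has_derivative (\<lambda>v. A (emb 0 (fd \<psi>0 q v)))) (at q)"
      by (rule has_derivative_transform_within_open[OF _ oB q]) (rule \<gamma>\<psi>[OF s, symmetric])
    moreover have "((\<lambda>q. \<gamma> (g (emb s q))) has_derivative (\<lambda>v. fd \<gamma> (g (emb s q)) (W s q v))) (at q)"
      using dcomp[OF s\<gamma>g s q] by (simp add: d\<gamma>g[OF inV[OF s q]] W_def)
    ultimately have "(\<lambda>v. A (emb 0 (fd \<psi>0 q v))) = (\<lambda>v. fd \<gamma> (g (emb s q)) (W s q v))"
      by (rule has_derivative_unique)
    from fun_cong[OF this, of v] show ?thesis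
      by (simp add: \<gamma>(2)[OF gB[OF inV[OF s q]]] \<alpha>W[OF s q] tg[OF inV[OF s q]])
  qed
  have G\<psi>: "G (g (emb s q)) = exp (lam2 * s) *\<^sub>R A (emb 0 (\<psi>0 q))" if s: "\<bar>s\<bar> < \<epsilon>" and q: "q \<in> ?B" for s q
    using G\<gamma>[OF gB[OF inV[OF s q]]] by (simp add: tg[OF inV[OF s q]] \<gamma>\<psi>[OF s q])
  have ind\<psi>: "z = 0 \<and> \<rho> = 0" if q: "q \<in> ?B" and "fd \<psi>0 q z + \<rho> *\<^sub>R \<psi>0 q = 0" for q z \<rho>
  proof -
    define x where "x = g (emb 0 q)"
    have s: "\<bar>0\<bar> < \<epsilon>" using \<epsilon> by simp
    have x\<Omega>: "x \<in> \<Omega>" unfolding x_def by (rule g\<Omega>[OF inV[OF s q]])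
    have "A (emb 0 (fd \<psi>0 q z)) + \<rho> *\<^sub>R A (emb 0 (\<psi>0 q)) = A (emb 0 (fd \<psi>0 q z + \<rho> *\<^sub>R \<psi>0 q))"
      using linear_add[OF bounded_linear.linear[OF blA]] linear_scale[OF bounded_linear.linear[OF blA]] by simp
    also have "\<dots> = 0" using that(2) linear_0[OF lA] by simp
    finally have "- \<delta> *\<^sub>R fd f x (W 0 q z) + \<rho> *\<^sub>R (fd f x (\<tau> x) + (- \<mu>) *\<^sub>R f x) = 0"
      using E1[OF s q, of z] G\<psi>[OF s q] G\<tau>[of x] by (simp add: x_def)
    then have "fd f x (- \<delta> *\<^sub>R W 0 q z + \<rho> *\<^sub>R \<tau> x) + (- (\<rho> * \<mu>)) *\<^sub>R f x = 0"
      by (simp only: linear_add[OF linear_df[OF x\<Omega>]] linear_scale[OF linear_df[OF x\<Omega>]]) (simp add: algebra_simps)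
    from indep[OF x\<Omega> this] nonzero have "\<rho> = 0" and "W 0 q z = 0" by auto
    moreover from this have "z = 0" using Wd[OF s q, of z]
      linear_0[OF smooth_on_linear_fd[OF s\<Psi> gB[OF inV[OF s q]]]] by simp
    ultimately show ?thesis by simp
  qed
  define h1 where "h1 q v w = (- \<delta> * lam2) * H (g (emb 0 q)) (W 0 q v) (W 0 q w)" for q v w
  \<comment> \<open>At every \<open>s\<close> the conormal of \<open>f\<close> annihilates the
    tangent vectors of the factor. Differentiating this relation isolates \<open>\<kappa>\<close>,
    the factor being \<open>1 / lam2\<close>, the value of \<open>\<nu> \<bullet> G\<close>. As
    \<open>\<kappa>\<close> does not involve \<open>s\<close>, the metric on the factor is constant
    in \<open>s\<close>.\<close>
  have E2: "\<kappa> = (- \<delta> * lam2) * H (g (emb s q)) (W s q v) (W s q w)"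
    if s: "\<bar>s\<bar> < \<epsilon>" and q: "q \<in> ?B" and dec: "fd (\<lambda>p. fd \<psi>0 p w) q v = fd \<psi>0 q z + \<kappa> *\<^sub>R \<psi>0 q" for s q v w z \<kappa>
  proof -
    define x where "x = g (emb s q)"
    have x\<Omega>: "x \<in> \<Omega>" unfolding x_def by (rule g\<Omega>[OF inV[OF s q]])
    have s\<nu>g: "smooth_on V (\<lambda>y. \<nu> (g y))"
      by (rule smooth_on_compose[OF UV(4) _ sg smooth_\<nu>]) (use g\<Omega> in auto)
    have sn: "smooth_on ?B (\<lambda>q. \<nu> (g (emb s q)))"
      by (rule smooth_on_compose[OF oB _ s_emb s\<nu>g]) (use inV s in auto)
    have sm: "smooth_on ?B (\<lambda>p. A (emb 0 (fd \<psi>0 p w)))"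
      by (intro smooth_on_linear[OF blA] oB smooth_on_fd s\<psi>0)
    have "\<nu> (g (emb s q)) \<bullet> fd (\<lambda>p. A (emb 0 (fd \<psi>0 p w))) q v +
        fd (\<lambda>q. \<nu> (g (emb s q))) q v \<bullet> A (emb 0 (fd \<psi>0 q w)) = fd (\<lambda>_. 0) q v"
      by (rule fd_inner_cong(1)[OF oB sn sm q]) (simp add: E1[OF s] \<nu>_df[OF g\<Omega>[OF inV[OF s]]])
    moreover have "fd (\<lambda>q. \<nu> (g (emb s q))) q v = fd \<nu> x (W s q v)"
    proof -
      have "fd (\<lambda>y. \<nu> (g y)) (emb s q) (emb 0 v) = fd \<nu> (g (emb s q)) (fd g (emb s q) (emb 0 v))"
        using has_derivative_compose[OF smooth_on_has_derivative[OF sg inV[OF s q]]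
            smooth_on_has_derivative[OF smooth_\<nu> g\<Omega>[OF inV[OF s q]]]] by (simp add: fd_eq)
      then show ?thesis using dcomp[OF s\<nu>g s q] by (simp add: fd_eq W_def x_def)
    qed
    moreover have "fd (\<lambda>p. A (emb 0 (fd \<psi>0 p w))) q v = A (emb 0 (fd \<psi>0 q z)) + \<kappa> *\<^sub>R A (emb 0 (\<psi>0 q))"
    proof -
      have "fd (\<lambda>p. A (emb 0 (fd \<psi>0 p w))) q v = A (emb 0 (fd (\<lambda>p. fd \<psi>0 p w) q v))"
        using fd_eq[OF bounded_linear.has_derivative[OF blA smooth_on_has_derivative[OF smooth_on_fd[OF s\<psi>0, of w] q]]] by simp
      then show ?thesis
        unfolding dec using linear_add[OF bounded_linear.linear[OF blA]] linear_scale[OF bounded_linear.linear[OF blA]] by simp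
    qed
    moreover have "\<nu> x \<bullet> A (emb 0 (\<psi>0 q)) = exp (- lam2 * s) / lam2"
    proof -
      have "A (emb 0 (\<psi>0 q)) = exp (- lam2 * s) *\<^sub>R G x" unfolding x_def G\<psi>[OF s q] by (simp add: exp_minus)
      moreover have "\<nu> x \<bullet> G x = 1 / lam2"
        using nonzero by (simp add: G\<tau> inner_diff_right \<nu>_df[OF x\<Omega>] \<nu>_f[OF x\<Omega>]) (simp add: lam_prod)
      ultimately show ?thesis by simp
    qed
    ultimately have "\<kappa> * (exp (- lam2 * s) / lam2) + \<delta> * exp (- lam2 * s) * H x (W s q v) (W s q w) = 0"
      by (simp add: E1[OF s q] x_def[symmetric] inner_add_right inner_diff_right \<nu>_df[OF x\<Omega>] d\<nu>_df[OF x\<Omega>])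
    then have "exp (- lam2 * s) * (\<kappa> / lam2 + \<delta> * H x (W s q v) (W s q w)) = 0" by (simp add: algebra_simps)
    then have "\<kappa> / lam2 + \<delta> * H x (W s q v) (W s q w) = 0" by simp
    then have "lam2 * (\<kappa> / lam2 + \<delta> * H x (W s q v) (W s q w)) = 0" by simp
    then have "\<kappa> + \<delta> * lam2 * H x (W s q v) (W s q w) = 0" using nonzero by (simp add: algebra_simps)
    then show ?thesis by (simp add: x_def)
  qed
  have gauss\<psi>: "\<exists>z. fd (\<lambda>p. fd \<psi>0 p w) q v = fd \<psi>0 q z + h1 q v w *\<^sub>R \<psi>0 q" if q: "q \<in> ?B" for q v w
  proof -
    obtain z \<kappa> where zk: "fd (\<lambda>p. fd \<psi>0 p w) q v = fd \<psi>0 q z + \<kappa> *\<^sub>R \<psi>0 q"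
      using linear_frame(1)[OF smooth_on_linear_fd[OF s\<psi>0 q] ind\<psi>[OF q]] by blast
    from E2[OF _ q zk, of 0] \<epsilon> have "\<kappa> = h1 q v w" by (simp add: h1_def)
    then show ?thesis using zk by blast
  qed
  have H_const: "H (g (emb s q)) (W s q v) (W s q w) = h1 q v w / (- \<delta> * lam2)" if s: "\<bar>s\<bar> < \<epsilon>" and q: "q \<in> ?B" for s q v w
    using gauss\<psi>[OF q, of w v] E2[OF s q] nonzero by force
  have pos: "- \<delta> * lam2 > 0"
  proof -
    have "- \<delta> * lam2 = lam2 * lam2 - lam" by (simp add: \<delta>_def lam_prod algebra_simps)
    then show ?thesis using lam_neg zero_le_square[of lam2] by linarith
  qed
  define k where "k = CARD('k)"
  define D where "D q X = det (\<chi> a. case a of None \<Rightarrow> \<psi>0 q | Some i \<Rightarrow> fd \<psi>0 q (X i))" for q and X :: "'k \<Rightarrow> real ^ 'k"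
  \<comment> \<open>The factors of the frame determinant that depend neither on the point nor on the
    frame.\<close>
  define C where "C = \<bar>det (matrix A)\<bar> * (\<bar>lam\<bar> / \<bar>\<delta>\<bar>) * (1 / \<bar>\<delta>\<bar>) ^ k"
  have C: "C > 0"
    using nonzero det_nz_iff_inj[OF lA] \<open>inj A\<close> by (simp add: C_def)
  have fA: "f (g (emb s q)) = A (emb (exp (\<mu> * s) / \<delta>) ((- exp (lam2 * s) / \<delta>) *\<^sub>R \<psi>0 q))"
    if s: "\<bar>s\<bar> < \<epsilon>" and q: "q \<in> ?B" for s q
  proof -
    have "\<delta> *\<^sub>R f (g (emb s q)) = F (g (emb s q)) - G (g (emb s q))" by (simp add: G_def)
    also have "\<dots> = exp (\<mu> * s) *\<^sub>R F x0 - exp (lam2 * s) *\<^sub>R A (emb 0 (\<psi>0 q))"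
      using F0[OF gB[OF inV[OF s q]]] by (simp add: tg[OF inV[OF s q]] G\<psi>[OF s q])
    also have "F x0 = A (axis None 1)"
      by (simp add: emb_axis[of 1, simplified, symmetric] A_def tail_0 linear_0[OF L(1)] linear_0[OF linear_df[OF x0]])
    finally have "f (g (emb s q)) = (1 / \<delta>) *\<^sub>R (exp (\<mu> * s) *\<^sub>R A (axis None 1) - exp (lam2 * s) *\<^sub>R A (emb 0 (\<psi>0 q)))"
      using nonzero by (metis divide_self scaleR_one scaleR_scaleR times_divide_eq_left mult_1)
    also have "\<dots> = A ((1 / \<delta>) *\<^sub>R (exp (\<mu> * s) *\<^sub>R axis None 1 - exp (lam2 * s) *\<^sub>R emb 0 (\<psi>0 q)))"
      by (simp add: linear_scale[OF lA] linear_diff[OF lA])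
    also have "(1 / \<delta>) *\<^sub>R (exp (\<mu> * s) *\<^sub>R axis None 1 - exp (lam2 * s) *\<^sub>R emb 0 (\<psi>0 q)) =
       emb (exp (\<mu> * s) / \<delta>) ((- exp (lam2 * s) / \<delta>) *\<^sub>R \<psi>0 q)"
      by (simp add: vec_option_eq_iff vec_eq_iff axis_def)
    finally show ?thesis .
  qed
  have TA: "fd f (g (emb s q)) (\<tau> (g (emb s q))) = A (emb (exp (\<mu> * s) * \<mu> / \<delta>) ((- (lam2 * exp (lam2 * s)) / \<delta>) *\<^sub>R \<psi>0 q))"
    if s: "\<bar>s\<bar> < \<epsilon>" and q: "q \<in> ?B" for s q
  proof -
    have "fd f (g (emb s q)) (\<tau> (g (emb s q))) = G (g (emb s q)) + \<mu> *\<^sub>R f (g (emb s q))" by (simp add: G\<tau>)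
    also have "\<dots> = A (exp (lam2 * s) *\<^sub>R emb 0 (\<psi>0 q) + \<mu> *\<^sub>R emb (exp (\<mu> * s) / \<delta>) ((- exp (lam2 * s) / \<delta>) *\<^sub>R \<psi>0 q))"
      by (simp add: G\<psi>[OF s q] fA[OF s q] linear_add[OF lA] linear_scale[OF lA])
    also have "exp (lam2 * s) *\<^sub>R emb 0 (\<psi>0 q) + \<mu> *\<^sub>R emb (exp (\<mu> * s) / \<delta>) ((- exp (lam2 * s) / \<delta>) *\<^sub>R \<psi>0 q) =
       emb (exp (\<mu> * s) * \<mu> / \<delta>) ((exp (lam2 * s) - \<mu> * exp (lam2 * s) / \<delta>) *\<^sub>R \<psi>0 q)"
      by (simp add: vec_option_eq_iff vec_eq_iff algebra_simps)
    also have "exp (lam2 * s) - \<mu> * exp (lam2 * s) / \<delta> = - (lam2 * exp (lam2 * s)) / \<delta>"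
      using nonzero by (simp add: field_simps) (simp add: \<delta>_def algebra_simps)
    finally show ?thesis .
  qed
  have UA: "fd f (g (emb s q)) (W s q v) = A (emb 0 ((- exp (lam2 * s) / \<delta>) *\<^sub>R fd \<psi>0 q v))"
    if s: "\<bar>s\<bar> < \<epsilon>" and q: "q \<in> ?B" for s q v
  proof -
    have "A (emb 0 ((- exp (lam2 * s) / \<delta>) *\<^sub>R fd \<psi>0 q v)) = (- exp (lam2 * s) / \<delta>) *\<^sub>R A (emb 0 (fd \<psi>0 q v))"
      using linear_scale[OF bounded_linear.linear[OF blA]] .
    then show ?thesis unfolding E1[OF s q] using nonzero by (simp add: exp_minus)
  qed
  \<comment> \<open>The volume condition for the frame of \<open>\<tau>\<close> and the fields
    \<open>W\<close>. The rows of \<open>f\<close> and \<open>\<tau>\<close> contribute the exponent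
    \<open>\<mu> + lam2\<close>, each of the other \<open>k\<close> rows \<open>lam2\<close>; the
    Gram matrix has a unit row for \<open>\<tau>\<close>.\<close>
  have vol: "C * exp ((\<mu> + (real k + 1) * lam2) * s) * \<bar>D q X\<bar> = sqrt \<bar>det (\<chi> i j. h1 q (X i) (X j) / (- \<delta> * lam2))\<bar>"
    if s: "\<bar>s\<bar> < \<epsilon>" and q: "q \<in> ?B" for s q X
  proof -
    define x where "x = g (emb s q)"
    have x\<Omega>: "x \<in> \<Omega>" unfolding x_def by (rule g\<Omega>[OF inV[OF s q]])
    define Y where "Y i = (case i of None \<Rightarrow> \<tau> x | Some i \<Rightarrow> W s q (X i))" for i
    have "det (\<chi> a. case a of None \<Rightarrow> (- lam) *\<^sub>R f x | Some i \<Rightarrow> fd f x (Y i)) =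
      det (\<chi> a. case a of None \<Rightarrow> A (emb (- lam * exp (\<mu> * s) / \<delta>) ((lam * exp (lam2 * s) / \<delta>) *\<^sub>R \<psi>0 q))
        | Some None \<Rightarrow> A (emb (exp (\<mu> * s) * \<mu> / \<delta>) ((- (lam2 * exp (lam2 * s)) / \<delta>) *\<^sub>R \<psi>0 q))
        | Some (Some i) \<Rightarrow> A (emb 0 ((- exp (lam2 * s) / \<delta>) *\<^sub>R fd \<psi>0 q (X i))))"
    proof -
      have "(- lam) *\<^sub>R f x = A ((- lam) *\<^sub>R emb (exp (\<mu> * s) / \<delta>) ((- exp (lam2 * s) / \<delta>) *\<^sub>R \<psi>0 q))"
        unfolding x_def fA[OF s q] by (rule linear_scale[OF lA, symmetric])
      then have "(- lam) *\<^sub>R f x = A (emb (- lam * exp (\<mu> * s) / \<delta>) ((lam * exp (lam2 * s) / \<delta>) *\<^sub>R \<psi>0 q))"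
        by (simp add: emb_scaleR)
      then show ?thesis
        by (intro arg_cong[where f = det] arg_cong[where f = vec_lambda] ext)
         (use TA[OF s q] UA[OF s q] in \<open>auto simp: Y_def x_def split: option.split\<close>)
    qed
    also have "\<dots> = det (matrix A) * ((- lam * exp (\<mu> * s) / \<delta> * (- (lam2 * exp (lam2 * s)) / \<delta>) -
        lam * exp (lam2 * s) / \<delta> * (exp (\<mu> * s) * \<mu> / \<delta>)) * ((- exp (lam2 * s) / \<delta>) ^ k * D q X))"
      unfolding det_split_rows[OF lA] k_def D_def ..
    also have "- lam * exp (\<mu> * s) / \<delta> * (- (lam2 * exp (lam2 * s)) / \<delta>) -
        lam * exp (lam2 * s) / \<delta> * (exp (\<mu> * s) * \<mu> / \<delta>) = - (lam / \<delta>) * (exp (\<mu> * s) * exp (lam2 * s))"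
      using nonzero by (simp add: field_simps) (simp add: \<delta>_def algebra_simps)
    finally have "\<bar>det (\<chi> a. case a of None \<Rightarrow> (- lam) *\<^sub>R f x | Some i \<Rightarrow> fd f x (Y i))\<bar> =
       C * (exp (\<mu> * s) * exp (lam2 * s) * exp (lam2 * s) ^ k) * \<bar>D q X\<bar>"
      by (simp add: abs_mult power_abs C_def power_divide) (simp add: ac_simps)
    also have "exp (\<mu> * s) * exp (lam2 * s) * exp (lam2 * s) ^ k = exp ((\<mu> + (real k + 1) * lam2) * s)"
      by (simp add: exp_of_nat_mult[symmetric] exp_add[symmetric] algebra_simps)
    finally have lhs: "\<bar>det (\<chi> a. case a of None \<Rightarrow> (- lam) *\<^sub>R f x | Some i \<Rightarrow> fd f x (Y i))\<bar> =
       C * exp ((\<mu> + (real k + 1) * lam2) * s) * \<bar>D q X\<bar>" .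
    have "det (\<chi> i j. H x (Y i) (Y j)) = det (\<chi> i j. (\<chi> i j. H x (Y i) (Y j)) $ Some i $ Some j)"
      by (rule det_option_block)
        (use \<alpha>W[OF s q] unit[OF x\<Omega>] in \<open>auto simp: vec_eq_iff Y_def axis_def x_def split: option.split\<close>)
    also have "\<dots> = det (\<chi> i j. h1 q (X i) (X j) / (- \<delta> * lam2))"
      using H_const[OF s q] by (simp add: Y_def x_def)
    finally show ?thesis using volume[OF x\<Omega>, of Y] lhs by simp
  qed
  \<comment> \<open>The right-hand side of \<open>vol\<close> is independent of \<open>s\<close>.
    Comparing \<open>\<epsilon> / 2\<close> with 0 on a frame with nonzero determinant forces the
    exponent to vanish.\<close>
  have \<mu>_eq: "\<mu> = - (real k + 1) * lam2"
  proof -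
    let ?X = "\<lambda>i. axis i 1 :: real ^ 'k"
    have 0: "0 \<in> ?B" using \<epsilon> by simp
    have "D 0 ?X \<noteq> 0" unfolding D_def by (rule linear_frame(2)[OF smooth_on_linear_fd[OF s\<psi>0 0] ind\<psi>[OF 0]])
    moreover have "C * exp ((\<mu> + (real k + 1) * lam2) * (\<epsilon> / 2)) * \<bar>D 0 ?X\<bar> = C * exp ((\<mu> + (real k + 1) * lam2) * 0) * \<bar>D 0 ?X\<bar>"
      using vol[of "\<epsilon> / 2" 0 ?X] vol[of 0 0 ?X] \<epsilon> by simp
    ultimately have "exp ((\<mu> + (real k + 1) * lam2) * (\<epsilon> / 2)) = 1" using C by simp
    then have "\<mu> + (real k + 1) * lam2 = 0" using \<epsilon> by simp
    then show ?thesis by (simp add: algebra_simps)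
  qed
  \<comment> \<open>Replacing \<open>h1 / (- \<delta> * lam2)\<close> by \<open>h1\<close>
    multiplies the Gram determinant of size \<open>k\<close> by the \<open>k\<close>-th power of the
    factor.\<close>
  define C' where "C' = C * sqrt ((- \<delta> * lam2) ^ k)"
  have C': "C' > 0" using C pos by (simp add: C'_def)
  have vol': "C' * \<bar>D q X\<bar> = sqrt \<bar>det (\<chi> i j. h1 q (X i) (X j))\<bar>" if q: "q \<in> ?B" for q X
  proof -
    have "(\<chi> i j. h1 q (X i) (X j)) = (\<chi> i j. (- \<delta> * lam2) * (h1 q (X i) (X j) / (- \<delta> * lam2)))"
      using nonzero by simp
    then have "det (\<chi> i j. h1 q (X i) (X j)) = (- \<delta> * lam2) ^ k * det (\<chi> i j. h1 q (X i) (X j) / (- \<delta> * lam2))"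
      unfolding k_def by (simp only: det_scale)
    then have "sqrt \<bar>det (\<chi> i j. h1 q (X i) (X j))\<bar> = sqrt ((- \<delta> * lam2) ^ k) * sqrt \<bar>det (\<chi> i j. h1 q (X i) (X j) / (- \<delta> * lam2))\<bar>"
      using pos by (simp only: abs_mult real_sqrt_mult abs_of_pos[OF zero_less_power[OF pos]])
    then show ?thesis using vol[of 0 q X] q \<epsilon> by (simp add: C'_def)
  qed
  \<comment> \<open>Scaling \<open>\<psi>0\<close> multiplies all \<open>k + 1\<close> rows of the
    frame determinant, but leaves \<open>h1\<close> unchanged because the transversal vector is
    scaled too. Hence the root of order \<open>k + 1\<close>.\<close>
  define \<sigma> where "\<sigma> = root (Suc k) C'"
  have \<sigma>: "\<sigma> > 0" "\<sigma> ^ Suc k = C'" using C' real_root_pow_pos[of "Suc k" C'] unfolding \<sigma>_def by simp_all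
  define \<psi> where "\<psi> q = \<sigma> *\<^sub>R \<psi>0 q" for q
  have s\<psi>: "smooth_on ?B \<psi>" unfolding \<psi>_def[abs_def] by (intro smooth_on_scaleR smooth_on_const s\<psi>0 oB)
  have d\<psi>: "fd \<psi> q v = \<sigma> *\<^sub>R fd \<psi>0 q v" if "q \<in> ?B" for q v
    using has_derivative_scaleR_right[OF smooth_on_has_derivative[OF s\<psi>0 that], of \<sigma>]
    unfolding \<psi>_def[abs_def] by (simp add: fd_eq)
  have d2\<psi>: "fd (\<lambda>p. fd \<psi> p w) q v = \<sigma> *\<^sub>R fd (\<lambda>p. fd \<psi>0 p w) q v" if q: "q \<in> ?B" for q v w
  proof -
    have "((\<lambda>p. fd \<psi> p w) has_derivative (\<lambda>v. \<sigma> *\<^sub>R fd (\<lambda>p. fd \<psi>0 p w) q v)) (at q)"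
      by (rule has_derivative_transform_within_open[OF
          has_derivative_scaleR_right[OF smooth_on_has_derivative[OF smooth_on_fd[OF s\<psi>0] q]] oB q])
        (simp add: d\<psi>)
    then show ?thesis by (simp add: fd_eq)
  qed
  have sphere: "hyperbolic_sphere_on ?B \<psi> h1"
    unfolding hyperbolic_sphere_on_def
  proof (intro conjI ballI allI impI s\<psi>)
    fix q assume q: "q \<in> ?B"
    { fix z \<rho> assume "fd \<psi> q z + \<rho> *\<^sub>R \<psi> q = 0"
      then have "\<sigma> *\<^sub>R (fd \<psi>0 q z + \<rho> *\<^sub>R \<psi>0 q) = 0" by (simp add: d\<psi>[OF q] \<psi>_def algebra_simps)
      then have "fd \<psi>0 q z + \<rho> *\<^sub>R \<psi>0 q = 0" using \<sigma> by simp
      from ind\<psi>[OF q this] show "z = 0" "\<rho> = 0" by auto }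
    { fix v w
      obtain z where "fd (\<lambda>p. fd \<psi>0 p w) q v = fd \<psi>0 q z + h1 q v w *\<^sub>R \<psi>0 q" using gauss\<psi>[OF q] by blast
      then show "\<exists>z. fd (\<lambda>p. fd \<psi> p w) q v = fd \<psi> q z + h1 q v w *\<^sub>R \<psi> q"
        by (intro exI[of _ z]) (simp add: d2\<psi>[OF q] d\<psi>[OF q] \<psi>_def algebra_simps) }
    { fix u :: "real ^ 'k" assume u: "u \<noteq> 0"
      have "W 0 q u \<noteq> 0"
        using Wd[of 0 q u] q \<epsilon> u linear_0[OF smooth_on_linear_fd[OF s\<Psi> gB[OF inV[of 0 q]]]] by auto
      then show "h1 q u u > 0"
        unfolding h1_def using H_pos[OF g\<Omega>[OF inV[of 0 q]]] q \<epsilon> by (intro mult_pos_pos[OF pos]) auto }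
    { fix X :: "'k \<Rightarrow> real ^ 'k"
      have "(\<chi> a. case a of None \<Rightarrow> \<psi> q | Some i \<Rightarrow> fd \<psi> q (X i)) =
         (\<chi> a. \<sigma> *s (case a of None \<Rightarrow> \<psi>0 q | Some i \<Rightarrow> fd \<psi>0 q (X i)))"
        by (intro arg_cong[where f = vec_lambda] ext)
          (auto simp: \<psi>_def d\<psi>[OF q] scalar_mult_eq_scaleR split: option.split)
      then have "det (\<chi> a. case a of None \<Rightarrow> \<psi> q | Some i \<Rightarrow> fd \<psi> q (X i)) = \<sigma> ^ Suc k * D q X"
        by (simp add: det_rows_mul D_def k_def)
      then show "\<bar>det (\<chi> a. case a of None \<Rightarrow> \<psi> q | Some i \<Rightarrow> fd \<psi> q (X i))\<bar> = sqrt \<bar>det (\<chi> i j. h1 q (X i) (X j))\<bar>"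
        using vol'[OF q, of X] C' unfolding \<sigma>(2) by (simp add: abs_mult) }
  qed
  have n: "real CARD('k option) = real k + 1" by (simp add: k_def)
  \<comment> \<open>The constants come from \<open>f = (F - G) / \<delta>\<close>, with
    \<open>G\<close> expressed through \<open>\<psi>\<close> instead of
    \<open>\<psi>0\<close>.\<close>
  show thesis
  proof (rule that[of \<epsilon> U V \<Psi> g A "- (1 / (\<delta> * \<sigma>))" "1 / \<delta>" \<psi> h1, OF \<epsilon> UV(1) _ UV(3,4,6)
      smooth_on_subset[OF s\<Psi> UV(2)] sg \<Psi>x0 inV lA bA _ _ sphere])
    show "U \<subseteq> \<Omega>" using UV(2) r(2) by blast
    show "- (1 / (\<delta> * \<sigma>)) \<noteq> 0" "1 / \<delta> \<noteq> 0" using nonzero \<sigma> by auto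
    fix s q assume sq: "\<bar>s\<bar> < \<epsilon>" "q \<in> ?B"
    have "\<mu> * s = - (real CARD('k option) * lam2 * s)" unfolding n \<mu>_eq by (simp add: algebra_simps)
    then show "f (g (emb s q)) = A (emb (1 / \<delta> * exp (- (real CARD('k option) * lam2 * s)))
        ((- (1 / (\<delta> * \<sigma>)) * exp (lam2 * s)) *\<^sub>R \<psi> q))"
      unfolding fA[OF sq] \<psi>_def using \<sigma> nonzero by simp
  qed
qed

end

section \<open>Open subsets of Euclidean space as manifolds\<close>

definition flat_manifold :: "(real ^ 'k::finite) set \<Rightarrow> (real ^ 'k, 'k) manifold" where
  "flat_manifold B = \<lparr>mtop = top_of_set B, atlas = {(B, \<lambda>x. x)}\<rparr>"

lemma pts_flat_manifold [simp]: "pts (flat_manifold B) = B"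
  by (simp add: flat_manifold_def)

lemma openin_flat_manifold: "open B \<Longrightarrow> openin (mtop (flat_manifold B)) W \<longleftrightarrow> open W \<and> W \<subseteq> B"
  by (auto simp: flat_manifold_def openin_open_eq)

lemma inv_into_ident: "x \<in> B \<Longrightarrow> inv_into B (\<lambda>x. x) x = x"
  using inv_into_f_f[of "\<lambda>x. x" B x] by simp

lemma second_countable_euclid: "second_countable (euclidean :: 'v::euclidean_space topology)"
proof -
  obtain \<B> :: "'v set set" where B: "countable \<B>" "\<And>C. C \<in> \<B> \<Longrightarrow> open C"
    "\<And>S. open S \<Longrightarrow> \<exists>U. U \<subseteq> \<B> \<and> S = \<Union>U"
    by (rule univ_second_countable) blast
  show ?thesis
    unfolding second_countable_def
  proof (intro exI[of _ \<B>] conjI ballI allI impI)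
    fix U :: "'v set" and x assume "openin euclidean U \<and> x \<in> U"
    then have "open U" and x: "x \<in> U" by auto
    from B(3)[OF this(1)] obtain \<U> where "\<U> \<subseteq> \<B>" "U = \<Union>\<U>" by blast
    with x show "\<exists>V\<in>\<B>. x \<in> V \<and> V \<subseteq> U" by blast
  qed (use B in auto)
qed

lemma smooth_manifold_flat:
  assumes B: "open B" shows "smooth_manifold (flat_manifold B)"
proof -
  have "smooth_on B ((\<lambda>x. x) \<circ> inv_into B (\<lambda>x. x))"
    by (rule smooth_on_cong[OF B _ smooth_on_ident]) (simp add: inv_into_ident)
  moreover have "homeomorphic_map (top_of_set B) (top_of_set B) (\<lambda>x. x)"
    by (simp add: homeomorphic_map_id[unfolded id_def])
  moreover have "Hausdorff_space (top_of_set B)"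
    by (simp add: Hausdorff_space_subtopology)
  moreover have "second_countable (top_of_set B)"
    by (simp add: second_countable_subtopology second_countable_euclid)
  ultimately show ?thesis
    using B by (simp add: smooth_manifold_def flat_manifold_def subtopology_subtopology)
qed

lemma mderiv_flat:
  assumes "open B" "p \<in> B" shows "mderiv (flat_manifold B) F p u = fd F p u"
proof -
  have "chart_at (flat_manifold B) p = (B, \<lambda>x. x)"
    unfolding chart_at_def by (rule some_equality) (use assms in \<open>auto simp: flat_manifold_def\<close>)
  moreover have "fd (F \<circ> inv_into B (\<lambda>x. x)) p = fd F p"
    by (rule fd_cong[OF assms]) (simp add: inv_into_ident)
  ultimately show ?thesis by (simp add: mderiv_def)
qed

lemma smooth_fun_flat:
  assumes "open B" "open W" "W \<subseteq> B"
  shows "smooth_fun (flat_manifold B) W F \<longleftrightarrow> smooth_on W F"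
proof -
  have W: "B \<inter> W = W" using assms by auto
  have "smooth_on W (F \<circ> inv_into B (\<lambda>x. x)) \<longleftrightarrow> smooth_on W F"
    using smooth_on_cong[OF assms(2), of F "F \<circ> inv_into B (\<lambda>x. x)"]
      smooth_on_cong[OF assms(2), of "F \<circ> inv_into B (\<lambda>x. x)" F] inv_into_ident assms(3) by fastforce
  then show ?thesis by (simp add: smooth_fun_def flat_manifold_def W)
qed

lemma vector_field_flat:
  assumes "open B" "open W" "W \<subseteq> B" "vector_field (flat_manifold B) W X"
  shows "smooth_on W X"
proof -
  have W: "B \<inter> W = W" using assms by auto
  have "smooth_fun (flat_manifold B) W (\<lambda>q. mderiv (flat_manifold B) (\<lambda>x. x) q (X q))"
    using assms(4) W unfolding vector_field_def by (simp add: flat_manifold_def)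
  then have "smooth_on W (\<lambda>q. mderiv (flat_manifold B) (\<lambda>x. x) q (X q))"
    using smooth_fun_flat[OF assms(1-3)] by blast
  then show ?thesis
    by (rule smooth_on_cong[OF assms(2), rotated]) (use assms(3) in \<open>auto simp: mderiv_flat[OF assms(1)]\<close>)
qed

text \<open>The induced connection is chosen pointwise as a solution of the Gauss formula. A
  solution exists for every field \<open>Y\<close>, because compared with the constant field of
  value \<open>Y p\<close> the second derivative gains a tangential term only. The normal is
  \<open>\<psi>\<close> itself, which gives the shape operator \<open>- 1\<close>.\<close>

lemma hyperbolic_sphere_flat:
  assumes B: "open B" and s: "hyperbolic_sphere_on B \<psi> h"
  shows "\<exists>nabla S. hyperbolic_affine_hypersphere (flat_manifold B) \<psi> \<psi> nabla h S (- 1)"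
proof -
  let ?M = "flat_manifold B"
  have sm: "smooth_on B \<psi>" using s by (simp add: hyperbolic_sphere_on_def)
  have ind: "z = 0 \<and> r = 0" if "q \<in> B" "fd \<psi> q z + r *\<^sub>R \<psi> q = 0" for q z r
    using s that by (simp add: hyperbolic_sphere_on_def)
  have gs: "\<exists>z. fd (\<lambda>p. fd \<psi> p w) q v = fd \<psi> q z + h q v w *\<^sub>R \<psi> q" if "q \<in> B" for q v w
    using s that by (simp add: hyperbolic_sphere_on_def)
  have md: "mderiv ?M F p u = fd F p u" if "p \<in> B" for F :: "_ \<Rightarrow> real ^ 'a option" and p u
    by (rule mderiv_flat[OF B that])
  have lin: "linear (fd \<psi> p)" if "p \<in> B" for p by (rule smooth_on_linear_fd[OF sm that])
  define nabla where "nabla X Y p = (SOME z. flat_deriv ?M \<psi> X Y p = mderiv ?M \<psi> p z + h p (X p) (Y p) *\<^sub>R \<psi> p)" for X Y p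
  have gauss: "gauss_formula ?M \<psi> \<psi> nabla h"
    unfolding gauss_formula_def nabla_def
  proof (intro allI impI ballI, rule someI_ex)
    fix W X Y p
    assume W': "openin (mtop ?M) W" and Y: "vector_field ?M W Y" and p: "p \<in> W"
    have W: "open W" "W \<subseteq> B" using W' openin_flat_manifold[OF B] by auto
    have pB: "p \<in> B" using W p by auto
    have sY: "smooth_on W Y" by (rule vector_field_flat[OF B W Y])
    have "flat_deriv ?M \<psi> X Y p = fd (\<lambda>q. mderiv ?M \<psi> q (Y q)) p (X p)"
      unfolding flat_deriv_def by (rule md[OF pB])
    also have "fd (\<lambda>q. mderiv ?M \<psi> q (Y q)) p = fd (\<lambda>q. fd \<psi> q (Y q)) p"
      by (rule fd_cong[OF W(1) p]) (use W in \<open>auto simp: md\<close>)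
    also have "\<dots> (X p) = fd (\<lambda>q. fd \<psi> q (Y p)) p (X p) + fd \<psi> p (fd Y p (X p))"
      by (rule fd_fd_field[OF W(1) p smooth_on_subset[OF sm W(2)] smooth_on_differentiable[OF sY p]])
    finally have e: "flat_deriv ?M \<psi> X Y p = fd (\<lambda>q. fd \<psi> q (Y p)) p (X p) + fd \<psi> p (fd Y p (X p))" .
    obtain z where "fd (\<lambda>q. fd \<psi> q (Y p)) p (X p) = fd \<psi> p z + h p (X p) (Y p) *\<^sub>R \<psi> p"
      using gs[OF pB] by blast
    then have "flat_deriv ?M \<psi> X Y p = fd \<psi> p (z + fd Y p (X p)) + h p (X p) (Y p) *\<^sub>R \<psi> p"
      using e by (simp add: linear_add[OF lin[OF pB]])
    then show "\<exists>z. flat_deriv ?M \<psi> X Y p = mderiv ?M \<psi> p z + h p (X p) (Y p) *\<^sub>R \<psi> p"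
      unfolding md[OF pB] by blast
  qed
  have imm: "hypersurface_immersion ?M \<psi>"
    unfolding hypersurface_immersion_def
  proof (intro conjI ballI)
    show "smooth_fun ?M (pts ?M) \<psi>" using sm smooth_fun_flat[OF B B, of \<psi>] by simp
    fix p assume "p \<in> pts ?M"
    then have p: "p \<in> B" by simp
    have "mderiv ?M \<psi> p = fd \<psi> p" using md[OF p] by blast
    moreover have "inj (fd \<psi> p)"
      unfolding linear_injective_0[OF lin[OF p]] using ind[OF p, of _ 0] by simp
    ultimately show "inj (mderiv ?M \<psi> p)" by simp
  qed
  have trans: "transversal_field ?M \<psi> \<psi>"
    unfolding transversal_field_def
  proof (intro conjI ballI notI)
    show "smooth_fun ?M (pts ?M) \<psi>" using sm smooth_fun_flat[OF B B, of \<psi>] by simp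
    fix p assume "p \<in> pts ?M" and "\<psi> p \<in> range (mderiv ?M \<psi> p)"
    then obtain u where p: "p \<in> B" and u: "\<psi> p = fd \<psi> p u" using md by auto
    then have "fd \<psi> p u + (- 1) *\<^sub>R \<psi> p = 0" by simp
    from ind[OF p this] show False by simp
  qed
  have "hyperbolic_affine_hypersphere ?M \<psi> \<psi> nabla h (\<lambda>p u. (- 1) *\<^sub>R u) (- 1)"
    unfolding hyperbolic_affine_hypersphere_def blaschke_structure_def
  proof (intro conjI imm trans gauss)
    show "weingarten_formula ?M \<psi> \<psi> (\<lambda>p u. (- 1) *\<^sub>R u)"
      unfolding weingarten_formula_def
      using linear_neg[OF lin] by (simp add: md)
    show "volume_condition ?M \<psi> \<psi> h"
      unfolding volume_condition_def using s by (simp add: md hyperbolic_sphere_on_def cong: option.case_cong)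
    show "\<forall>p\<in>pts ?M. \<forall>u. u \<noteq> 0 \<longrightarrow> 0 < h p u u"
      using s by (simp add: hyperbolic_sphere_on_def)
  qed auto
  then show ?thesis by blast
qed

section \<open>Coordinate vector fields\<close>

locale manifold_chart =
  fixes M :: "('a, 'n::finite) manifold" and U :: "'a set" and c :: "'a \<Rightarrow> real ^ 'n"
  assumes M: "smooth_manifold M" and chart: "(U, c) \<in> atlas M"
begin

abbreviation "ci \<equiv> inv_into U c"

lemma openin_U: "openin (mtop M) U" and open_image: "open (c ` U)"
  and homeo: "homeomorphic_map (subtopology (mtop M) U) (top_of_set (c ` U)) c"
  using M chart unfolding smooth_manifold_def by auto

lemma U_sub: "U \<subseteq> pts M"
  by (rule openin_subset[OF openin_U])

lemma inj_c: "inj_on c U"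
  using homeomorphic_imp_injective_map[OF homeo] U_sub by (simp add: inf_absorb2)

lemma ci_c [simp]: "p \<in> U \<Longrightarrow> ci (c p) = p"
  by (rule inv_into_f_f[OF inj_c])

lemma c_ci [simp]: "x \<in> c ` U \<Longrightarrow> c (ci x) = x"
  by (rule f_inv_into_f)

lemma ci_mem [simp]: "x \<in> c ` U \<Longrightarrow> ci x \<in> U"
  by (rule inv_into_into)

lemma open_image_Int: assumes "openin (mtop M) W" shows "open (c ` (U \<inter> W))"
proof -
  have "openin (subtopology (mtop M) U) (U \<inter> W)" by (rule openin_subtopology_Int2[OF assms])
  then have "openin (top_of_set (c ` U)) (c ` (U \<inter> W))"
    using homeomorphic_imp_open_map[OF homeo] by (simp add: open_map_def)
  then show ?thesis using open_image by (simp add: openin_open_eq)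
qed

lemma openin_preimage: assumes "open Q" "Q \<subseteq> c ` U" shows "openin (mtop M) (ci ` Q)"
proof -
  have "openin (top_of_set (c ` U)) Q" using assms open_image by (simp add: openin_open_eq)
  then have "openin (subtopology (mtop M) U) {p \<in> topspace (subtopology (mtop M) U). c p \<in> Q}"
    using homeomorphic_imp_continuous_map[OF homeo] by (simp add: continuous_map_def)
  moreover have "{p \<in> topspace (subtopology (mtop M) U). c p \<in> Q} = ci ` Q"
  proof
    show "{p \<in> topspace (subtopology (mtop M) U). c p \<in> Q} \<subseteq> ci ` Q"
      by (auto intro!: image_eqI[of _ ci "c _"])
    show "ci ` Q \<subseteq> {p \<in> topspace (subtopology (mtop M) U). c p \<in> Q}"
    proof
      fix p assume "p \<in> ci ` Q"
      then obtain x where x: "x \<in> Q" "p = ci x" by blast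
      then have "x \<in> c ` U" using assms(2) by blast
      then show "p \<in> {p \<in> topspace (subtopology (mtop M) U). c p \<in> Q}"
        using x U_sub ci_mem[of x] by auto
    qed
  qed
  ultimately show ?thesis using openin_U openin_trans_full by metis
qed

lemma continuous_map_ci: "continuous_map (top_of_set (c ` U)) (mtop M) ci"
proof -
  have "ci x \<in> topspace (mtop M)" if "x \<in> c ` U" for x using that U_sub ci_mem[of x] by blast
  moreover have "openin (top_of_set (c ` U)) {x \<in> c ` U. ci x \<in> W}" if W: "openin (mtop M) W" for W
  proof -
    have "{x \<in> c ` U. ci x \<in> W} = c ` (U \<inter> W)" by auto
    then show ?thesis using open_image_Int[OF W] open_image by (auto simp: openin_open_eq)
  qed
  ultimately show ?thesis by (simp add: continuous_map_def)
qed

lemma continuous_map_c: "continuous_map (subtopology (mtop M) U) euclidean c"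
  using homeomorphic_imp_continuous_map[OF homeo] by (simp add: continuous_map_in_subtopology)

lemma smooth_fun_chart: "smooth_fun M W F \<Longrightarrow> smooth_on (c ` (U \<inter> W)) (F \<circ> ci)"
  using chart unfolding smooth_fun_def by blast

lemma smooth_transition:
  assumes "(V, d) \<in> atlas M" shows "smooth_on (c ` (U \<inter> V)) (d \<circ> ci)"
  using M chart assms unfolding smooth_manifold_def by blast

end

section \<open>Change of charts for tangent vectors\<close>

lemma chart_at_mem:
  assumes "smooth_manifold M" "p \<in> pts M"
  shows "chart_at M p \<in> atlas M" "p \<in> fst (chart_at M p)"
proof -
  have "\<exists>C. C \<in> atlas M \<and> p \<in> fst C"
    using assms unfolding smooth_manifold_def by fastforce
  from someI_ex[OF this] show "chart_at M p \<in> atlas M" "p \<in> fst (chart_at M p)"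
    by (auto simp: chart_at_def)
qed

text \<open>The chain rule across two charts and the fact that the Jacobians of the two transitions
  are mutually inverse. One chart will be the uncontrolled preferred chart of a point, the other a
  fixed chart.\<close>

lemma transition_derivative:
  assumes "manifold_chart M U c" "manifold_chart M V d" "p \<in> U" "p \<in> V"
  shows "((F \<circ> inv_into U c) differentiable (at (c p)) \<Longrightarrow>
      fd (F \<circ> inv_into V d) (d p) u = fd (F \<circ> inv_into U c) (c p) (fd (c \<circ> inv_into V d) (d p) u))"
    "fd (c \<circ> inv_into V d) (d p) (fd (d \<circ> inv_into U c) (c p) u) = u"
    "linear (fd (c \<circ> inv_into V d) (d p))"
proof -
  interpret U: manifold_chart M U c by fact
  interpret V: manifold_chart M V d by fact
  have o: "open (d ` (V \<inter> U))" by (rule V.open_image_Int[OF U.openin_U])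
  have dp: "d p \<in> d ` (V \<inter> U)" using assms(3,4) by blast
  have sm: "smooth_on (d ` (V \<inter> U)) (c \<circ> V.ci)" by (rule V.smooth_transition[OF U.chart])
  have dc: "((c \<circ> V.ci) has_derivative fd (c \<circ> V.ci) (d p)) (at (d p))"
    by (rule smooth_on_has_derivative[OF sm dp])
  show "linear (fd (c \<circ> V.ci) (d p))" by (rule smooth_on_linear_fd[OF sm dp])
  have cc: "(c \<circ> V.ci) (d p) = c p" using assms(4) by simp
  show chain: "fd (F \<circ> V.ci) (d p) u = fd (F \<circ> U.ci) (c p) (fd (c \<circ> V.ci) (d p) u)"
    if F: "(F \<circ> U.ci) differentiable (at (c p))" for F :: "_ \<Rightarrow> 'w::real_normed_vector" and u
  proof -
    have "((F \<circ> U.ci) has_derivative fd (F \<circ> U.ci) (c p)) (at ((c \<circ> V.ci) (d p)))"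
      unfolding cc using F frechet_derivative_works by blast
    from has_derivative_compose[OF dc this]
    have "fd (\<lambda>x. (F \<circ> U.ci) ((c \<circ> V.ci) x)) (d p) u = fd (F \<circ> U.ci) (c p) (fd (c \<circ> V.ci) (d p) u)"
      by (simp add: fd_eq)
    moreover have "fd (\<lambda>x. (F \<circ> U.ci) ((c \<circ> V.ci) x)) (d p) = fd (F \<circ> V.ci) (d p)"
      by (rule fd_cong[OF o dp]) auto
    ultimately show ?thesis by simp
  qed
  have o': "open (c ` (U \<inter> V))" by (rule U.open_image_Int[OF V.openin_U])
  have cp: "c p \<in> c ` (U \<inter> V)" using assms(3,4) by blast
  have sm': "smooth_on (c ` (U \<inter> V)) (d \<circ> U.ci)" by (rule U.smooth_transition[OF V.chart])
  have dd: "((d \<circ> U.ci) has_derivative fd (d \<circ> U.ci) (c p)) (at (c p))"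
    by (rule smooth_on_has_derivative[OF sm' cp])
  have "(d \<circ> U.ci) (c p) = d p" using assms(3) by simp
  from has_derivative_compose[OF dd dc[folded this]]
  have "fd (\<lambda>x. (c \<circ> V.ci) ((d \<circ> U.ci) x)) (c p) u = fd (c \<circ> V.ci) (d p) (fd (d \<circ> U.ci) (c p) u)"
    using assms(3) by (simp add: fd_eq)
  moreover have "fd (\<lambda>x. (c \<circ> V.ci) ((d \<circ> U.ci) x)) (c p) = fd (\<lambda>x. x) (c p)"
    by (rule fd_cong[OF o' cp]) auto
  ultimately show "fd (c \<circ> V.ci) (d p) (fd (d \<circ> U.ci) (c p) u) = u" by simp
qed

context manifold_chart
begin

text \<open>The coordinate vector field with constant components \<open>u\<close> in the chart \<open>c\<close>. The map \<open>J\<close> gives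
  the components in \<open>c\<close> of a tangent vector, which is itself written in the preferred chart.\<close>

definition coord_field :: "real ^ 'n \<Rightarrow> 'a \<Rightarrow> real ^ 'n" where
  "coord_field u p = (case chart_at M p of (V, d) \<Rightarrow> fd (d \<circ> ci) (c p) u)"

abbreviation "J \<equiv> mderiv M c"

lemma preferred_chart:
  assumes "p \<in> U"
  obtains V d where "chart_at M p = (V, d)" "manifold_chart M V d" "p \<in> V"
proof -
  obtain V d where "chart_at M p = (V, d)" by fastforce
  then show thesis
    using that[of V d] chart_at_mem[OF M, of p] assms U_sub M by (auto simp: manifold_chart_def)
qed

lemma self_chart: "manifold_chart M U c"
  by unfold_locales

text \<open>Removes the preferred chart from a derivative: only \<open>J\<close> still refers to it,
  and \<open>coord_field\<close> inverts \<open>J\<close>.\<close>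

lemma mderiv_chain:
  assumes p: "p \<in> U" and F: "(F \<circ> ci) differentiable (at (c p))"
  shows "mderiv M F p w = fd (F \<circ> ci) (c p) (J p w)"
proof -
  obtain V d where *: "chart_at M p = (V, d)" "manifold_chart M V d" "p \<in> V" by (rule preferred_chart[OF p])
  show ?thesis
    using transition_derivative(1)[OF self_chart *(2) p *(3) F] by (simp add: mderiv_def *(1))
qed

lemma J_coord_field: assumes p: "p \<in> U" shows "J p (coord_field u p) = u"
proof -
  obtain V d where *: "chart_at M p = (V, d)" "manifold_chart M V d" "p \<in> V" by (rule preferred_chart[OF p])
  show ?thesis
    using transition_derivative(2)[OF self_chart *(2) p *(3)] by (simp add: mderiv_def coord_field_def *(1))
qed

lemma coord_field_J: assumes p: "p \<in> U" shows "coord_field (J p w) p = w"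
proof -
  obtain V d where *: "chart_at M p = (V, d)" "manifold_chart M V d" "p \<in> V" by (rule preferred_chart[OF p])
  show ?thesis
    using transition_derivative(2)[OF *(2) self_chart *(3) p] by (simp add: mderiv_def coord_field_def *(1))
qed

lemma linear_J: assumes p: "p \<in> U" shows "linear (J p)"
proof -
  obtain V d where *: "chart_at M p = (V, d)" "manifold_chart M V d" "p \<in> V" by (rule preferred_chart[OF p])
  have "J p = fd (c \<circ> inv_into V d) (d p)" by (rule ext) (simp add: mderiv_def *(1))
  then show ?thesis using transition_derivative(3)[OF self_chart *(2) p *(3)] by simp
qed

lemma linear_coord_field: assumes p: "p \<in> U" shows "linear (\<lambda>u. coord_field u p)"
proof -
  obtain V d where *: "chart_at M p = (V, d)" "manifold_chart M V d" "p \<in> V" by (rule preferred_chart[OF p])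
  show ?thesis
    using transition_derivative(3)[OF *(2) self_chart *(3) p] by (simp add: coord_field_def *(1))
qed

lemma mderiv_coord_field:
  "p \<in> U \<Longrightarrow> (F \<circ> ci) differentiable (at (c p)) \<Longrightarrow> mderiv M F p (coord_field u p) = fd (F \<circ> ci) (c p) u"
  by (simp add: mderiv_chain J_coord_field)

text \<open>The components in a chart \<open>d\<close> are a directional derivative of the
  transition from \<open>c\<close> to \<open>d\<close>, hence smooth. Smoothness of these components
  as functions is in turn tested in a third chart \<open>d'\<close>.\<close>

lemma vector_field_coord_field: "vector_field M U (coord_field u)"
  unfolding vector_field_def
proof (clarify)
  fix V d assume V: "(V, d) \<in> atlas M"
  interpret V: manifold_chart M V d using M V by unfold_locales
  have o: "open (c ` (U \<inter> V))" by (rule open_image_Int[OF V.openin_U])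
  have sm: "smooth_on (c ` (U \<inter> V)) (\<lambda>x. fd (d \<circ> ci) x u)"
    by (rule smooth_on_fd[OF smooth_transition[OF V]])
  have eq: "mderiv M d q (coord_field u q) = fd (d \<circ> ci) (c q) u" if "q \<in> V" "q \<in> U" for q
    by (rule mderiv_coord_field[OF that(2) smooth_on_differentiable[OF smooth_transition[OF V]]])
      (use that in blast)
  show "smooth_fun M (V \<inter> U) (\<lambda>q. mderiv M d q (coord_field u q))"
    unfolding smooth_fun_def
  proof clarify
    fix V' d' assume V': "(V', d') \<in> atlas M"
    interpret V': manifold_chart M V' d' using M V' by unfold_locales
    have o': "open (d' ` (V' \<inter> (V \<inter> U)))" by (rule V'.open_image_Int[OF openin_Int[OF V.openin_U openin_U]])
    have "smooth_on (d' ` (V' \<inter> (V \<inter> U))) (c \<circ> V'.ci)"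
      by (rule smooth_on_subset[OF V'.smooth_transition[OF chart]]) auto
    then have "smooth_on (d' ` (V' \<inter> (V \<inter> U))) (\<lambda>y. fd (d \<circ> ci) ((c \<circ> V'.ci) y) u)"
      by (rule smooth_on_compose[OF o' _ _ sm, rotated]) auto
    then show "smooth_on (d' ` (V' \<inter> (V \<inter> U))) ((\<lambda>q. mderiv M d q (coord_field u q)) \<circ> V'.ci)"
      by (rule smooth_on_cong[OF o', rotated]) (auto simp: eq)
  qed
qed

lemma smooth_component: "smooth_fun M U (\<lambda>q. c q $ i)"
  unfolding smooth_fun_def
proof clarify
  fix V d assume V: "(V, d) \<in> atlas M"
  interpret V: manifold_chart M V d using M V by unfold_locales
  have "smooth_on (d ` (V \<inter> U)) (\<lambda>x. (c \<circ> V.ci) x $ i)"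
    by (rule smooth_on_vec_nth[OF V.open_image_Int[OF openin_U] V.smooth_transition[OF chart]])
  then show "smooth_on (d ` (V \<inter> U)) ((\<lambda>q. c q $ i) \<circ> V.ci)" by (simp add: o_def)
qed

lemma smooth_vector_field_components:
  assumes "vector_field M (pts M) X"
  shows "smooth_on (c ` U) (\<lambda>x. J (ci x) (X (ci x)))"
proof -
  have eq: "U \<inter> pts M = U" using U_sub by auto
  have "smooth_fun M (U \<inter> pts M) (\<lambda>q. J q (X q))" using assms chart unfolding vector_field_def by blast
  from smooth_fun_chart[OF this] show ?thesis by (simp add: eq o_def)
qed

section \<open>The structure equations for coordinate fields\<close>

lemma coordinate_smooth:
  assumes "blaschke_structure M \<phi> \<xi> nabla h S"
  shows "smooth_on (c ` U) (\<phi> \<circ> ci)" "smooth_on (c ` U) (\<xi> \<circ> ci)"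
proof -
  have "U \<inter> pts M = U" using U_sub by auto
  then show "smooth_on (c ` U) (\<phi> \<circ> ci)" and "smooth_on (c ` U) (\<xi> \<circ> ci)"
    using assms smooth_fun_chart[of "pts M" \<phi>] smooth_fun_chart[of "pts M" \<xi>]
    by (auto simp: blaschke_structure_def hypersurface_immersion_def transversal_field_def)
qed

lemma coordinate_gauss:
  fixes \<phi> \<xi> :: "'a \<Rightarrow> real ^ 'n option"
  assumes bl: "blaschke_structure M \<phi> \<xi> nabla h S" and p: "p \<in> U"
  shows "mderiv M \<phi> p (coord_field u p) = fd (\<phi> \<circ> ci) (c p) u"
    "mderiv M \<xi> p (coord_field u p) = fd (\<xi> \<circ> ci) (c p) u"
    "fd (\<lambda>x. fd (\<phi> \<circ> ci) x v) (c p) u = fd (\<phi> \<circ> ci) (c p) (J p (nabla (coord_field u) (coord_field v) p))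
       + h p (coord_field u p) (coord_field v p) *\<^sub>R \<xi> p"
proof -
  note s\<phi> = coordinate_smooth(1)[OF bl] and s\<xi> = coordinate_smooth(2)[OF bl]
  have cq: "c q \<in> c ` U" if "q \<in> U" for q using that by blast
  have d\<phi>: "mderiv M \<phi> q (coord_field u q) = fd (\<phi> \<circ> ci) (c q) u" if "q \<in> U" for q u
    by (rule mderiv_coord_field[OF that smooth_on_differentiable[OF s\<phi> cq[OF that]]])
  show "mderiv M \<phi> p (coord_field u p) = fd (\<phi> \<circ> ci) (c p) u" by (rule d\<phi>[OF p])
  show "mderiv M \<xi> p (coord_field u p) = fd (\<xi> \<circ> ci) (c p) u"
    by (rule mderiv_coord_field[OF p smooth_on_differentiable[OF s\<xi> cq[OF p]]])
  let ?D = "\<lambda>q. mderiv M \<phi> q (coord_field v q)"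
  have e: "fd (\<phi> \<circ> ci) x v = (?D \<circ> ci) x" if "x \<in> c ` U" for x
    using d\<phi>[OF ci_mem[OF that]] that by simp
  have sD: "smooth_on (c ` U) (?D \<circ> ci)"
    by (rule smooth_on_cong[OF open_image e smooth_on_fd[OF s\<phi>]])
  have "flat_deriv M \<phi> (coord_field u) (coord_field v) p = fd (?D \<circ> ci) (c p) u"
    unfolding flat_deriv_def
    by (rule mderiv_coord_field[OF p smooth_on_differentiable[OF sD cq[OF p]]])
  also have "fd (?D \<circ> ci) (c p) = fd (\<lambda>x. fd (\<phi> \<circ> ci) x v) (c p)"
    by (rule fd_cong[OF open_image cq[OF p], symmetric]) (rule e)
  finally have "fd (\<lambda>x. fd (\<phi> \<circ> ci) x v) (c p) u = flat_deriv M \<phi> (coord_field u) (coord_field v) p" by simp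
  also have "\<dots> = mderiv M \<phi> p (nabla (coord_field u) (coord_field v) p) + h p (coord_field u p) (coord_field v p) *\<^sub>R \<xi> p"
    using bl openin_U vector_field_coord_field p unfolding blaschke_structure_def gauss_formula_def by blast
  also have "mderiv M \<phi> p (nabla (coord_field u) (coord_field v) p) = fd (\<phi> \<circ> ci) (c p) (J p (nabla (coord_field u) (coord_field v) p))"
    by (rule mderiv_chain[OF p smooth_on_differentiable[OF s\<phi> cq[OF p]]])
  finally show "fd (\<lambda>x. fd (\<phi> \<circ> ci) x v) (c p) u = fd (\<phi> \<circ> ci) (c p) (J p (nabla (coord_field u) (coord_field v) p))
       + h p (coord_field u p) (coord_field v p) *\<^sub>R \<xi> p" .
qed

text \<open>Torsion is defined through the action on functions. Tested on the coordinate functions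
  of the chart, the bracket of two coordinate fields vanishes by symmetry of second derivatives, and
  these functions determine a tangent vector.\<close>

lemma coordinate_torsion_free:
  assumes tf: "torsion_free M D" and p: "p \<in> U"
  shows "J p (D (coord_field u) (coord_field v) p) = J p (D (coord_field v) (coord_field u) p)"
proof -
  have cp: "c p \<in> c ` U" using p by blast
  have *: "J p (D (coord_field u) (coord_field v) p - D (coord_field v) (coord_field u) p) $ i = 0" for i
  proof -
    let ?F = "\<lambda>q. c q $ i"
    have Fci: "(?F \<circ> ci) x = x $ i" if "x \<in> c ` U" for x using that by simp
    have sF: "smooth_on (c ` U) (?F \<circ> ci)"
      using smooth_fun_chart[OF smooth_component] by simp
    have dF: "mderiv M ?F q (coord_field w q) = fd (?F \<circ> ci) (c q) w" if "q \<in> U" for q w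
      by (rule mderiv_coord_field[OF that smooth_on_differentiable[OF sF]]) (use that in blast)
    have sd: "mderiv M (\<lambda>q. mderiv M ?F q (coord_field v q)) p (coord_field u p) = fd (\<lambda>x. fd (?F \<circ> ci) x v) (c p) u" for u v
    proof -
      have e: "fd (?F \<circ> ci) x v = ((\<lambda>q. mderiv M ?F q (coord_field v q)) \<circ> ci) x" if "x \<in> c ` U" for x
        using dF[OF ci_mem[OF that]] that by simp
      have "smooth_on (c ` U) ((\<lambda>q. mderiv M ?F q (coord_field v q)) \<circ> ci)"
        by (rule smooth_on_cong[OF open_image e smooth_on_fd[OF sF]])
      then have "mderiv M (\<lambda>q. mderiv M ?F q (coord_field v q)) p (coord_field u p) =
          fd ((\<lambda>q. mderiv M ?F q (coord_field v q)) \<circ> ci) (c p) u"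
        by (rule mderiv_coord_field[OF p smooth_on_differentiable[OF _ cp]])
      also have "fd ((\<lambda>q. mderiv M ?F q (coord_field v q)) \<circ> ci) (c p) = fd (\<lambda>x. fd (?F \<circ> ci) x v) (c p)"
        by (rule fd_cong[OF open_image cp, symmetric]) (rule e)
      finally show ?thesis .
    qed
    have "mderiv M ?F p (D (coord_field u) (coord_field v) p - D (coord_field v) (coord_field u) p) = 0"
      using tf openin_U vector_field_coord_field smooth_component[of i] p fd_commute[OF open_image cp sF, of u v]
      unfolding torsion_free_def by (simp add: sd)
    moreover have "mderiv M ?F p w = J p w $ i" for w
    proof -
      have "mderiv M ?F p w = fd (?F \<circ> ci) (c p) (J p w)"
        by (rule mderiv_chain[OF p smooth_on_differentiable[OF sF cp]])
      also have "fd (?F \<circ> ci) (c p) = fd (\<lambda>x. x $ i) (c p)"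
        by (rule fd_cong[OF open_image cp Fci])
      also have "\<dots> = (\<lambda>x. x $ i)"
        by (rule fd_eq[OF bounded_linear_imp_has_derivative[OF bounded_linear_vec_nth]])
      finally show ?thesis .
    qed
    ultimately show ?thesis by simp
  qed
  then have "J p (D (coord_field u) (coord_field v) p - D (coord_field v) (coord_field u) p) = 0"
    by (simp add: vec_eq_iff)
  then show ?thesis by (simp add: linear_diff[OF linear_J[OF p]])
qed

lemma coordinate_metric:
  assumes mc: "metric_connection M h D" and p: "p \<in> U"
    and sm: "((\<lambda>q. h q (coord_field v q) (coord_field w q)) \<circ> ci) differentiable (at (c p))"
  shows "fd ((\<lambda>q. h q (coord_field v q) (coord_field w q)) \<circ> ci) (c p) u =
    h p (D (coord_field u) (coord_field v) p) (coord_field w p) + h p (coord_field v p) (D (coord_field u) (coord_field w) p)"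
proof -
  have "mderiv M (\<lambda>q. h q (coord_field v q) (coord_field w q)) p (coord_field u p) =
    h p (D (coord_field u) (coord_field v) p) (coord_field w p) + h p (coord_field v p) (D (coord_field u) (coord_field w) p)"
    using mc openin_U vector_field_coord_field p unfolding metric_connection_def by blast
  then show ?thesis using mderiv_coord_field[OF p sm] by simp
qed

text \<open>For \<open>S = lam\<close> the Weingarten formula says that the sum of
  \<open>\<xi>\<close> and \<open>lam *\<^sub>R \<phi>\<close> has zero derivative. Its constant
  value, divided by \<open>lam\<close>, is the center.\<close>

lemma centered_hypersphere:
  fixes \<phi> \<xi> :: "'a \<Rightarrow> real ^ 'n option"
  assumes hs: "hyperbolic_affine_hypersphere M \<phi> \<xi> nabla h S lam" and B: "ball x0 r \<subseteq> c ` U"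
  obtains b where "\<And>x. x \<in> ball x0 r \<Longrightarrow> \<xi> (ci x) = (- lam) *\<^sub>R (\<phi> (ci x) - b)"
proof -
  have bl: "blaschke_structure M \<phi> \<xi> nabla h S" and lam: "lam < 0" and S: "\<And>p u. p \<in> pts M \<Longrightarrow> S p u = lam *\<^sub>R u"
    using hs by (auto simp: hyperbolic_affine_hypersphere_def)
  define k where "k x = (\<xi> \<circ> ci) x + lam *\<^sub>R (\<phi> \<circ> ci) x" for x
  have "(k has_derivative (\<lambda>_. 0)) (at x)" if "x \<in> ball x0 r" for x
  proof -
    have x: "x \<in> c ` U" using B that by blast
    have p: "ci x \<in> U" by (rule ci_mem[OF x])
    note cg = coordinate_smooth[OF bl] coordinate_gauss[OF bl p]
    have dk: "(k has_derivative (\<lambda>u. fd (\<xi> \<circ> ci) x u + lam *\<^sub>R fd (\<phi> \<circ> ci) x u)) (at x)"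
      unfolding k_def[abs_def]
      by (intro has_derivative_add has_derivative_scaleR_right smooth_on_has_derivative[OF cg(1) x]
        smooth_on_has_derivative[OF cg(2) x])
    have "fd (\<xi> \<circ> ci) x u + lam *\<^sub>R fd (\<phi> \<circ> ci) x u = 0" for u
    proof -
      have "mderiv M \<xi> (ci x) (coord_field u (ci x)) = - mderiv M \<phi> (ci x) (lam *\<^sub>R coord_field u (ci x))"
        using bl S p U_sub unfolding blaschke_structure_def weingarten_formula_def by (metis subsetD)
      moreover have "lam *\<^sub>R coord_field u (ci x) = coord_field (lam *\<^sub>R u) (ci x)"
        by (rule linear_scale[OF linear_coord_field[OF p], symmetric])
      ultimately have "fd (\<xi> \<circ> ci) x u = - fd (\<phi> \<circ> ci) x (lam *\<^sub>R u)"
        using x by (simp add: cg(3,4))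
      then show ?thesis by (simp add: linear_scale[OF smooth_on_linear_fd[OF cg(1) x]])
    qed
    then show ?thesis using dk by simp
  qed
  from constant_on_ball[OF this] have k: "k x = k x0" if "x \<in> ball x0 r" for x using that by blast
  show thesis
  proof (rule that[of "(1 / lam) *\<^sub>R k x0"])
    fix x assume "x \<in> ball x0 r"
    then have "\<xi> (ci x) + lam *\<^sub>R \<phi> (ci x) = k x0" using k[of x] by (simp add: k_def)
    then show "\<xi> (ci x) = (- lam) *\<^sub>R (\<phi> (ci x) - (1 / lam) *\<^sub>R k x0)" using lam by (simp add: algebra_simps)
  qed
qed

end

text \<open>The translation from the manifold to one chart: translate the center to the origin and
  evaluate every structure on coordinate fields. \<open>E\<close> turns chart components into
  tangent vectors and \<open>J\<close> is its inverse.\<close>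

lemma sphere_chart_of_manifold:
  fixes M :: "('a, 'k::finite option) manifold"
    and \<phi> \<xi> :: "'a \<Rightarrow> real ^ 'k option option"
    and T :: "'a \<Rightarrow> real ^ 'k option"
  assumes mc: "manifold_chart M U c"
    and hs: "hyperbolic_affine_hypersphere M \<phi> \<xi> nabla h S lam"
    and lc: "levi_civita_connection M h nabla_hat"
    and dt: "difference_tensor M nabla nabla_hat K"
    and dec: "\<And>p w. p \<in> pts M \<Longrightarrow> \<exists>u\<in>D1 p. \<exists>v\<in>D2 p. w = u + v"
    and orth: "\<And>p u v. p \<in> pts M \<Longrightarrow> u \<in> D1 p \<Longrightarrow> v \<in> D2 p \<Longrightarrow> h p u v = 0"
    and T: "vector_field M (pts M) T"
    and D1: "\<And>p. p \<in> pts M \<Longrightarrow> D1 p = span {T p} \<and> h p (T p) (T p) = 1"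
    and lam_eq: "- lam + lam1 * lam2 - lam2\<^sup>2 = 0"
    and K_T: "\<And>p. p \<in> pts M \<Longrightarrow> K p (T p) (T p) = lam1 *\<^sub>R T p"
    and K_U: "\<And>p u. p \<in> pts M \<Longrightarrow> u \<in> D2 p \<Longrightarrow> K p (T p) u = lam2 *\<^sub>R u"
    and B: "ball x0 r \<subseteq> c ` U"
  obtains b H \<Gamma> \<tau> \<Gamma>h where
    "sphere_chart_volume (ball x0 r) (\<lambda>x. \<phi> (inv_into U c x) - b) H \<Gamma> lam \<tau> \<Gamma>h lam1 lam2"
proof -
  interpret manifold_chart M U c by fact
  have bl: "blaschke_structure M \<phi> \<xi> nabla h S" and lam: "lam < 0"
    using hs by (auto simp: hyperbolic_affine_hypersphere_def)
  then have vol: "volume_condition M \<phi> \<xi> h" by (simp add: blaschke_structure_def)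
  obtain b where b: "\<And>x. x \<in> ball x0 r \<Longrightarrow> \<xi> (ci x) = (- lam) *\<^sub>R (\<phi> (ci x) - b)"
    using centered_hypersphere[OF hs B] by metis
  define f where "f x = (\<phi> \<circ> ci) x + (- b)" for x
  define E where "E u x = coord_field u (ci x)" for u x
  define H where "H x u v = h (ci x) (E u x) (E v x)" for x u v
  define \<Gamma> where "\<Gamma> x u v = J (ci x) (nabla (coord_field u) (coord_field v) (ci x))" for x u v
  define \<Gamma>h where "\<Gamma>h x u v = J (ci x) (nabla_hat (coord_field u) (coord_field v) (ci x))" for x u v
  define \<tau> where "\<tau> x = J (ci x) (T (ci x))" for x
  let ?B = "ball x0 r"
  have xU: "x \<in> c ` U" and pU: "ci x \<in> U" and pM: "ci x \<in> pts M" if "x \<in> ?B" for x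
    using B that U_sub ci_mem by blast+
  note s0 = coordinate_smooth(1)[OF bl]
  have sf: "smooth_on ?B f"
    unfolding f_def[abs_def] by (intro smooth_on_add smooth_on_const smooth_on_subset[OF s0 B]) auto
  have df: "fd f x u = fd (\<phi> \<circ> ci) x u" if x: "x \<in> ?B" for x u
    using has_derivative_add[OF smooth_on_has_derivative[OF s0 xU[OF x]] has_derivative_const[of "- b"]]
    unfolding f_def[abs_def] by (simp add: fd_eq)
  have dfE: "fd f x u = mderiv M \<phi> (ci x) (E u x)" if x: "x \<in> ?B" for x u
    using coordinate_gauss(1)[OF bl pU[OF x], of u] xU[OF x] by (simp add: df[OF x] E_def)
  have \<xi>f: "\<xi> (ci x) = (- lam) *\<^sub>R f x" if "x \<in> ?B" for x using b[OF that] by (simp add: f_def)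
  have JE: "J (ci x) (E u x) = u" if "x \<in> ?B" for x u unfolding E_def by (rule J_coord_field[OF pU[OF that]])
  have EJ: "E (J (ci x) w) x = w" if "x \<in> ?B" for x w unfolding E_def by (rule coord_field_J[OF pU[OF that]])
  have E\<tau>: "E (\<tau> x) x = T (ci x)" if "x \<in> ?B" for x unfolding \<tau>_def by (rule EJ[OF that])
  have Elin: "linear (\<lambda>u. E u x)" if "x \<in> ?B" for x unfolding E_def by (rule linear_coord_field[OF pU[OF that]])
  have Jlin: "linear (J (ci x))" if "x \<in> ?B" for x by (rule linear_J[OF pU[OF that]])
  interpret C: centroaffine_chart ?B f H \<Gamma> lam
  proof
    show "open ?B" by simp
    show "smooth_on ?B f" by (rule sf)
    show "lam < 0" by (rule lam)
    fix x assume x: "x \<in> ?B"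
    have lf: "linear (fd f x)" by (rule smooth_on_linear_fd[OF sf x])
    { fix u \<rho> assume e: "fd f x u + \<rho> *\<^sub>R f x = 0"
      \<comment> \<open>Otherwise the position vector relative to the center would be tangent, and
        so would \<open>\<xi>\<close>, its multiple by \<open>- lam\<close>.\<close>
      have "\<rho> = 0"
      proof (rule ccontr)
        assume \<rho>: "\<rho> \<noteq> 0"
        have "\<rho> *\<^sub>R f x = - fd f x u" using e by (simp add: eq_neg_iff_add_eq_0 add.commute)
        then have "(lam / \<rho>) *\<^sub>R (- (\<rho> *\<^sub>R f x)) = (lam / \<rho>) *\<^sub>R fd f x u" by simp
        then have "\<xi> (ci x) = fd f x ((lam / \<rho>) *\<^sub>R u)" using \<rho> by (simp add: \<xi>f[OF x] linear_scale[OF lf])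
        then have "\<xi> (ci x) \<in> range (mderiv M \<phi> (ci x))" by (simp add: dfE[OF x])
        then show False using bl pM[OF x] unfolding blaschke_structure_def transversal_field_def by blast
      qed
      then have "fd f x u = fd f x 0" using e by (simp add: linear_0[OF lf])
      then have "mderiv M \<phi> (ci x) (E u x) = mderiv M \<phi> (ci x) (E 0 x)" by (simp add: dfE[OF x])
      moreover have "inj (mderiv M \<phi> (ci x))"
        using bl pM[OF x] unfolding blaschke_structure_def hypersurface_immersion_def by blast
      ultimately have "E u x = E 0 x" by (meson injD)
      then have "u = 0" using JE[OF x] by metis
      with \<open>\<rho> = 0\<close> show "u = 0 \<and> \<rho> = 0" by simp }
    { fix u v
      have "fd (\<lambda>y. fd f y v) x = fd (\<lambda>y. fd (\<phi> \<circ> ci) y v) x"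
        by (rule fd_cong[OF open_ball x df])
      then show "fd (\<lambda>y. fd f y v) x u = fd f x (\<Gamma> x u v) - (lam * H x u v) *\<^sub>R f x"
        using coordinate_gauss(3)[OF bl pU[OF x], of v u] xU[OF x]
        by (simp add: df[OF x] \<Gamma>_def H_def E_def \<xi>f[OF x] mult.commute) }
    { fix u :: "real ^ 'k option" assume "u \<noteq> 0"
      then have "E u x \<noteq> 0" using JE[OF x] linear_0[OF Jlin[OF x]] by metis
      then show "H x u u > 0" using bl pM[OF x] unfolding H_def blaschke_structure_def by blast }
  qed
  have KE: "J (ci x) (K (ci x) (E u x) (E v x)) = \<Gamma> x u v - \<Gamma>h x u v" if x: "x \<in> ?B" for x u v
  proof -
    have "K (ci x) (E u x) (E v x) = nabla (coord_field u) (coord_field v) (ci x) - nabla_hat (coord_field u) (coord_field v) (ci x)"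
      unfolding E_def using dt openin_U vector_field_coord_field pU[OF x] unfolding difference_tensor_def by blast
    then show ?thesis by (simp add: \<Gamma>_def \<Gamma>h_def linear_diff[OF Jlin[OF x]])
  qed
  have tf: "torsion_free M nabla_hat" and met: "metric_connection M h nabla_hat"
    using lc by (auto simp: levi_civita_connection_def)
  have "sphere_chart_volume ?B f H \<Gamma> lam \<tau> \<Gamma>h lam1 lam2"
  proof unfold_locales
    show "smooth_on ?B \<tau>"
      unfolding \<tau>_def[abs_def] by (rule smooth_on_subset[OF smooth_vector_field_components[OF T] B])
    show "- lam + lam1 * lam2 - lam2\<^sup>2 = 0" by (rule lam_eq)
    fix x assume x: "x \<in> ?B"
    show unit: "H x (\<tau> x) (\<tau> x) = 1" using D1[OF pM[OF x]] by (simp add: H_def E\<tau>[OF x])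
    show "\<Gamma>h x u v = \<Gamma>h x v u" for u v
      unfolding \<Gamma>h_def by (rule coordinate_torsion_free[OF tf pU[OF x]])
    show "fd (\<lambda>y. H y v w) x u = H x (\<Gamma>h x u v) w + H x v (\<Gamma>h x u w)" for u v w
    proof -
      have "(\<lambda>y. H y v w) differentiable (at x)" by (rule smooth_on_differentiable[OF C.smooth_H x])
      then have "((\<lambda>q. h q (coord_field v q) (coord_field w q)) \<circ> ci) differentiable (at (c (ci x)))"
        using xU[OF x] by (simp add: H_def E_def o_def)
      from coordinate_metric[OF met pU[OF x] this, of u] show ?thesis
        using xU[OF x] by (simp add: H_def \<Gamma>h_def EJ[OF x] o_def) (simp add: E_def)
    qed
    show "\<Gamma> x (\<tau> x) (\<tau> x) - \<Gamma>h x (\<tau> x) (\<tau> x) = lam1 *\<^sub>R \<tau> x"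
      using KE[OF x, of "\<tau> x" "\<tau> x"] K_T[OF pM[OF x]] by (simp add: E\<tau>[OF x] linear_scale[OF Jlin[OF x]] \<tau>_def[symmetric])
    \<comment> \<open>A vector orthogonal to \<open>T\<close> belongs to the second distribution: in
      its decomposition the multiple of \<open>T\<close> is detected by pairing with
      \<open>T\<close>, which is a unit vector orthogonal to the other summand.\<close>
    show "\<Gamma> x (\<tau> x) u - \<Gamma>h x (\<tau> x) u = lam2 *\<^sub>R u" if "H x (\<tau> x) u = 0" for u
    proof -
      obtain a v where "a \<in> D1 (ci x)" and v: "v \<in> D2 (ci x)" and av: "E u x = a + v" using dec[OF pM[OF x]] by blast
      then obtain s where a: "a = s *\<^sub>R T (ci x)" using D1[OF pM[OF x]] by (auto simp: span_singleton)
      have "T (ci x) \<in> D1 (ci x)" using D1[OF pM[OF x]] by (simp add: span_base)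
      then have "h (ci x) (T (ci x)) v = 0" using orth[OF pM[OF x]] v by blast
      then have 0: "H x (\<tau> x) (J (ci x) v) = 0" by (simp add: H_def E\<tau>[OF x] EJ[OF x])
      have "u = s *\<^sub>R \<tau> x + J (ci x) v"
        using arg_cong[OF av, of "J (ci x)"] by (simp add: JE[OF x] linear_add[OF Jlin[OF x]] a linear_scale[OF Jlin[OF x]] \<tau>_def)
      then have "s = 0" using that unit 0 by (simp add: C.H_linear[OF x])
      then have "E u x \<in> D2 (ci x)" using av a v by simp
      from K_U[OF pM[OF x] this] KE[OF x, of "\<tau> x" u] show ?thesis
        by (simp add: E\<tau>[OF x] linear_scale[OF Jlin[OF x]] JE[OF x])
    qed
    show "\<bar>det (\<chi> a. case a of None \<Rightarrow> (- lam) *\<^sub>R f x | Some i \<Rightarrow> fd f x (X i))\<bar> = sqrt \<bar>det (\<chi> i j. H x (X i) (X j))\<bar>" for X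
    proof -
      have "\<bar>det (\<chi> a. case a of None \<Rightarrow> \<xi> (ci x) | Some i \<Rightarrow> mderiv M \<phi> (ci x) (E (X i) x))\<bar> =
        sqrt \<bar>det (\<chi> i j. h (ci x) (E (X i) x) (E (X j) x))\<bar>"
        by (rule vol[unfolded volume_condition_def, rule_format, OF pM[OF x], of "\<lambda>i. E (X i) x"])
      then show ?thesis by (simp add: \<xi>f[OF x] dfE[OF x] H_def cong: option.case_cong)
    qed
  qed
  moreover have "f = (\<lambda>x. \<phi> (ci x) - b)" by (simp add: f_def fun_eq_iff)
  ultimately show thesis using that by blast
qed

section \<open>Local parametrisations\<close>

lemma interval_times_flat:
  "interval_times I (flat_manifold B) = \<lparr>mtop = top_of_set (I \<times> B), atlas = {(I \<times> B, \<lambda>(t, p). emb t p)}\<rparr>"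
  by (simp add: interval_times_def flat_manifold_def prod_topology_subtopology_eu emb_def[abs_def])

lemma inj_emb_pair: "inj_on (\<lambda>(t, p). emb t p) X"
  by (auto simp: inj_on_def)

text \<open>Linear change of the first coordinate, from the arc length \<open>t\<close> of the
  adapted coordinates to the parameter of the Calabi product.\<close>

definition rescale :: "real \<Rightarrow> real ^ 'n::finite option \<Rightarrow> real ^ 'n option" where
  "rescale a y = emb (a * y $ None) (tail y)"

lemma rescale_emb [simp]: "rescale a (emb t q) = emb (a * t) q"
  by (simp add: rescale_def)

lemma bounded_linear_rescale: "bounded_linear (rescale a :: real ^ 'n::finite option \<Rightarrow> _)"
  unfolding linear_conv_bounded_linear[symmetric]
  by (intro linearI) (simp_all add: rescale_def tail_add tail_scaleR emb_add emb_scaleR algebra_simps)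

lemma continuous_on_emb_pair: "continuous_on X (\<lambda>z. emb (fst z) (snd z :: real ^ 'n::finite))"
proof -
  have "continuous_on X (\<lambda>z. fst z *\<^sub>R axis None 1 + emb 0 (snd z :: real ^ 'n))"
    by (intro continuous_intros bounded_linear.continuous_on[OF bounded_linear_emb])
  then show ?thesis by (simp add: emb_split[symmetric])
qed

context manifold_chart
begin

lemma smooth_chart_change:
  assumes V: "(V, d) \<in> atlas M" and W: "openin (mtop M) W" and f: "smooth_on Y f" "open Y" "f ` Y \<subseteq> c ` (U \<inter> (V \<inter> W))"
  shows "smooth_on Y (\<lambda>x. d (ci (f x)))"
proof -
  have "smooth_on (c ` (U \<inter> (V \<inter> W))) (d \<circ> ci)"
    by (rule smooth_on_subset[OF smooth_transition[OF V]]) auto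
  from smooth_on_compose[OF f(2,3,1) this] show ?thesis by simp
qed

end

text \<open>In the chart \<open>c\<close> the parametrisation is the map \<open>E\<close> on the
  open box \<open>X\<close>, with inverse \<open>L\<close>. Both are smooth between Euclidean
  spaces, so smoothness in any other chart follows by composing with a transition map.\<close>

lemma box_diffeomorphism:
  fixes M :: "('a, 'k::finite option) manifold" and \<Psi> g :: "real ^ 'k option \<Rightarrow> real ^ 'k option"
  assumes mc: "manifold_chart M U c" and a: "a \<noteq> 0"
    and hom: "homeomorphism Q V \<Psi> g" and Q: "open Q" "Q \<subseteq> c ` U" and V: "open V"
    and sm: "smooth_on Q \<Psi>" "smooth_on V g"
    and I: "open I" and B: "open B" and box: "\<And>t q. t \<in> I \<Longrightarrow> q \<in> B \<Longrightarrow> emb (a * t) q \<in> V"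
  defines "\<theta> \<equiv> \<lambda>(t, q). inv_into U c (g (emb (a * t) q))"
  shows "openin (mtop M) (\<theta> ` (I \<times> B))"
    "diffeomorphism (interval_times I (flat_manifold B)) (open_submanifold M (\<theta> ` (I \<times> B))) \<theta>"
proof -
  interpret manifold_chart M U c by fact
  have gQ: "g y \<in> Q" and \<Psi>g: "\<Psi> (g y) = y" if "y \<in> V" for y
    using hom that by (auto simp: homeomorphism_def)
  have \<Psi>V: "\<Psi> x \<in> V" and g\<Psi>: "g (\<Psi> x) = x" if "x \<in> Q" for x
    using hom that by (auto simp: homeomorphism_def)
  have gU: "g y \<in> c ` U" if "y \<in> V" for y using gQ[OF that] Q by blast
  let ?N = "\<theta> ` (I \<times> B)"
  define X where "X = {y. y $ None \<in> I \<and> tail y \<in> (B :: (real ^ 'k) set)}"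
  have oX: "open X"
  proof -
    have "X = (\<lambda>y. y $ None) -` I \<inter> tail -` B" by (auto simp: X_def)
    moreover have "open ((\<lambda>y :: real ^ 'k option. y $ None) -` I)"
      by (rule open_vimage[OF I]) (intro continuous_intros)
    moreover have "open (tail -` B)"
      by (rule open_vimage[OF B bounded_linear.continuous_on[OF bounded_linear_tail continuous_on_id]])
    ultimately show ?thesis by auto
  qed
  have X_emb: "X = (\<lambda>(t, q). emb t q) ` (I \<times> B)"
  proof
    show "X \<subseteq> (\<lambda>(t, q). emb t q) ` (I \<times> B)"
    proof
      fix y assume "y \<in> X"
      then show "y \<in> (\<lambda>(t, q). emb t q) ` (I \<times> B)"
        by (intro image_eqI[of _ _ "(y $ None, tail y)"]) (auto simp: X_def)
    qed
  qed (auto simp: X_def)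
  have rX: "rescale a y \<in> V" if "y \<in> X" for y
    using box that by (auto simp: X_emb)
  define E where "E y = g (rescale a y)" for y
  define L where "L x = rescale (1 / a) (\<Psi> x)" for x
  have resc: "rescale (1 / a) (rescale a y) = y" "rescale a (rescale (1 / a) y) = y" for y :: "real ^ 'k option"
    using a by (simp_all add: rescale_def)
  have LE: "L (E y) = y" if "y \<in> X" for y using that by (simp add: L_def E_def \<Psi>g rX resc)
  have EU: "E y \<in> c ` U" if "y \<in> X" for y unfolding E_def by (rule gU[OF rX[OF that]])
  have sE: "smooth_on X E"
    unfolding E_def[abs_def]
    by (rule smooth_on_compose[OF oX _ smooth_on_linear[OF bounded_linear_rescale oX smooth_on_ident] sm(2)]) (use rX in auto)
  have sL: "smooth_on Q L"
    unfolding L_def[abs_def] by (rule smooth_on_linear[OF bounded_linear_rescale Q(1) sm(1)])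
  define P where "P = E ` X"
  \<comment> \<open>Describing the image of the box as a preimage under the continuous map
    \<open>L\<close> shows that it is open.\<close>
  have P_eq: "P = {x \<in> Q. L x \<in> X}"
  proof
    show "P \<subseteq> {x \<in> Q. L x \<in> X}" using LE gQ rX by (auto simp: P_def E_def)
    show "{x \<in> Q. L x \<in> X} \<subseteq> P"
    proof
      fix x assume x: "x \<in> {x \<in> Q. L x \<in> X}"
      have "E (L x) = x" using x by (simp add: E_def L_def resc g\<Psi>)
      then show "x \<in> P" using x unfolding P_def by force
    qed
  qed
  have EL: "E (L x) = x" if "x \<in> P" for x using that LE by (auto simp: P_def)
  have oP: "open P"
  proof -
    have "P = Q \<inter> L -` X" using P_eq by auto
    then show ?thesis using continuous_open_preimage[OF smooth_on_continuous[OF sL] Q(1) oX] by simp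
  qed
  have PU: "P \<subseteq> c ` U" using EU by (auto simp: P_def)
  have \<theta>E: "\<theta> z = ci (E (emb (fst z) (snd z)))" for z by (simp add: \<theta>_def E_def case_prod_unfold)
  have N_eq: "?N = ci ` P"
    unfolding P_def X_emb image_image by (rule image_cong) (auto simp: \<theta>E)
  show oN: "openin (mtop M) ?N" unfolding N_eq by (rule openin_preimage[OF oP PU])
  have NU: "?N \<subseteq> U" using PU ci_mem unfolding N_eq by blast
  have NM: "pts M \<inter> ?N = ?N" using NU U_sub by blast
  have cN: "c p \<in> P" "ci (c p) = p" if "p \<in> ?N" for p
    using that PU unfolding N_eq by (auto simp: subset_iff)
  define \<theta>i where "\<theta>i p = (L (c p) $ None, tail (L (c p)))" for p
  have emb_\<theta>i: "emb (fst (\<theta>i p)) (snd (\<theta>i p)) = L (c p)" for p by (simp add: \<theta>i_def)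
  have \<theta>i_mem: "\<theta>i p \<in> I \<times> B" if "p \<in> ?N" for p
    using cN(1)[OF that] by (auto simp: P_eq X_def \<theta>i_def)
  have \<theta>_\<theta>i: "\<theta> (\<theta>i p) = p" if "p \<in> ?N" for p
    using cN[OF that] by (simp add: \<theta>E emb_\<theta>i EL)
  have \<theta>i_\<theta>: "\<theta>i (\<theta> z) = z" if "z \<in> I \<times> B" for z
  proof -
    have z: "emb (fst z) (snd z) \<in> X" using that by (auto simp: X_emb)
    then have "L (c (\<theta> z)) = emb (fst z) (snd z)" using EU by (simp add: \<theta>E LE)
    then show ?thesis by (simp add: \<theta>i_def)
  qed
  have inj: "inj_on \<theta> (I \<times> B)" using \<theta>i_\<theta> by (metis inj_onI)
  have inv: "inv_into (I \<times> B) \<theta> p = \<theta>i p" if "p \<in> ?N" for p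
    using inv_into_f_f[OF inj \<theta>i_mem[OF that]] \<theta>_\<theta>i[OF that] by simp
  let ?I = "interval_times I (flat_manifold B)" and ?S = "open_submanifold M ?N"
  have ptsI: "pts ?I = I \<times> B" and mtopI: "mtop ?I = top_of_set (I \<times> B)"
    and atlasI: "atlas ?I = {(I \<times> B, \<lambda>(t, p). emb t p)}" by (simp_all add: interval_times_flat)
  have mtopS: "mtop ?S = subtopology (mtop M) ?N" by (simp add: open_submanifold_def)
  have atlasS: "atlas ?S = (\<lambda>(U, c). (U \<inter> ?N, c)) ` atlas M" by (simp add: open_submanifold_def)
  have ptsS: "pts ?S = ?N" unfolding mtopS topspace_subtopology by (rule NM)
  show "diffeomorphism ?I ?S \<theta>"
    unfolding diffeomorphism_def
  proof (intro conjI)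
    show "bij_betw \<theta> (pts ?I) (pts ?S)" unfolding ptsI ptsS using inj by (simp add: bij_betw_def)
    show "smooth_map ?I ?S \<theta>"
      unfolding smooth_map_def
    proof (intro conjI)
      have "continuous_on (I \<times> B) (\<lambda>z. E (emb (fst z) (snd z)))"
        by (rule continuous_on_compose2[OF smooth_on_continuous[OF sE] continuous_on_emb_pair]) (auto simp: X_emb)
      then have "continuous_map (top_of_set (I \<times> B)) (top_of_set (c ` U)) (\<lambda>z. E (emb (fst z) (snd z)))"
        using EU[unfolded X_def] by (simp add: continuous_map_in_subtopology mem_Times_iff Pi_iff)
      from continuous_map_compose[OF this continuous_map_ci]
      have "continuous_map (top_of_set (I \<times> B)) (mtop M) \<theta>" by (simp add: o_def \<theta>E[abs_def])
      then show "continuous_map (mtop ?I) (mtop ?S) \<theta>"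
        unfolding mtopI mtopS by (auto simp: continuous_map_in_subtopology)
      show "\<forall>(U, c)\<in>atlas ?I. \<forall>(V, d)\<in>atlas ?S. smooth_on (c ` {p \<in> U. \<theta> p \<in> V}) (d \<circ> \<theta> \<circ> inv_into U c)"
        unfolding atlasI atlasS
      proof (simp only: ball_simps prod.case simp_thms, rule ballI)
        fix C assume C: "C \<in> atlas M"
        obtain V' d where C_eq: "C = (V', d)" by fastforce
        then have V': "(V', d) \<in> atlas M" using C by simp
        interpret V': manifold_chart M V' d using M V' by unfold_locales
        let ?e = "\<lambda>(t, p). emb t p :: real ^ 'k option"
        let ?Z = "?e ` {z \<in> I \<times> B. \<theta> z \<in> V' \<inter> ?N}"
        \<comment> \<open>Smoothness is tested on the part of the box that lands in the chart
          \<open>d\<close>; as a preimage under \<open>E\<close> this part is open.\<close>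
        have Z: "?Z = {y \<in> X. E y \<in> c ` (U \<inter> (V' \<inter> ?N))}"
        proof
          show "?Z \<subseteq> {y \<in> X. E y \<in> c ` (U \<inter> (V' \<inter> ?N))}"
          proof
            fix y assume "y \<in> ?Z"
            then obtain z where z: "z \<in> I \<times> B" "\<theta> z \<in> V'" "\<theta> z \<in> ?N" "y = emb (fst z) (snd z)" by auto
            have y: "y \<in> X" using z by (auto simp: X_emb)
            then have "E y = c (\<theta> z)" using EU by (simp add: \<theta>E z(4))
            then show "y \<in> {y \<in> X. E y \<in> c ` (U \<inter> (V' \<inter> ?N))}" using y z NU by blast
          qed
          show "{y \<in> X. E y \<in> c ` (U \<inter> (V' \<inter> ?N))} \<subseteq> ?Z"
          proof
            fix y assume "y \<in> {y \<in> X. E y \<in> c ` (U \<inter> (V' \<inter> ?N))}"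
            then obtain p where y: "y \<in> X" and p: "p \<in> U" "p \<in> V'" "p \<in> ?N" "E y = c p" by auto
            have "\<theta> (y $ None, tail y) = p" using p by (simp add: \<theta>E)
            then show "y \<in> ?Z" using y p by (intro image_eqI[of _ _ "(y $ None, tail y)"]) (auto simp: X_def)
          qed
        qed
        have oZ: "open ?Z"
        proof -
          have "open (X \<inter> E -` (c ` (U \<inter> (V' \<inter> ?N))))"
            by (rule continuous_open_preimage[OF smooth_on_continuous[OF sE] oX open_image_Int[OF openin_Int[OF V'.openin_U oN]]])
          moreover have "X \<inter> E -` (c ` (U \<inter> (V' \<inter> ?N))) = ?Z" unfolding Z by auto
          ultimately show ?thesis by simp
        qed
        have ZX: "?Z \<subseteq> X" and EZ: "E ` ?Z \<subseteq> c ` (U \<inter> (V' \<inter> ?N))" unfolding Z by blast+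
        have "smooth_on ?Z (\<lambda>y. d (ci (E y)))"
          by (rule smooth_chart_change[OF V' oN smooth_on_subset[OF sE ZX] oZ EZ])
        then have "smooth_on ?Z (d \<circ> \<theta> \<circ> inv_into (I \<times> B) ?e)"
        proof (rule smooth_on_cong[OF oZ, rotated])
          fix y assume "y \<in> ?Z"
          then obtain z where z: "z \<in> I \<times> B" "y = ?e z" by blast
          then show "d (ci (E y)) = (d \<circ> \<theta> \<circ> inv_into (I \<times> B) ?e) y"
            using inv_into_f_f[OF inj_emb_pair z(1)] by (auto simp: \<theta>E)
        qed
        then show "case case C of (U, c) \<Rightarrow> (U \<inter> ?N, c) of (V, d) \<Rightarrow>
            smooth_on (?e ` {z \<in> I \<times> B. \<theta> z \<in> V}) (d \<circ> \<theta> \<circ> inv_into (I \<times> B) ?e)"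
          unfolding C_eq prod.case .
      qed
    qed
    show "smooth_map ?S ?I (inv_into (pts ?I) \<theta>)"
      unfolding smooth_map_def ptsI
    proof (intro conjI)
      have "continuous_map (subtopology (mtop M) ?N) (top_of_set P) c"
      proof -
        have "subtopology (mtop M) ?N = subtopology (subtopology (mtop M) U) ?N"
          using NU by (simp add: subtopology_subtopology inf_absorb2)
        then have "continuous_map (subtopology (mtop M) ?N) euclidean c"
          using continuous_map_from_subtopology[OF continuous_map_c] by metis
        then show ?thesis using cN by (auto simp: continuous_map_in_subtopology)
      qed
      moreover have "continuous_map (top_of_set P) (top_of_set (I \<times> B)) (\<lambda>x. (L x $ None, tail (L x)))"
      proof -
        have cL: "continuous_on P L" using smooth_on_continuous[OF sL] P_eq by (auto intro: continuous_on_subset)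
        have "continuous_on P (\<lambda>x. (L x $ None, tail (L x)))"
          by (intro continuous_intros cL bounded_linear.continuous_on[OF bounded_linear_tail])
        then show ?thesis by (auto simp: continuous_map_in_subtopology P_eq X_def)
      qed
      ultimately have "continuous_map (subtopology (mtop M) ?N) (top_of_set (I \<times> B)) ((\<lambda>x. (L x $ None, tail (L x))) \<circ> c)"
        by (rule continuous_map_compose)
      then show "continuous_map (mtop ?S) (mtop ?I) (inv_into (I \<times> B) \<theta>)"
        unfolding mtopI mtopS by (rule continuous_map_eq) (auto simp: inv \<theta>i_def)
      show "\<forall>(U, c)\<in>atlas ?S. \<forall>(V, d)\<in>atlas ?I. smooth_on (c ` {p \<in> U. inv_into (I \<times> B) \<theta> p \<in> V})
          (d \<circ> inv_into (I \<times> B) \<theta> \<circ> inv_into U c)"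
        unfolding atlasI atlasS
      proof (simp only: ball_simps prod.case simp_thms, rule ballI)
        fix C assume C: "C \<in> atlas M"
        obtain V' d where C_eq: "C = (V', d)" by fastforce
        then have V': "(V', d) \<in> atlas M" using C by simp
        interpret V': manifold_chart M V' d using M V' by unfold_locales
        let ?e = "\<lambda>(t, p). emb t p :: real ^ 'k option"
        have set_eq: "{p \<in> V' \<inter> ?N. inv_into (I \<times> B) \<theta> p \<in> I \<times> B} = V' \<inter> ?N"
          using inv \<theta>i_mem by auto
        have o: "open (d ` (V' \<inter> ?N))" by (rule V'.open_image_Int[OF oN])
        have sc: "smooth_on (d ` (V' \<inter> ?N)) (c \<circ> V'.ci)"
          by (rule smooth_on_subset[OF V'.smooth_transition[OF chart]]) (use NU in auto)
        have "smooth_on (d ` (V' \<inter> ?N)) (\<lambda>x. L ((c \<circ> V'.ci) x))"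
        proof (rule smooth_on_compose[OF o _ sc])
          show "smooth_on P L" by (rule smooth_on_subset[OF sL]) (auto simp: P_eq)
          show "(c \<circ> V'.ci) ` d ` (V' \<inter> ?N) \<subseteq> P"
          proof (rule image_subsetI)
            fix x assume "x \<in> d ` (V' \<inter> ?N)"
            then obtain p where p: "p \<in> V'" "p \<in> ?N" "x = d p" by blast
            show "(c \<circ> V'.ci) x \<in> P" using cN(1)[OF p(2)] p(1,3) by simp
          qed
        qed
        then have "smooth_on (d ` (V' \<inter> ?N)) (?e \<circ> inv_into (I \<times> B) \<theta> \<circ> inv_into (V' \<inter> ?N) d)"
        proof (rule smooth_on_cong[OF o, rotated])
          fix x assume "x \<in> d ` (V' \<inter> ?N)"
          then obtain p where p: "p \<in> V'" "p \<in> ?N" "x = d p" by blast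
          have "inv_into (V' \<inter> ?N) d x = p"
            unfolding p(3) by (rule inv_into_f_f[OF inj_on_subset[OF V'.inj_c]]) (use p in auto)
          then show "L ((c \<circ> V'.ci) x) = (?e \<circ> inv_into (I \<times> B) \<theta> \<circ> inv_into (V' \<inter> ?N) d) x"
            using p inv[OF p(2)] emb_\<theta>i[of p] by (simp add: case_prod_unfold)
        qed
        then show "case case C of (U, c) \<Rightarrow> (U \<inter> ?N, c) of (U, c) \<Rightarrow>
            smooth_on (c ` {p \<in> U. inv_into (I \<times> B) \<theta> p \<in> I \<times> B}) (?e \<circ> inv_into (I \<times> B) \<theta> \<circ> inv_into U c)"
          unfolding C_eq prod.case set_eq .
      qed
    qed
  qed
qed

theorem theorem1:
  fixes M :: "('a, 'k::finite option) manifold"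
    and \<phi> \<xi> :: "'a \<Rightarrow> real ^ 'k option option"
    and nabla nabla_hat :: "('a, 'k option) connection"
    and h :: "('a, 'k option) bilinear_field"
    and S :: "'a \<Rightarrow> real ^ 'k option \<Rightarrow> real ^ 'k option"
    and K :: "('a, 'k option) tensor21"
    and D1 D2 :: "'a \<Rightarrow> (real ^ 'k option) set"
    and T :: "'a \<Rightarrow> real ^ 'k option"
    and lam lam1 lam2 :: real
  assumes "smooth_manifold M"
    and "hyperbolic_affine_hypersphere M \<phi> \<xi> nabla h S lam"
    and "levi_civita_connection M h nabla_hat"
    and "difference_tensor M nabla nabla_hat K"
    and "smooth_distribution M D1" and "smooth_distribution M D2"
    and "\<forall>p\<in>pts M. D1 p \<inter> D2 p = {0} \<and> (\<forall>w. \<exists>u\<in>D1 p. \<exists>v\<in>D2 p. w = u + v)"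
    and "\<forall>p\<in>pts M. \<forall>u\<in>D1 p. \<forall>v\<in>D2 p. h p u v = 0"
    and "vector_field M (pts M) T"
    and "\<forall>p\<in>pts M. dim (D1 p) = 1 \<and> D1 p = span {T p} \<and> h p (T p) (T p) = 1"
    and "- lam + lam1 * lam2 - lam2\<^sup>2 = 0"
    and "\<forall>p\<in>pts M. K p (T p) (T p) = lam1 *\<^sub>R T p"
    and "\<forall>p\<in>pts M. \<forall>u\<in>D2 p. K p (T p) u = lam2 *\<^sub>R u"
  shows "locally_calabi_product_with_point M \<phi>"
  unfolding locally_calabi_product_with_point_def
proof
  fix p assume p: "p \<in> pts M"
  obtain U c where chart: "(U, c) \<in> atlas M" and pU: "p \<in> U"
    using assms(1) p unfolding smooth_manifold_def by auto
  then interpret manifold_chart M U c using assms(1) by unfold_locales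
  obtain r where r: "r > 0" "ball (c p) r \<subseteq> c ` U" using open_image pU openE by blast
  have "\<exists>b H \<Gamma> \<tau> \<Gamma>h. sphere_chart_volume (ball (c p) r) (\<lambda>x. \<phi> (ci x) - b) H \<Gamma> lam \<tau> \<Gamma>h lam1 lam2"
    by (rule sphere_chart_of_manifold[OF self_chart assms(2-4) _ _ assms(9) _ assms(11) _ _ r(2)])
      (use assms in blast)+
  then obtain b H \<Gamma> \<tau> \<Gamma>h where "sphere_chart_volume (ball (c p) r) (\<lambda>x. \<phi> (ci x) - b) H \<Gamma> lam \<tau> \<Gamma>h lam1 lam2"
    by blast
  then interpret S: sphere_chart_volume "ball (c p) r" "\<lambda>x. \<phi> (ci x) - b" H \<Gamma> lam \<tau> \<Gamma>h lam1 lam2 .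
  have cp: "c p \<in> ball (c p) r" using r by simp
  show "\<exists>N I (M1 :: (real ^ 'k, 'k) manifold) \<psi> \<xi> nabla h S \<theta> c1 c2 A b.
        openin (mtop M) N \<and> p \<in> N \<and>
        open I \<and> is_interval I \<and> smooth_manifold M1 \<and>
        hyperbolic_affine_hypersphere M1 \<psi> \<xi> nabla h S (-1) \<and> affine_center M1 \<psi> \<xi> 0 \<and>
        diffeomorphism (interval_times I M1) (open_submanifold M N) \<theta> \<and>
        c1 \<noteq> 0 \<and> c2 \<noteq> 0 \<and> linear A \<and> bij A \<and>
        (\<forall>t\<in>I. \<forall>q\<in>pts M1. \<phi> (\<theta> (t, q)) = A (calabi_product_point c1 c2 \<psi> (t, q)) + b)"
  proof (rule S.calabi_coordinates[OF cp])
    fix \<epsilon> Q V g \<Psi> A c1 c2 \<psi> h1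
    assume \<epsilon>: "\<epsilon> > 0" and Q: "open Q" "Q \<subseteq> ball (c p) r" "c p \<in> Q" and V: "open V"
      and hom: "homeomorphism Q V \<Psi> g" and sm: "smooth_on Q \<Psi>" "smooth_on V g" and \<Psi>0: "\<Psi> (c p) = 0"
      and box: "\<And>s (q :: real ^ 'k). \<bar>s\<bar> < \<epsilon> \<Longrightarrow> q \<in> ball 0 \<epsilon> \<Longrightarrow> emb s q \<in> V"
      and A: "linear A" "bij A" and c12: "c1 \<noteq> 0" "c2 \<noteq> 0" and sph: "hyperbolic_sphere_on (ball (0 :: real ^ 'k) \<epsilon>) \<psi> h1"
      and eq: "\<And>s q. \<bar>s\<bar> < \<epsilon> \<Longrightarrow> q \<in> ball 0 \<epsilon> \<Longrightarrow> \<phi> (ci (g (emb s q))) - b =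
        A (emb (c2 * exp (- (real CARD('k option) * lam2 * s))) ((c1 * exp (lam2 * s)) *\<^sub>R \<psi> q))"
    let ?B = "ball (0 :: real ^ 'k) \<epsilon>"
    define n where "n = sqrt (real CARD('k option))"
    have n: "n > 0" "n * n = real CARD('k option)" by (simp_all add: n_def)
    \<comment> \<open>With \<open>n\<close> the square root of the dimension, the exponents
      \<open>lam2 * s\<close> and dimension times \<open>lam2 * s\<close> become
      \<open>t / n\<close> and \<open>n * t\<close> for \<open>s = a * t\<close>, as in the
      normalisation of the Calabi product.\<close>
    define a where "a = 1 / (n * lam2)"
    have a: "a \<noteq> 0" using n S.nonzero by (simp add: a_def)
    \<comment> \<open>The radius is divided by the absolute value of \<open>a\<close>, which may be
      negative, so that \<open>a * t\<close> stays in the range of the adapted coordinate.\<close>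
    define I where "I = ball (0 :: real) (\<epsilon> / \<bar>a\<bar>)"
    have I: "\<bar>a * t\<bar> < \<epsilon>" if "t \<in> I" for t
      using that a by (simp add: I_def dist_real_def abs_mult field_simps)
    have box': "emb (a * t) q \<in> V" if "t \<in> I" "q \<in> ?B" for t q
      by (rule box[OF I[OF that(1)] that(2)])
    have QU: "Q \<subseteq> c ` U" using Q(2) r(2) by blast
    define \<theta> where "\<theta> = (\<lambda>(t, q). ci (g (emb (a * t) (q :: real ^ 'k))))"
    have oI: "open I" "is_interval I" by (simp_all add: I_def is_interval_ball_real)
    have oN: "openin (mtop M) (\<theta> ` (I \<times> ?B))"
      unfolding \<theta>_def by (rule box_diffeomorphism(1)[OF self_chart a hom Q(1) QU V sm oI(1) open_ball box'])
    have diffeo: "diffeomorphism (interval_times I (flat_manifold ?B)) (open_submanifold M (\<theta> ` (I \<times> ?B))) \<theta>"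
      unfolding \<theta>_def by (rule box_diffeomorphism(2)[OF self_chart a hom Q(1) QU V sm oI(1) open_ball box'])
    obtain nabla1 S1 where hs: "hyperbolic_affine_hypersphere (flat_manifold ?B) \<psi> \<psi> nabla1 h1 S1 (- 1)"
      using hyperbolic_sphere_flat[OF open_ball sph] by blast
    have center: "affine_center (flat_manifold ?B) \<psi> \<psi> 0"
      unfolding affine_center_def by (auto intro: exI[of _ "- 1"])
    have pN: "p \<in> \<theta> ` (I \<times> ?B)"
    proof (rule image_eqI[of _ _ "(0, 0)"])
      have "g 0 = c p" using hom Q(3) \<Psi>0 by (metis homeomorphism_apply1)
      then show "p = \<theta> (0, 0)" using pU by (simp add: \<theta>_def)
      show "(0, 0) \<in> I \<times> ?B" using \<epsilon> a by (simp add: I_def)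
    qed
    have prod: "\<phi> (\<theta> (t, q)) = A (calabi_product_point c1 c2 \<psi> (t, q)) + b" if t: "t \<in> I" and q: "q \<in> ?B" for t q
    proof -
      have e1: "lam2 * (a * t) = t / n" using S.nonzero by (simp add: a_def)
      have e2: "real CARD('k option) * lam2 * (a * t) = n * t"
        unfolding n(2)[symmetric] using S.nonzero n(1) by (simp add: a_def)
      have "calabi_product_point c1 c2 \<psi> (t, q) =
        emb (c2 * exp (- (real CARD('k option) * lam2 * (a * t)))) ((c1 * exp (lam2 * (a * t))) *\<^sub>R \<psi> q)"
        unfolding e1 e2 by (simp add: calabi_product_point_def emb_def n_def vec_eq_iff split: option.split)
      then show ?thesis using eq[OF I[OF t] q] by (simp add: \<theta>_def algebra_simps)
    qed
    show ?thesis
    proof (rule exI[of _ "\<theta> ` (I \<times> ?B)"], rule exI[of _ I], rule exI[of _ "flat_manifold ?B"], rule exI[of _ \<psi>],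
        rule exI[of _ \<psi>], rule exI[of _ nabla1], rule exI[of _ h1], rule exI[of _ S1], rule exI[of _ \<theta>],
        rule exI[of _ c1], rule exI[of _ c2], rule exI[of _ A], rule exI[of _ b], intro conjI ballI)
      fix t q assume "t \<in> I" "q \<in> pts (flat_manifold ?B)"
      then show "\<phi> (\<theta> (t, q)) = A (calabi_product_point c1 c2 \<psi> (t, q)) + b" using prod by simp
    qed (fact oN diffeo pN oI smooth_manifold_flat[OF open_ball] hs center c12 A)+
  qed
qed

end
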